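(* Let $d\in\mathbb{N}$, $T>0$, $a,b>0$, and let $\{a_n\}_{n\ge1}$ be a sequence of positive real numbers with $n^{d-1}\sqrt{g_d(n)}\ll a_n\ll n^d$. There exists $\lambda_c>0$ such that for any $\lambda\in[-\lambda_c,\lambda_c]$ (with $\lambda>-a$) the following holds. For any $H\in C^{1,\infty}([0,T]\times\mathbb{T}^d)$, any $1\le i\le d$, and any $\varepsilon>0$, $$\lim_{n\to\infty}\frac{n^d}{a_n^2}\log\mathbb{P}^n_{\rho_*}\Big(\sup_{0\le t\le T}\Big|\int_0^t\frac1{a_n}\sum_{x\in\mathbb{T}_n^d}\bar\eta_x(s)\bar\eta_{x+e_i}(s)H_s(\tfrac xn)\,ds\Big|>\varepsilon\Big)=-\infty.$$
   Context: Notation: $u_n\ll v_n$ means $u_n/v_n\to0$ as $n\to\infty$. $g_d(n)=n$ if $d=1$, $g_d(n)=\log n$ if $d=2$, $g_d(n)=1$ if $d\ge3$. $\mathbb{T}^d$ is the $d$-dimensional unit torus, $\mathbb{T}_n^d=\mathbb{Z}^d/(n\mathbb{Z}^d)$ the discrete torus, $e_1,\dots,e_d$ the canonical basis; $x\sim y$ means $\sum_i|x_i-y_i|=1$. $C^{1,\infty}([0,T]\times\mathbb{T}^d)$ is the space of functions continuously differentiable in time and smooth in space; $H_s=H(s,\cdot)$. The process: the state space is $\Omega_n=\{0,1\}^{\mathbb{T}_n^d}$. For parameters $a,b>0$ and $\lambda>-a$, $\eta(t)=\eta^n(t)$ is the continuous-time Markov process on $\Omega_n$ with generator $L_n=n^2L_n^{\rm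 ex}+L_n^{\rm r}$, where for $f:\Omega_n\to\mathbb{R}$, $$L_n^{\rm ex}f(\eta)=\sum_{x\in\mathbb{T}_n^d}\sum_{i=1}^d[f(\eta^{x,x+e_i})-f(\eta)],\qquad L_n^{\rm r}f(\eta)=\sum_{x\in\mathbb{T}_n^d}c_x(\eta)[f(\eta^x)-f(\eta)],$$ $\eta^{x,y}$ is $\eta$ with the values at $x$ and $y$ swapped, $\eta^x$ is $\eta$ with the value at $x$ replaced by $1-\eta_x$, and $$c_x(\eta)=\Big(a+\frac{\lambda}{2d}\sum_{y\sim x}\eta_y\Big)(1-\eta_x)+b\eta_x.$$ $\rho_*$ is the unique point of $(0,1)$ with $F(\rho_* )=0$, where $F(\rho)=(a+\lambda\rho)(1-\rho)-b\rho$. $\nu^n_{\rho_*}$ is the product Bernoulli measure on $\Omega_n$ with constant density $\rho_*$, $\mathbb{P}^n_{\rho_*}$ is the law on $D([0,T],\Omega_n)$ of the process started from $\nu^n_{\rho_*}$, and $\bar\eta_x=\eta_x-\rho_*$. *)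

theory Defs
  imports "HOL-Probability.Probability"
begin

section \<open>Asymptotic scales\<close>

definition much_less :: "(nat \<Rightarrow> real) \<Rightarrow> (nat \<Rightarrow> real) \<Rightarrow> bool" where
  "much_less u v \<longleftrightarrow> (\<lambda>n. u n / v n) \<longlonglongrightarrow> 0"

definition g_scale :: "nat \<Rightarrow> nat \<Rightarrow> real" where
  "g_scale d n = (if d = 1 then real n else if d = 2 then ln (real n) else 1)"

text \<open>Extended logarithm of a probability: \<open>log 0 = -\<infinity>\<close>, whereas \<open>ln 0 = 0\<close> on the reals.\<close>

definition elog :: "real \<Rightarrow> ereal" where
  "elog p = (if p \<le> 0 then -\<infinity> else ereal (ln p))"

section \<open>The discrete torus and its configurations\<close>

text \<open>The dimension is \<open>d = CARD('d)\<close>.  A point of \<open>\<int>\<^sup>d/(n\<int>\<^sup>d)\<close> is represented by its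
  representative with coordinates in \<open>{0..<n}\<close>, addition being taken modulo \<open>n\<close>.\<close>

definition sites :: "nat \<Rightarrow> (int ^ 'd) set" where
  "sites n = {x. \<forall>j. 0 \<le> x $ j \<and> x $ j < int n}"

definition shift :: "nat \<Rightarrow> 'd \<Rightarrow> int ^ 'd \<Rightarrow> int ^ 'd" where
  "shift n i x = (\<chi> j. (x + axis i 1) $ j mod int n)"

text \<open>\<open>x \<sim> y\<close> if \<open>\<Sum>\<^sub>i |x\<^sub>i - y\<^sub>i| = 1\<close>, where \<open>|x\<^sub>i - y\<^sub>i|\<close> is the distance in \<open>\<int>/n\<int>\<close>.\<close>

definition adj :: "nat \<Rightarrow> int ^ 'd::finite \<Rightarrow> int ^ 'd \<Rightarrow> bool" where
  "adj n x y \<longleftrightarrow>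
     (\<Sum>j\<in>UNIV. min ((x $ j - y $ j) mod int n) ((y $ j - x $ j) mod int n)) = 1"

definition embed :: "nat \<Rightarrow> int ^ 'd \<Rightarrow> real ^ 'd" where
  "embed n x = (\<chi> j. real_of_int (x $ j) / real n)"

text \<open>Occupation variables in \<open>{0,1}\<close> are encoded as booleans, and configurations are extended
  by \<open>False\<close> off the torus, which is the convention of \<^const>\<open>Pi_pmf\<close> below.\<close>

type_synonym 'd config = "int ^ 'd \<Rightarrow> bool"

definition Omega :: "nat \<Rightarrow> ('d::finite) config set" where
  "Omega n = {\<eta>. \<forall>x. x \<notin> sites n \<longrightarrow> \<not> \<eta> x}"

definition swap :: "('d::finite) config \<Rightarrow> int ^ 'd \<Rightarrow> int ^ 'd \<Rightarrow> 'd config" where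
  "swap \<eta> x y = \<eta>(x := \<eta> y, y := \<eta> x)"

definition flip :: "('d::finite) config \<Rightarrow> int ^ 'd \<Rightarrow> 'd config" where
  "flip \<eta> x = \<eta>(x := \<not> \<eta> x)"

definition bernoulli_config :: "nat \<Rightarrow> real \<Rightarrow> ('d::finite) config pmf" where
  "bernoulli_config n \<rho> = Pi_pmf (sites n) False (\<lambda>_. bernoulli_pmf \<rho>)"

section \<open>The generator\<close>

definition rate :: "real \<Rightarrow> real \<Rightarrow> real \<Rightarrow> nat \<Rightarrow> int ^ 'd::finite \<Rightarrow> 'd config \<Rightarrow> real" where
  "rate a b lam n x \<eta> =
     (a + lam / (2 * real CARD('d)) * (\<Sum>y | y \<in> sites n \<and> adj n x y. of_bool (\<eta> y)))
       * (1 - of_bool (\<eta> x)) + b * of_bool (\<eta> x)"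

definition Lex :: "nat \<Rightarrow> (('d::finite) config \<Rightarrow> real) \<Rightarrow> 'd config \<Rightarrow> real" where
  "Lex n f \<eta> = (\<Sum>x\<in>sites n. \<Sum>i\<in>UNIV. f (swap \<eta> x (shift n i x)) - f \<eta>)"

definition Lr :: "real \<Rightarrow> real \<Rightarrow> real \<Rightarrow> nat \<Rightarrow> (('d::finite) config \<Rightarrow> real) \<Rightarrow> 'd config \<Rightarrow> real" where
  "Lr a b lam n f \<eta> = (\<Sum>x\<in>sites n. rate a b lam n x \<eta> * (f (flip \<eta> x) - f \<eta>))"

definition gen :: "real \<Rightarrow> real \<Rightarrow> real \<Rightarrow> nat \<Rightarrow> (('d::finite) config \<Rightarrow> real) \<Rightarrow> 'd config \<Rightarrow> real" where
  "gen a b lam n f \<eta> = (real n)\<^sup>2 * Lex n f \<eta> + Lr a b lam n f \<eta>"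

definition reaction :: "real \<Rightarrow> real \<Rightarrow> real \<Rightarrow> real \<Rightarrow> real" where
  "reaction a b lam \<rho> = (a + lam * \<rho>) * (1 - \<rho>) - b * \<rho>"

definition rho_star :: "real \<Rightarrow> real \<Rightarrow> real \<Rightarrow> real" where
  "rho_star a b lam = (THE \<rho>. 0 < \<rho> \<and> \<rho> < 1 \<and> reaction a b lam \<rho> = 0)"

lemma rho_star_ex1:
  assumes "a > 0" "b > 0"
  shows "\<exists>!\<rho>. 0 < \<rho> \<and> \<rho> < 1 \<and> reaction a b lam \<rho> = 0"
proof (rule ex_ex1I)
  have "\<exists>x. 0 \<le> x \<and> x \<le> 1 \<and> reaction a b lam x = 0"
    unfolding reaction_def
    by (rule IVT2') (use assms in \<open>simp_all add: continuous_on_diff continuous_on_mult continuous_on_add\<close>)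
  then obtain x where x: "0 \<le> x" "x \<le> 1" "reaction a b lam x = 0" by blast
  moreover have "x \<noteq> 0" "x \<noteq> 1" using x assms by (auto simp: reaction_def)
  ultimately have "0 < x \<and> x < 1 \<and> reaction a b lam x = 0" by linarith
  then show "\<exists>x. 0 < x \<and> x < 1 \<and> reaction a b lam x = 0" ..
next
  fix x y assume A: "0 < x \<and> x < 1 \<and> reaction a b lam x = 0" "0 < y \<and> y < 1 \<and> reaction a b lam y = 0"
  have *: "a / z + lam = b / (1 - z)" if "0 < z \<and> z < 1 \<and> reaction a b lam z = 0" for z
  proof -
    have "z \<noteq> 0" "1 - z \<noteq> 0" and r: "(a + lam * z) * (1 - z) = b * z"
      using that by (auto simp: reaction_def)
    have "a / z + lam = (a + lam * z) / z"
      using \<open>z \<noteq> 0\<close> by (simp add: add_divide_distrib)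
    also have "\<dots> = b / (1 - z)"
      using r by (subst frac_eq_eq[OF \<open>z \<noteq> 0\<close> \<open>1 - z \<noteq> 0\<close>])
    finally show ?thesis .
  qed
  have "\<not> u < v" if "0 < u \<and> u < 1 \<and> reaction a b lam u = 0" "0 < v \<and> v < 1 \<and> reaction a b lam v = 0" for u v
  proof
    assume "u < v"
    then have "a / v < a / u" "b / (1 - u) < b / (1 - v)"
      using that assms by (simp_all add: divide_strict_left_mono)
    then show False using *[OF that(1)] *[OF that(2)] by linarith
  qed
  from this[OF A] this[OF A(2,1)] show "x = y" by linarith
qed

section \<open>Laws of continuous-time Markov processes on a finite state space\<close>

text \<open>The semigroup \<open>exp (tL)\<close> of a generator \<open>L\<close>.\<close>

definition gen_semigroup :: "(('s \<Rightarrow> real) \<Rightarrow> 's \<Rightarrow> real) \<Rightarrow> real \<Rightarrow> ('s \<Rightarrow> real) \<Rightarrow> 's \<Rightarrow> real" where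
  "gen_semigroup L t f \<eta> = (\<Sum>k. t ^ k / fact k * (L ^^ k) f \<eta>)"

text \<open>The cadlag paths \<open>D([0,T],S)\<close>.  As \<open>S\<close> carries the discrete topology, one-sided limits
  amount to being eventually constant on that side.\<close>

definition cadlag :: "'s set \<Rightarrow> real \<Rightarrow> (real \<Rightarrow> 's) set" where
  "cadlag S T = {\<omega> \<in> {0..T} \<rightarrow>\<^sub>E S.
     (\<forall>t\<in>{0..<T}. eventually (\<lambda>s. \<omega> s = \<omega> t) (at_right t)) \<and>
     (\<forall>t\<in>{0<..T}. \<exists>\<xi>\<in>S. eventually (\<lambda>s. \<omega> s = \<xi>) (at_left t))}"

text \<open>\<open>D([0,T],S)\<close> with the sigma-algebra generated by the coordinates, i.e. the Borel
  sigma-algebra of the Skorokhod topology.\<close>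

definition path_space :: "'s set \<Rightarrow> real \<Rightarrow> (real \<Rightarrow> 's) measure" where
  "path_space S T = restrict_space (PiM {0..T} (\<lambda>_. count_space S)) (cadlag S T)"

definition past :: "'s set \<Rightarrow> real \<Rightarrow> real \<Rightarrow> (real \<Rightarrow> 's) measure" where
  "past S T s = sigma (cadlag S T) {{\<omega> \<in> cadlag S T. \<omega> u \<in> A} | u A. 0 \<le> u \<and> u \<le> s \<and> A \<subseteq> S}"

text \<open>\<open>P\<close> is the law on \<open>D([0,T],S)\<close> of the Markov process with generator \<open>L\<close> and
  initial distribution \<open>\<mu>\<close>.\<close>

definition markov_law ::
  "'s set \<Rightarrow> (('s \<Rightarrow> real) \<Rightarrow> 's \<Rightarrow> real) \<Rightarrow> 's pmf \<Rightarrow> real \<Rightarrow> (real \<Rightarrow> 's) measure \<Rightarrow> bool" where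
  "markov_law S L \<mu> T P \<longleftrightarrow>
     prob_space P \<and>
     space P = cadlag S T \<and>
     sets P = sets (path_space S T) \<and>
     (\<forall>\<xi>\<in>S. \<P>(\<omega> in P. \<omega> 0 = \<xi>) = pmf \<mu> \<xi>) \<and>
     (\<forall>f s t. 0 \<le> s \<and> s \<le> t \<and> t \<le> T \<longrightarrow>
        (AE \<omega> in P. real_cond_exp P (past S T s) (\<lambda>\<omega>. f (\<omega> t)) \<omega>
                     = gen_semigroup L (t - s) f (\<omega> s)))"

section \<open>Test functions\<close>

text \<open>\<open>C\<^sup>1\<^sup>,\<^sup>\<infinity>([0,T] \<times> \<T>\<^sup>d)\<close>: functions on the torus are \<open>\<int>\<^sup>d\<close>-periodic functions on \<open>\<real>\<^sup>d\<close>.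
  The time derivative (one-sided at \<open>0\<close> and \<open>T\<close>) and all iterated spatial partial derivatives
  exist and are jointly continuous; \<open>D js\<close> is the iterated partial derivative in the directions
  listed in \<open>is\<close>.  No mixed time-space derivatives are required.\<close>

definition C1inf :: "real \<Rightarrow> (real \<Rightarrow> real ^ 'd::finite \<Rightarrow> real) set" where
  "C1inf T = {H.
     (\<forall>t\<in>{0..T}. \<forall>u i. H t (u + axis i 1) = H t u) \<and>
     (\<exists>H'. (\<forall>t\<in>{0..T}. \<forall>u. ((\<lambda>s. H s u) has_real_derivative H' t u) (at t within {0..T})) \<and>
           continuous_on ({0..T} \<times> UNIV) (\<lambda>(t, u). H' t u)) \<and>
     (\<exists>D. D [] = H \<and>
          (\<forall>js. continuous_on ({0..T} \<times> UNIV) (\<lambda>(t, u). D js t u)) \<and>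
          (\<forall>js i. \<forall>t\<in>{0..T}. \<forall>u.
             ((\<lambda>h. D js t (u + h *\<^sub>R axis i 1)) has_real_derivative D (i # js) t u) (at 0)))}"

text \<open>The integrand \<open>a\<^sub>n\<^sup>-\<^sup>1 \<Sum>\<^sub>x (\<eta>\<^sub>x - \<rho>)(\<eta>\<^sub>x\<^sub>+\<^sub>e\<^sub>i - \<rho>) h(x/n)\<close>, with \<open>\<alpha> = a\<^sub>n\<close>.\<close>

definition corr_field ::
  "nat \<Rightarrow> real \<Rightarrow> real \<Rightarrow> 'd::finite \<Rightarrow> (real ^ 'd \<Rightarrow> real) \<Rightarrow> 'd config \<Rightarrow> real" where
  "corr_field n \<alpha> \<rho> i h \<eta> =
     1 / \<alpha> * (\<Sum>x\<in>sites n. (of_bool (\<eta> x) - \<rho>) * (of_bool (\<eta> (shift n i x)) - \<rho>) * h (embed n x))"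

end

theory Submission
  imports Defs
begin

text \<open>
  Let \<open>e(x) = \<eta>(x) - \<rho>\<^sub>*\<close>, let \<open>\<nu>\<close> be the Bernoulli measure of density \<open>\<rho>\<^sub>*\<close>, and let
  \<open>W = \<gamma> \<Sum>\<^sub>x H\<^sub>s(x/n) e(x) e(x+e\<^sub>i)\<close> with a small constant \<open>\<gamma>\<close>.  By the Feynman-Kac formula and
  Chebyshev's inequality it suffices that \<open>\<langle>g, (L\<^sub>n + W) g\<rangle> \<le> \<Lambda> \<langle>g, g\<rangle>\<close> in \<open>L\<^sup>2(\<nu>)\<close> with \<open>\<Lambda>\<close> of order
  \<open>n\<^sup>d\<^sup>-\<^sup>2 g\<^sub>d(n)\<close>, which is negligible against \<open>a\<^sub>n\<^sup>2/n\<^sup>d\<close>.  As \<open>\<gamma>\<close> is a constant and not of order \<open>a\<^sub>n/n\<^sup>d\<close>,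
  the tails are of order \<open>exp (- c a\<^sub>n)\<close>; as \<open>a\<^sub>n \<ge> \<surd>n\<close> for large \<open>n\<close>, a union bound over a polynomially fine time
  grid handles the supremum.

  The measure \<open>\<nu>\<close> is not invariant, but by the choice of \<open>\<rho>\<^sub>*\<close> the defect has the same form as \<open>W\<close>, with
  the coefficient \<open>\<lambda>/(2d\<rho>\<^sub>*)\<close>.  For the spectral bound, \<open>2 g(\<eta>) g(\<eta>') \<le> g(\<eta>)\<^sup>2 exp \<alpha> + g(\<eta>')\<^sup>2 exp (-\<alpha>)\<close> is
  used with a different exponent for every transition.  This reduces it to finding a field \<open>w(x)\<close> that does
  not depend on \<open>\<eta>(x)\<close> and a field \<open>U(y,j)\<close> that does not depend on \<open>\<eta>(y)\<close>, \<open>\<eta>(y+e\<^sub>j)\<close> such that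
  \<open>\<Sum> G\<^sub>i(x) e(x) e(x+e\<^sub>i) + \<Sum> (2w(x)\<^sup>2/b - e(x) w(x)) + \<Sum> ((e(y+e\<^sub>j) - e(y)) U(y,j) + U(y,j)\<^sup>2/n\<^sup>2) \<le> \<Lambda>\<close>
  pointwise.  The field \<open>U\<close> replaces \<open>e(x+e\<^sub>i)\<close> by an average on the scale \<open>n\<close> along the flow of a Polya urn,
  whose energy is a sum of inverse cardinalities of discrete simplices and hence of order \<open>g\<^sub>d(n)\<close>.
  One part of \<open>w\<close> cancels the average.  The errors form a small positive semidefinite quadratic form of
  trace \<open>O(n\<^sup>d\<^sup>-\<^sup>2 g\<^sub>d(n))\<close>, and the other part of \<open>w\<close> damps everything but its trace.
\<close>

section \<open>Exponential moments of additive functionals\<close>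

lemma exp_le_quadratic:
  fixes x :: real
  assumes "x \<le> 1"
  shows "exp x \<le> 1 + x + x\<^sup>2"
proof (cases "x \<ge> 0")
  case True
  then show ?thesis using exp_bound[of x] assms by simp
next
  case False
  define y where "y = - x"
  have y: "y > 0" using False by (simp add: y_def)
  \<comment> \<open>For x = -y the claim reads 1 \<le> (1 - y + y^2) exp y. Replacing exp y by its
    Taylor polynomial 1 + y + y^2/2 gives a product without negative coefficients.\<close>
  have "1 \<le> 1 + y^2/2 + y^3/2 + y^4/2" using y by simp
  also have "\<dots> = (1 - y + y^2) * (1 + y + y^2/2)" by (simp add: field_simps power2_eq_square power3_eq_cube power4_eq_xxxx)
  also have "\<dots> \<le> (1 - y + y^2) * exp y"
  proof (rule mult_left_mono)
    show "1 + y + y^2/2 \<le> exp y" using exp_lower_Taylor_quadratic[of y] y by simp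
    have "1 - y + y^2 = (1 - y/2)^2 + 3/4 * y^2" by (simp add: power2_eq_square field_simps)
    then show "0 \<le> 1 - y + y^2" by simp
  qed
  finally have "exp (- y) \<le> 1 - y + y^2" by (simp add: exp_minus field_simps)
  then show ?thesis by (simp add: y_def)
qed

lemma abs_exp_minus_one_le:
  fixes y :: real shows "\<bar>exp y - 1\<bar> \<le> \<bar>y\<bar> * exp \<bar>y\<bar>"
proof (cases "y \<ge> 0")
  case True
  have "1 - y \<le> exp (- y)" using exp_ge_add_one_self[of "-y"] by simp
  then have "(1 - y) * exp y \<le> exp (- y) * exp y" by (intro mult_right_mono) auto
  then show ?thesis using True by (simp add: algebra_simps flip: exp_add)
next
  case False
  have "1 - exp y \<le> - y" using exp_ge_add_one_self[of y] by linarith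
  also have "\<dots> \<le> (- y) * exp (-y)" using False by simp
  finally show ?thesis using False by simp
qed

lemma abs_exp_remainder_le:
  fixes y :: real shows "\<bar>exp y - 1 - y\<bar> \<le> y\<^sup>2 * exp \<bar>y\<bar>"
proof -
  have "1 - y \<le> exp (- y)" using exp_ge_add_one_self[of "-y"] by simp
  then have "(1 - y) * exp y \<le> exp (- y) * exp y" by (intro mult_right_mono) auto
  then have "exp y - 1 - y \<le> y * (exp y - 1)" by (simp add: algebra_simps flip: exp_add)
  also have "\<dots> \<le> \<bar>y\<bar> * \<bar>exp y - 1\<bar>" by (metis abs_ge_self abs_mult)
  also have "\<dots> \<le> \<bar>y\<bar> * (\<bar>y\<bar> * exp \<bar>y\<bar>)" by (intro mult_left_mono abs_exp_minus_one_le) auto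
  finally have "exp y - 1 - y \<le> y\<^sup>2 * exp \<bar>y\<bar>"
    by (simp add: power2_eq_square flip: mult.assoc)
  then show ?thesis using exp_ge_add_one_self[of y] by linarith
qed

text \<open>\<open>C\<close> bounds the operator norm for the supremum over \<open>S\<close>, so the
  exponential series converges. By linearity, \<open>L_bound\<close> with bound 0 makes
  \<open>L f\<close> on \<open>S\<close> depend only on \<open>f\<close> on \<open>S\<close>,
  although \<open>L\<close> acts on functions on the whole type.\<close>

locale finite_generator =
  fixes S :: "'s set" and L :: "('s \<Rightarrow> real) \<Rightarrow> 's \<Rightarrow> real" and C :: real
  assumes finS: "finite S"
    and L_lin: "\<And>f g c \<eta>. L (\<lambda>x. f x + c * g x) \<eta> = L f \<eta> + c * L g \<eta>"
    and L_bound: "\<And>f M \<eta>. (\<And>\<xi>. \<xi> \<in> S \<Longrightarrow> \<bar>f \<xi>\<bar> \<le> M) \<Longrightarrow> \<eta> \<in> S \<Longrightarrow> \<bar>L f \<eta>\<bar> \<le> C * M"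
    and C_nonneg: "C \<ge> 0"
begin

lemma L_funpow_bound:
  assumes "\<And>\<xi>. \<xi> \<in> S \<Longrightarrow> \<bar>f \<xi>\<bar> \<le> M" "\<eta> \<in> S"
  shows "\<bar>(L ^^ k) f \<eta>\<bar> \<le> C ^ k * M"
  using assms(2)
proof (induction k arbitrary: \<eta>)
  case 0 then show ?case using assms by simp
next
  case (Suc k)
  have "\<bar>L ((L ^^ k) f) \<eta>\<bar> \<le> C * (C ^ k * M)"
    by (rule L_bound) (use Suc in auto)
  then show ?case by (simp add: mult.assoc)
qed

lemma semigroup_expansion:
  assumes f: "\<And>\<xi>. \<xi> \<in> S \<Longrightarrow> \<bar>f \<xi>\<bar> \<le> M" and \<eta>: "\<eta> \<in> S" and h: "0 \<le> h" "h \<le> 1"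
  shows "\<bar>gen_semigroup L h f \<eta> - f \<eta> - h * L f \<eta>\<bar> \<le> h\<^sup>2 * (C\<^sup>2 * exp C * M)"
proof -
  define a where "a k = h ^ k / fact k * (L ^^ k) f \<eta>" for k
  have M: "M \<ge> 0" using f[OF \<eta>] by linarith
  \<comment> \<open>Two powers of \<open>h\<close> are pulled out of every later term by
    h^(k+2)/(k+2)! \<le> h^2/k!; what remains sums to a multiple of \<open>exp C\<close>.\<close>
  have b: "\<bar>a (k + 2)\<bar> \<le> h\<^sup>2 * C\<^sup>2 * M * (C ^ k / fact k)" for k
  proof -
    have "\<bar>a (k+2)\<bar> = h ^ (k+2) / fact (k+2) * \<bar>(L ^^ (k+2)) f \<eta>\<bar>"
      using h by (simp add: a_def abs_mult)
    also have "\<dots> \<le> h\<^sup>2 / fact k * (C ^ (k+2) * M)"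
    proof (intro mult_mono)
      show "h ^ (k + 2) / fact (k + 2) \<le> h\<^sup>2 / fact k"
      proof (intro frac_le)
        show "h ^ (k+2) \<le> h\<^sup>2" using h power_decreasing[of 2 "k+2" h] by simp
        show "(fact k :: real) \<le> fact (k + 2)" by (rule fact_mono) simp
      qed auto
      show "\<bar>(L ^^ (k+2)) f \<eta>\<bar> \<le> C ^ (k+2) * M" by (rule L_funpow_bound[OF f \<eta>])
    qed (use h in auto)
    also have "\<dots> = h\<^sup>2 * C\<^sup>2 * M * (C ^ k / fact k)" by (simp add: power_add power2_eq_square)
    finally show ?thesis .
  qed
  have sC: "(\<lambda>k. h\<^sup>2 * C\<^sup>2 * M * (C ^ k / fact k)) sums (h\<^sup>2 * C\<^sup>2 * M * exp C)"
    by (intro sums_mult) (use exp_converges[of C] in \<open>simp add: divide_inverse mult.commute\<close>)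
  have s2: "summable (\<lambda>k. \<bar>a (k+2)\<bar>)"
    by (rule summable_comparison_test'[OF sums_summable[OF sC], of 0]) (use b in auto)
  then have s: "summable (\<lambda>k. a (k+2))" by (rule summable_rabs_cancel)
  then have sa: "summable a" using summable_iff_shift[of a 2] by blast
  have "gen_semigroup L h f \<eta> = (\<Sum>k. a (k+2)) + (\<Sum>k<2. a k)"
    using suminf_split_initial_segment[OF sa, of 2] unfolding gen_semigroup_def a_def .
  also have "(\<Sum>k<2. a k) = f \<eta> + h * L f \<eta>"
    by (simp add: a_def numeral_2_eq_2)
  finally have "gen_semigroup L h f \<eta> - f \<eta> - h * L f \<eta> = (\<Sum>k. a (k+2))" by simp
  also have "\<bar>\<dots>\<bar> \<le> (\<Sum>k. \<bar>a (k+2)\<bar>)" by (rule summable_rabs[OF s2])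
  also have "\<dots> \<le> (\<Sum>k. h\<^sup>2 * C\<^sup>2 * M * (C ^ k / fact k))"
    by (rule suminf_le[OF _ s2 sums_summable[OF sC]]) (use b in auto)
  also have "\<dots> = h\<^sup>2 * C\<^sup>2 * M * exp C" using sC by (simp add: sums_iff)
  finally show ?thesis by (simp add: mult_ac)
qed

end

section \<open>Quadratic forms in the weighted L2 space\<close>

locale weighted_generator = finite_generator +
  fixes \<mu> :: "'a pmf"
  assumes mu_sum: "(\<Sum>\<xi>\<in>S. pmf \<mu> \<xi>) = 1" and mu_pos: "\<And>\<xi>. \<xi> \<in> S \<Longrightarrow> pmf \<mu> \<xi> > 0"
begin

text \<open>The norm of L2(\<mu>), written through \<open>L2_set\<close> so as to inherit the
  inequalities of Minkowski and Cauchy-Schwarz.\<close>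

definition nrm :: "('a \<Rightarrow> real) \<Rightarrow> real" where
  "nrm v = L2_set (\<lambda>\<xi>. sqrt (pmf \<mu> \<xi>) * v \<xi>) S"

text \<open>A bound on the top of the spectrum of the symmetric part of \<open>L + W\<close> in
  L2(\<mu>); \<open>L\<close> itself may be non-symmetric.\<close>

definition spectral_le :: "('a \<Rightarrow> real) \<Rightarrow> real \<Rightarrow> bool" where
  "spectral_le W \<Lambda> \<longleftrightarrow> (\<forall>g. (\<Sum>\<xi>\<in>S. pmf \<mu> \<xi> * (g \<xi> * (L g \<xi> + W \<xi> * g \<xi>))) \<le> \<Lambda> * (\<Sum>\<xi>\<in>S. pmf \<mu> \<xi> * (g \<xi>)\<^sup>2))"

text \<open>One step of Trotter's product formula for \<open>L + W\<close>: multiplication by exp (h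
  W), then exp (h L).\<close>

definition tilted_step :: "real \<Rightarrow> ('a \<Rightarrow> real) \<Rightarrow> ('a \<Rightarrow> real) \<Rightarrow> 'a \<Rightarrow> real" where
  "tilted_step h W v = gen_semigroup L h (\<lambda>\<xi>. exp (h * W \<xi>) * v \<xi>)"

lemma nrm_nonneg: "nrm v \<ge> 0" by (simp add: nrm_def)

lemma nrm_sq: "(nrm v)\<^sup>2 = (\<Sum>\<xi>\<in>S. pmf \<mu> \<xi> * (v \<xi>)\<^sup>2)"
  by (simp add: nrm_def L2_set_def sum_nonneg power_mult_distrib)

lemma nrm_triangle: "nrm (\<lambda>\<xi>. u \<xi> + v \<xi>) \<le> nrm u + nrm v"
  unfolding nrm_def using L2_set_triangle_ineq[of "\<lambda>\<xi>. sqrt (pmf \<mu> \<xi>) * u \<xi>" "\<lambda>\<xi>. sqrt (pmf \<mu> \<xi>) * v \<xi>" S]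
  by (simp add: algebra_simps)

lemma nrm_le_sup:
  assumes "\<And>\<xi>. \<xi> \<in> S \<Longrightarrow> \<bar>v \<xi>\<bar> \<le> M" "M \<ge> 0"
  shows "nrm v \<le> M"
proof (rule power2_le_imp_le)
  have "(nrm v)\<^sup>2 \<le> (\<Sum>\<xi>\<in>S. pmf \<mu> \<xi> * M\<^sup>2)" unfolding nrm_sq
    using assms by (intro sum_mono mult_left_mono abs_le_square_iff[THEN iffD1]) auto
  then show "(nrm v)\<^sup>2 \<le> M\<^sup>2" by (simp add: mu_sum flip: sum_distrib_right)
qed (use assms in auto)

lemma mean_le_nrm: "\<bar>\<Sum>\<xi>\<in>S. pmf \<mu> \<xi> * v \<xi>\<bar> \<le> nrm v"
proof -
  have "\<bar>\<Sum>\<xi>\<in>S. pmf \<mu> \<xi> * v \<xi>\<bar> \<le> (\<Sum>\<xi>\<in>S. \<bar>sqrt (pmf \<mu> \<xi>)\<bar> * \<bar>sqrt (pmf \<mu> \<xi>) * v \<xi>\<bar>)"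
    by (rule order_trans[OF sum_abs]) (simp add: abs_mult mult.assoc[symmetric])
  also have "\<dots> \<le> L2_set (\<lambda>\<xi>. sqrt (pmf \<mu> \<xi>)) S * nrm v" unfolding nrm_def
    by (rule L2_set_mult_ineq)
  also have "L2_set (\<lambda>\<xi>. sqrt (pmf \<mu> \<xi>)) S = 1" by (simp add: L2_set_def mu_sum)
  finally show ?thesis by simp
qed

text \<open>Equivalence of norms on a finite set of full support. The constant is poor, but it only
  enters terms of order h^2, which disappear in total as the mesh tends to zero.\<close>

lemma sup_le_nrm: "\<exists>k\<ge>0. \<forall>v. \<forall>\<xi>\<in>S. \<bar>v \<xi>\<bar> \<le> k * nrm v"
proof -
  define k where "k = (\<Sum>\<xi>\<in>S. 1 / sqrt (pmf \<mu> \<xi>))"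
  have "\<bar>v \<xi>\<bar> \<le> k * nrm v" if "\<xi> \<in> S" for v \<xi>
  proof -
    have "\<bar>sqrt (pmf \<mu> \<xi>) * v \<xi>\<bar> \<le> nrm v" unfolding nrm_def
      using member_le_L2_set[OF finS that, of "\<lambda>\<xi>. \<bar>sqrt (pmf \<mu> \<xi>) * v \<xi>\<bar>"] by (simp add: L2_set_def)
    then have "\<bar>v \<xi>\<bar> \<le> 1 / sqrt (pmf \<mu> \<xi>) * nrm v" using mu_pos[OF that]
      by (simp add: abs_mult field_simps)
    also have "\<dots> \<le> k * nrm v" unfolding k_def
      by (intro mult_right_mono member_le_sum nrm_nonneg) (use that finS in auto)
    finally show ?thesis .
  qed
  moreover have "k \<ge> 0" unfolding k_def by (intro sum_nonneg) auto
  ultimately show ?thesis by blast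
qed

text \<open>Up to errors of order h^2 the step is v + h (L + W) v, and the first-order term of its
  squared norm is twice the form bounded by \<Lambda>. \<open>D\<close> is chosen before
  \<open>h\<close>, \<open>W\<close> and \<open>v\<close>, so that one value serves every cell of
  every grid.\<close>

lemma one_step:
  assumes M: "M \<ge> 0" and Lam: "\<Lambda> \<ge> 0"
  shows "\<exists>D\<ge>0. \<forall>h W v. 0 \<le> h \<longrightarrow> h \<le> 1 \<longrightarrow> (\<forall>\<xi>\<in>S. \<bar>W \<xi>\<bar> \<le> M) \<longrightarrow> spectral_le W \<Lambda> \<longrightarrow>
     nrm (tilted_step h W v) \<le> (1 + h * \<Lambda> + h\<^sup>2 * D) * nrm v"
proof -
  obtain k where k: "k \<ge> 0" "\<And>v \<xi>. \<xi> \<in> S \<Longrightarrow> \<bar>v \<xi>\<bar> \<le> k * nrm v" using sup_le_nrm by blast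
  \<comment> \<open>The summands of \<open>D1\<close> come from the remainder of exp (h L), the
    remainder of exp (h W) and the replacement of \<open>L f\<close> by \<open>L v\<close>.
    \<open>D3\<close> is half the h^2 coefficient of the squared norm, because squaring 1 + h
    \<Lambda> + h^2 D3 doubles it.\<close>
  define D1 where "D1 = (C\<^sup>2 * exp C * exp M + M\<^sup>2 * exp M + C * M * exp M) * k"
  define D3 where "D3 = ((M + C) * k)\<^sup>2 / 2"
  have "nrm (tilted_step h W v) \<le> (1 + h * \<Lambda> + h\<^sup>2 * (D1 + D3)) * nrm v"
    if h: "0 \<le> h" "h \<le> 1" and W: "\<And>\<xi>. \<xi> \<in> S \<Longrightarrow> \<bar>W \<xi>\<bar> \<le> M"
      and spec: "spectral_le W \<Lambda>"
    for h W v
  proof -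
    define B where "B = k * nrm v"
    have vB: "\<bar>v \<xi>\<bar> \<le> B" if "\<xi> \<in> S" for \<xi> using k(2)[OF that] by (simp add: B_def)
    have B0: "B \<ge> 0" using k(1) by (simp add: B_def nrm_nonneg)
    define f where "f = (\<lambda>\<xi>. exp (h * W \<xi>) * v \<xi>)"
    define Av where "Av = (\<lambda>\<xi>. L v \<xi> + W \<xi> * v \<xi>)"
    have hW: "\<bar>h * W \<xi>\<bar> \<le> h * M" "\<bar>h * W \<xi>\<bar> \<le> M" if "\<xi> \<in> S" for \<xi>
    proof -
      show "\<bar>h * W \<xi>\<bar> \<le> h * M" using W[OF that] h by (simp add: abs_mult mult_left_mono)
      also have "\<dots> \<le> M" using h M by (simp add: mult_left_le_one_le)
      finally show "\<bar>h * W \<xi>\<bar> \<le> M" .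
    qed
    have fB: "\<bar>f \<xi>\<bar> \<le> exp M * B" if "\<xi> \<in> S" for \<xi>
      unfolding f_def abs_mult using hW(2)[OF that] vB[OF that] by (intro mult_mono) auto
    have d1: "\<bar>f \<xi> - v \<xi>\<bar> \<le> h * (M * exp M * B)" if "\<xi> \<in> S" for \<xi>
    proof -
      have "f \<xi> - v \<xi> = (exp (h * W \<xi>) - 1) * v \<xi>" by (simp add: f_def algebra_simps)
      then have "\<bar>f \<xi> - v \<xi>\<bar> = \<bar>exp (h * W \<xi>) - 1\<bar> * \<bar>v \<xi>\<bar>" by (simp add: abs_mult)
      also have "\<dots> \<le> (\<bar>h * W \<xi>\<bar> * exp \<bar>h * W \<xi>\<bar>) * B"
        by (intro mult_mono abs_exp_minus_one_le vB that) auto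
      also have "\<dots> \<le> ((h * M) * exp M) * B" using hW[OF that] h M B0 by (intro mult_mono) auto
      finally show ?thesis by (simp add: mult_ac)
    qed
    have d2: "\<bar>f \<xi> - v \<xi> - h * (W \<xi> * v \<xi>)\<bar> \<le> h\<^sup>2 * (M\<^sup>2 * exp M * B)" if "\<xi> \<in> S" for \<xi>
    proof -
      have "f \<xi> - v \<xi> - h * (W \<xi> * v \<xi>) = (exp (h * W \<xi>) - 1 - h * W \<xi>) * v \<xi>" by (simp add: f_def algebra_simps)
      then have "\<bar>f \<xi> - v \<xi> - h * (W \<xi> * v \<xi>)\<bar> = \<bar>exp (h * W \<xi>) - 1 - h * W \<xi>\<bar> * \<bar>v \<xi>\<bar>" by (simp add: abs_mult)
      also have "\<dots> \<le> ((h * W \<xi>)\<^sup>2 * exp \<bar>h * W \<xi>\<bar>) * B"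
        by (intro mult_mono abs_exp_remainder_le vB that) auto
      also have "\<dots> \<le> ((h * M)\<^sup>2 * exp M) * B" using hW[OF that] h M B0
        by (intro mult_mono abs_le_square_iff[THEN iffD1]) (auto simp: abs_mult)
      finally show ?thesis by (simp add: mult_ac power2_eq_square)
    qed
    have d3: "\<bar>L f \<xi> - L v \<xi>\<bar> \<le> C * (h * (M * exp M * B))" if "\<xi> \<in> S" for \<xi>
    proof -
      have "L f \<xi> - L v \<xi> = L (\<lambda>x. f x + (-1) * v x) \<xi>" by (subst L_lin) simp
      also have "\<bar>\<dots>\<bar> \<le> C * (h * (M * exp M * B))"
        by (rule L_bound) (use d1 that in auto)
      finally show ?thesis .
    qed
    define R where "R = (\<lambda>\<xi>. gen_semigroup L h f \<xi> - v \<xi> - h * Av \<xi>)"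
    have R: "\<bar>R \<xi>\<bar> \<le> h\<^sup>2 * (D1 * nrm v)" if "\<xi> \<in> S" for \<xi>
    proof -
      have "R \<xi> = (gen_semigroup L h f \<xi> - f \<xi> - h * L f \<xi>) + (f \<xi> - v \<xi> - h * (W \<xi> * v \<xi>)) + h * (L f \<xi> - L v \<xi>)"
        by (simp add: R_def Av_def algebra_simps)
      then have "\<bar>R \<xi>\<bar> \<le> \<bar>gen_semigroup L h f \<xi> - f \<xi> - h * L f \<xi>\<bar> + \<bar>f \<xi> - v \<xi> - h * (W \<xi> * v \<xi>)\<bar> + \<bar>h * (L f \<xi> - L v \<xi>)\<bar>"
        by linarith
      also have "\<dots> \<le> h\<^sup>2 * (C\<^sup>2 * exp C * (exp M * B)) + h\<^sup>2 * (M\<^sup>2 * exp M * B) + h * (C * (h * (M * exp M * B)))"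
        using d3[OF that] h
        by (intro add_mono semigroup_expansion fB that d2) (auto simp: abs_mult intro: mult_left_mono)
      also have "\<dots> = h\<^sup>2 * (D1 * nrm v)" by (simp add: D1_def B_def power2_eq_square algebra_simps)
      finally show ?thesis .
    qed
    have D1: "D1 \<ge> 0" using k(1) C_nonneg M by (simp add: D1_def)
    have "nrm (\<lambda>\<xi>. v \<xi> + h * Av \<xi>) \<le> (1 + h * \<Lambda> + h\<^sup>2 * D3) * nrm v"
    proof (rule power2_le_imp_le)
      have Avb: "\<bar>Av \<xi>\<bar> \<le> (M + C) * k * nrm v" if "\<xi> \<in> S" for \<xi>
      proof -
        have "\<bar>L v \<xi>\<bar> \<le> C * B" by (rule L_bound[OF vB that])
        moreover have "\<bar>W \<xi> * v \<xi>\<bar> \<le> M * B" unfolding abs_mult using W[OF that] vB[OF that] M by (intro mult_mono) auto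
        ultimately show ?thesis by (simp add: Av_def B_def algebra_simps)
      qed
      then have "nrm Av \<le> (M + C) * k * nrm v" by (rule nrm_le_sup) (use M C_nonneg k nrm_nonneg in auto)
      then have n2: "(nrm Av)\<^sup>2 \<le> ((M + C) * k * nrm v)\<^sup>2" by (intro power_mono nrm_nonneg)
      have "(nrm (\<lambda>\<xi>. v \<xi> + h * Av \<xi>))\<^sup>2 = (nrm v)\<^sup>2 + 2 * h * (\<Sum>\<xi>\<in>S. pmf \<mu> \<xi> * (v \<xi> * Av \<xi>)) + h\<^sup>2 * (nrm Av)\<^sup>2"
        unfolding nrm_sq by (simp add: sum_distrib_left power2_eq_square algebra_simps sum.distrib)
      also have "\<dots> \<le> (nrm v)\<^sup>2 + 2 * h * (\<Lambda> * (nrm v)\<^sup>2) + h\<^sup>2 * ((M + C) * k * nrm v)\<^sup>2"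
        using spec[unfolded spectral_le_def, rule_format, of v] h n2 unfolding nrm_sq Av_def by (intro add_mono mult_left_mono) auto
      also have "\<dots> = (1 + 2 * h * \<Lambda> + 2 * h\<^sup>2 * D3) * (nrm v)\<^sup>2"
        by (simp add: D3_def power2_eq_square algebra_simps)
      also have "\<dots> \<le> (1 + h * \<Lambda> + h\<^sup>2 * D3)\<^sup>2 * (nrm v)\<^sup>2"
      proof (intro mult_right_mono)
        have "(1 + h * \<Lambda> + h\<^sup>2 * D3)\<^sup>2 = 1 + 2 * h * \<Lambda> + 2 * h\<^sup>2 * D3 + (h * \<Lambda> + h\<^sup>2 * D3)\<^sup>2"
          by (simp add: power2_eq_square algebra_simps)
        then show "1 + 2 * h * \<Lambda> + 2 * h\<^sup>2 * D3 \<le> (1 + h * \<Lambda> + h\<^sup>2 * D3)\<^sup>2" by simp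
      qed simp
      finally show "(nrm (\<lambda>\<xi>. v \<xi> + h * Av \<xi>))\<^sup>2 \<le> ((1 + h * \<Lambda> + h\<^sup>2 * D3) * nrm v)\<^sup>2"
        by (simp add: power_mult_distrib)
    next
      have "0 \<le> D3" by (simp add: D3_def)
      then show "0 \<le> (1 + h * \<Lambda> + h\<^sup>2 * D3) * nrm v"
        using Lam h by (intro mult_nonneg_nonneg add_nonneg_nonneg nrm_nonneg) auto
    qed
    moreover have "nrm R \<le> h\<^sup>2 * (D1 * nrm v)" by (rule nrm_le_sup[OF R]) (use D1 nrm_nonneg in auto)
    moreover have "nrm (gen_semigroup L h f) \<le> nrm (\<lambda>\<xi>. v \<xi> + h * Av \<xi>) + nrm R"
      using nrm_triangle[of "\<lambda>\<xi>. v \<xi> + h * Av \<xi>" R] by (simp add: R_def)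
    ultimately show ?thesis by (simp add: tilted_step_def f_def algebra_simps)
  qed
  moreover have "D1 + D3 \<ge> 0" using k(1) C_nonneg M by (simp add: D1_def D3_def)
  ultimately show ?thesis by (intro exI[of _ "D1 + D3"]) blast
qed

end

section \<open>Markov property and the discrete Feynman-Kac bound\<close>

locale feynman_kac = weighted_generator S L C \<mu>
  for S :: "'s set" and L C \<mu> +
  fixes T :: real and P :: "(real \<Rightarrow> 's) measure"
  assumes law: "markov_law S L \<mu> T P" and T_pos: "T > 0"
begin

sublocale prob_space P using law by (simp add: markov_law_def)

lemma space_P: "space P = cadlag S T" and sets_P: "sets P = sets (path_space S T)"
  using law by (simp_all add: markov_law_def)

lemma coord_in_S: "\<omega> \<in> cadlag S T \<Longrightarrow> 0 \<le> t \<Longrightarrow> t \<le> T \<Longrightarrow> \<omega> t \<in> S"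
  by (auto simp: cadlag_def PiE_def Pi_def)

lemma coord_measurable:
  assumes "0 \<le> t" "t \<le> T"
  shows "(\<lambda>\<omega>. \<omega> t) \<in> measurable P (count_space S)"
proof -
  have "(\<lambda>\<omega>. \<omega> t) \<in> measurable (path_space S T) (count_space S)"
    unfolding path_space_def
    by (intro measurable_restrict_space1 measurable_component_singleton) (use assms in auto)
  then show ?thesis using measurable_cong_sets[OF sets_P refl] by blast
qed

lemma coord_fun_measurable:
  assumes "0 \<le> t" "t \<le> T"
  shows "(\<lambda>\<omega>. f (\<omega> t) :: real) \<in> borel_measurable P"
  by (rule measurable_compose[OF coord_measurable[OF assms]]) simp

lemma past_generators: "{{\<omega> \<in> cadlag S T. \<omega> u \<in> A} | u A. 0 \<le> u \<and> u \<le> s \<and> A \<subseteq> S} \<subseteq> Pow (cadlag S T)"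
  by auto

lemma subalgebra_past:
  assumes "s \<le> T"
  shows "subalgebra P (past S T s)"
  unfolding subalgebra_def
proof
  show "space (past S T s) = space P"
    unfolding past_def space_P by (rule space_measure_of[OF past_generators])
  have "sets (past S T s) = sigma_sets (cadlag S T) {{\<omega> \<in> cadlag S T. \<omega> u \<in> A} | u A. 0 \<le> u \<and> u \<le> s \<and> A \<subseteq> S}"
    unfolding past_def by (rule sets_measure_of[OF past_generators])
  also have "\<dots> \<subseteq> sets P"
    unfolding space_P[symmetric]
  proof (rule sets.sigma_sets_subset, safe)
    fix u A assume "0 \<le> u" "u \<le> s" "A \<subseteq> S"
    then show "{\<omega> \<in> space P. \<omega> u \<in> A} \<in> sets P"
      using measurable_sets[OF coord_measurable[of u], of A] assms
      by (simp add: vimage_def Int_def conj_commute)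
  qed
  finally show "sets (past S T s) \<subseteq> sets P" .
qed

lemma coord_past_measurable:
  assumes "0 \<le> u" "u \<le> s" "s \<le> T"
  shows "(\<lambda>\<omega>. f (\<omega> u) :: real) \<in> borel_measurable (past S T s)"
proof -
  have sp: "space (past S T s) = cadlag S T"
    unfolding past_def by (rule space_measure_of[OF past_generators])
  have "(\<lambda>\<omega>. \<omega> u) \<in> measurable (past S T s) (count_space S)"
  proof (rule measurableI)
    fix A assume "A \<in> sets (count_space S)"
    then have "{\<omega> \<in> cadlag S T. \<omega> u \<in> A} \<in> {{\<omega> \<in> cadlag S T. \<omega> u \<in> A} | u A. 0 \<le> u \<and> u \<le> s \<and> A \<subseteq> S}"
      using assms by auto
    then have "{\<omega> \<in> cadlag S T. \<omega> u \<in> A} \<in> sets (past S T s)"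
      unfolding past_def sets_measure_of[OF past_generators] by (rule sigma_sets.Basic)
    then show "(\<lambda>\<omega>. \<omega> u) -` A \<inter> space (past S T s) \<in> sets (past S T s)"
      by (simp add: sp vimage_def Int_def conj_commute)
  qed (use coord_in_S assms in \<open>auto simp: sp\<close>)
  then show ?thesis by (rule measurable_compose) simp
qed

lemma bounded_integrable:
  assumes "f \<in> borel_measurable P" "\<And>\<omega>. \<omega> \<in> space P \<Longrightarrow> \<bar>f \<omega>\<bar> \<le> (B::real)"
  shows "integrable P f"
  by (rule integrable_const_bound[of _ B]) (use assms in auto)

lemma fun_bounded: "\<exists>B. \<forall>\<xi>\<in>S. \<bar>f \<xi> :: real\<bar> \<le> B"
  by (intro exI[of _ "\<Sum>\<xi>\<in>S. \<bar>f \<xi>\<bar>"] ballI member_le_sum[of _ S "\<lambda>\<xi>. \<bar>f \<xi>\<bar>"]) (use finS in auto)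

text \<open>The conditional expectation in \<open>markov_law\<close>, integrated against a bounded
  observable of the past; this is the form in which the last factor of a product over grid times can
  be removed.\<close>

lemma markov_property:
  assumes st: "0 \<le> s" "s \<le> t" "t \<le> T"
    and Y: "Y \<in> borel_measurable (past S T s)" "\<And>\<omega>. \<omega> \<in> space P \<Longrightarrow> \<bar>Y \<omega>\<bar> \<le> B"
  shows "expectation (\<lambda>\<omega>. Y \<omega> * f (\<omega> t)) = expectation (\<lambda>\<omega>. Y \<omega> * gen_semigroup L (t - s) f (\<omega> s))"
proof -
  have sub: "subalgebra P (past S T s)" using subalgebra_past st by auto
  interpret F: finite_measure_subalgebra P "past S T s"
    by unfold_locales (rule sub)
  have YP: "Y \<in> borel_measurable P" by (rule measurable_from_subalg[OF sub Y(1)])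
  obtain Bf where Bf: "\<And>\<xi>. \<xi> \<in> S \<Longrightarrow> \<bar>f \<xi>\<bar> \<le> Bf" using fun_bounded by blast
  have int: "integrable P (\<lambda>\<omega>. Y \<omega> * f (\<omega> t))"
  proof (rule bounded_integrable[where B = "B * Bf"])
    show "(\<lambda>\<omega>. Y \<omega> * f (\<omega> t)) \<in> borel_measurable P"
      using coord_fun_measurable[of t f] st YP by simp
    show "\<bar>Y \<omega> * f (\<omega> t)\<bar> \<le> B * Bf" if "\<omega> \<in> space P" for \<omega>
      unfolding abs_mult using Y(2)[OF that] Bf[of "\<omega> t"] coord_in_S[of \<omega> t] that st
      by (intro mult_mono) (auto simp: space_P)
  qed
  have mk: "AE \<omega> in P. real_cond_exp P (past S T s) (\<lambda>\<omega>. f (\<omega> t)) \<omega> = gen_semigroup L (t - s) f (\<omega> s)"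
    using law st unfolding markov_law_def by blast
  have "expectation (\<lambda>\<omega>. Y \<omega> * f (\<omega> t)) = expectation (\<lambda>\<omega>. Y \<omega> * real_cond_exp P (past S T s) (\<lambda>\<omega>. f (\<omega> t)) \<omega>)"
    using F.real_cond_exp_intg(2)[OF int Y(1) coord_fun_measurable[of t f]] st by simp
  also have "\<dots> = expectation (\<lambda>\<omega>. Y \<omega> * gen_semigroup L (t - s) f (\<omega> s))"
  proof (rule integral_cong_AE)
    show "(\<lambda>\<omega>. Y \<omega> * gen_semigroup L (t - s) f (\<omega> s)) \<in> borel_measurable P"
      using coord_fun_measurable[of s "gen_semigroup L (t - s) f"] st YP by simp
  qed (use mk YP in auto)
  finally show ?thesis .
qed

lemma expectation_initial:
  "expectation (\<lambda>\<omega>. v (\<omega> 0)) = (\<Sum>\<xi>\<in>S. pmf \<mu> \<xi> * v \<xi>)"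
proof -
  have ms: "{\<omega> \<in> space P. \<omega> 0 = \<xi>} \<in> events" if "\<xi> \<in> S" for \<xi>
    using measurable_sets[OF coord_measurable[of 0], of "{\<xi>}"] T_pos that
    by (simp add: vimage_def Int_def conj_commute)
  have "expectation (\<lambda>\<omega>. v (\<omega> 0)) = expectation (\<lambda>\<omega>. \<Sum>\<xi>\<in>S. v \<xi> * indicator {\<omega> \<in> space P. \<omega> 0 = \<xi>} \<omega>)"
  proof (rule Bochner_Integration.integral_cong[OF refl])
    fix \<omega> assume w: "\<omega> \<in> space P"
    then have "\<omega> 0 \<in> S" using coord_in_S[of \<omega> 0] T_pos by (simp add: space_P)
    then show "v (\<omega> 0) = (\<Sum>\<xi>\<in>S. v \<xi> * indicator {\<omega> \<in> space P. \<omega> 0 = \<xi>} \<omega>)"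
      using w finS by (simp add: indicator_def of_bool_def if_distrib cong: if_cong)
  qed
  also have "\<dots> = (\<Sum>\<xi>\<in>S. v \<xi> * prob {\<omega> \<in> space P. \<omega> 0 = \<xi>})"
  proof (subst Bochner_Integration.integral_sum)
    show "integrable P (\<lambda>\<omega>. v \<xi> * indicator {\<omega> \<in> space P. \<omega> 0 = \<xi>} \<omega>)" if "\<xi> \<in> S" for \<xi>
      by (rule bounded_integrable[where B = "\<bar>v \<xi>\<bar>"]) (use ms[OF that] in \<open>auto simp: indicator_def\<close>)
  qed (use ms in auto)
  also have "\<dots> = (\<Sum>\<xi>\<in>S. pmf \<mu> \<xi> * v \<xi>)"
    using law unfolding markov_law_def by (intro sum.cong) auto
  finally show ?thesis .
qed

text \<open>Induction on the number of steps, removing the last one: conditioning on the past of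
  time k h turns the last factor and the terminal function \<open>v\<close> into
  \<open>tilted_step\<close> of \<open>v\<close>, which is why \<open>v\<close> is arbitrary. At
  time 0 the law is \<mu>, and Cauchy-Schwarz bounds the mean by the norm.\<close>

lemma discrete_bound:
  assumes h: "0 \<le> h" and D: "D \<ge> 0"
    and step: "\<And>j v. j < k \<Longrightarrow> nrm (tilted_step h (W (Suc j)) v) \<le> D * nrm v"
    and kT: "real k * h \<le> T"
  shows "\<bar>expectation (\<lambda>\<omega>. (\<Prod>j<k. exp (h * W (Suc j) (\<omega> (real (Suc j) * h)))) * v (\<omega> (real k * h)))\<bar> \<le> D ^ k * nrm v"
  using step kT
proof (induction k arbitrary: v)
  case 0
  then show ?case using mean_le_nrm[of v] by (simp add: expectation_initial)
next
  case (Suc k)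
  define Y where "Y = (\<lambda>\<omega>. \<Prod>j<k. exp (h * W (Suc j) (\<omega> (real (Suc j) * h))))"
  have kT: "real k * h \<le> T" "real k * h \<le> real (Suc k) * h"
    using Suc.prems(2) h by (auto simp: algebra_simps)
  have le: "real (Suc j) * h \<le> real k * h" if "j < k" for j
    using that h by (intro mult_right_mono) auto
  have "\<exists>B. \<forall>j<k. \<forall>\<xi>\<in>S. \<bar>exp (h * W (Suc j) \<xi>)\<bar> \<le> B"
    by (intro exI[of _ "\<Sum>j<k. \<Sum>\<xi>\<in>S. \<bar>exp (h * W (Suc j) \<xi>)\<bar>"] allI impI ballI
         order_trans[OF member_le_sum[of _ S "\<lambda>\<xi>. \<bar>exp (h * W (Suc _) \<xi>)\<bar>"] member_le_sum[of _ "{..<k}" "\<lambda>j. \<Sum>\<xi>\<in>S. \<bar>exp (h * W (Suc j) \<xi>)\<bar>"]])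
       (use finS in \<open>auto intro: sum_nonneg\<close>)
  then obtain B where B: "\<And>j \<xi>. j < k \<Longrightarrow> \<xi> \<in> S \<Longrightarrow> \<bar>exp (h * W (Suc j) \<xi>)\<bar> \<le> B" by blast
  have "expectation (\<lambda>\<omega>. (\<Prod>j<Suc k. exp (h * W (Suc j) (\<omega> (real (Suc j) * h)))) * v (\<omega> (real (Suc k) * h)))
      = expectation (\<lambda>\<omega>. Y \<omega> * (exp (h * W (Suc k) (\<omega> (real (Suc k) * h))) * v (\<omega> (real (Suc k) * h))))"
    by (simp add: Y_def mult.assoc)
  also have "\<dots> = expectation (\<lambda>\<omega>. Y \<omega> * gen_semigroup L (real (Suc k) * h - real k * h) (\<lambda>\<xi>. exp (h * W (Suc k) \<xi>) * v \<xi>) (\<omega> (real k * h)))"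
  proof (rule markov_property[where B = "B ^ k"])
    show "Y \<in> borel_measurable (past S T (real k * h))" unfolding Y_def
      by (intro borel_measurable_prod coord_past_measurable) (use h kT le in auto)
    show "\<bar>Y \<omega>\<bar> \<le> B ^ k" if "\<omega> \<in> space P" for \<omega>
    proof -
      have "\<omega> (real (Suc j) * h) \<in> S" if "j < k" for j
        using coord_in_S[of \<omega> "real (Suc j) * h"] \<open>\<omega> \<in> space P\<close> le[OF that] kT h by (auto simp: space_P)
      then have "\<bar>Y \<omega>\<bar> \<le> (\<Prod>j<k. B)" unfolding Y_def abs_prod using B by (intro prod_mono) auto
      then show ?thesis by simp
    qed
  qed (use h kT Suc.prems in auto)
  also have "real (Suc k) * h - real k * h = h" by (simp add: algebra_simps)
  also have "gen_semigroup L h (\<lambda>\<xi>. exp (h * W (Suc k) \<xi>) * v \<xi>) = tilted_step h (W (Suc k)) v" by (simp only: tilted_step_def)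
  also have "\<bar>expectation (\<lambda>\<omega>. Y \<omega> * tilted_step h (W (Suc k)) v (\<omega> (real k * h)))\<bar>
      \<le> D ^ k * nrm (tilted_step h (W (Suc k)) v)"
    unfolding Y_def by (rule Suc.IH) (use Suc.prems kT in auto)
  also have "\<dots> \<le> D ^ k * (D * nrm v)" using Suc.prems(1)[of k v] D by (intro mult_left_mono) auto
  finally show ?case by (simp add: mult_ac)
qed

end

section \<open>Riemann sums along cadlag paths\<close>

lemma sum_indicator_grid:
  fixes h s :: real and c :: "nat \<Rightarrow> real"
  assumes "k < m" "real k * h < s" "s \<le> real (Suc k) * h" "h > 0"
  shows "(\<Sum>j<m. indicator {real j * h <.. real (Suc j) * h} s * c j) = c k"
proof -
  have "indicator {real j * h <.. real (Suc j) * h} s * c j = (if j = k then c k else 0)" for j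
  proof (cases j k rule: linorder_cases)
    case less
    then have "real (Suc j) * h \<le> real k * h" using assms by (intro mult_right_mono) auto
    then have "\<not> s \<le> real (Suc j) * h" using assms(2) by linarith
    then show ?thesis using less assms by (auto simp: indicator_def)
  next
    case greater
    then have "real (Suc k) * h \<le> real j * h" using assms by (intro mult_right_mono) auto
    then have "\<not> real j * h < s" using assms(3) by linarith
    then show ?thesis using greater assms by (auto simp: indicator_def)
  next
    case equal
    then show ?thesis using assms by (simp add: indicator_def)
  qed
  then show ?thesis using assms by simp
qed

text \<open>Cells are open on the left and closed on the right, hence the ceiling minus one: each
  time lies in the same cell as the right end point at which the path is sampled.\<close>

lemma grid_cell:
  fixes h s :: real
  assumes "h > 0" "0 < s" "s \<le> real m * h"
  obtains k where "k < m" "real k * h < s" "s \<le> real (Suc k) * h"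
proof -
  define k where "k = nat \<lceil>s / h\<rceil> - 1"
  have c: "\<lceil>s / h\<rceil> \<ge> 1" using assms by simp
  have kc: "real (Suc k) = of_int \<lceil>s / h\<rceil>" using c by (simp add: k_def)
  have "s / h \<le> real m" using assms by (simp add: field_simps)
  then have "\<lceil>s / h\<rceil> \<le> int m" by (simp add: ceiling_le_iff)
  then have "k < m" using c unfolding k_def by linarith
  moreover have "s \<le> real (Suc k) * h" unfolding kc
    using mult_right_mono[OF le_of_int_ceiling[of "s / h"], of h] assms(1) by simp
  moreover have "real k < s / h" using kc ceiling_correct[of "s / h"] by simp
  then have "real k * h < s" using assms(1) by (simp add: field_simps)
  ultimately show ?thesis using that by blast
qed

text \<open>The right end of cell \<open>j\<close>. The number of cells is \<open>Suc m\<close>, so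
  that the grid is never empty.\<close>

abbreviation gridpt :: "real \<Rightarrow> nat \<Rightarrow> nat \<Rightarrow> real" where
  "gridpt t m j \<equiv> real (Suc j) * (t / real (Suc m))"

abbreviation step_fun :: "(real \<Rightarrow> 's \<Rightarrow> real) \<Rightarrow> (real \<Rightarrow> 's) \<Rightarrow> real \<Rightarrow> nat \<Rightarrow> real \<Rightarrow> real" where
  "step_fun W \<omega> t m s \<equiv> (\<Sum>j<Suc m. indicator {real j * (t / real (Suc m)) <.. gridpt t m j} s
            * W (gridpt t m j) (\<omega> (gridpt t m j)))"

abbreviation riemann_sum :: "(real \<Rightarrow> 's \<Rightarrow> real) \<Rightarrow> (real \<Rightarrow> 's) \<Rightarrow> real \<Rightarrow> nat \<Rightarrow> real" where
  "riemann_sum W \<omega> t m \<equiv> (\<Sum>j<Suc m. (t / real (Suc m)) * W (gridpt t m j) (\<omega> (gridpt t m j)))"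

text \<open>A path in a discrete space is locally constant to the right, so step functions that look
  at the right endpoint of each cell converge.\<close>

lemma step_approximation_tendsto:
  fixes W :: "real \<Rightarrow> 's \<Rightarrow> real"
  assumes w: "\<omega> \<in> cadlag S T" and s: "0 < s" "s < t" and t: "t \<le> T"
    and W: "\<And>\<xi>. \<xi> \<in> S \<Longrightarrow> continuous_on {0..T} (\<lambda>s. W s \<xi>)"
  shows "(\<lambda>m. step_fun W \<omega> t m s) \<longlonglongrightarrow> W s (\<omega> s)"
proof -
  have sS: "\<omega> s \<in> S" using w s t by (auto simp: cadlag_def PiE_def Pi_def)
  have "eventually (\<lambda>r. \<omega> r = \<omega> s) (at_right s)" using w s t by (auto simp: cadlag_def)
  then obtain b where b: "b > s" "\<And>r. s < r \<Longrightarrow> r < b \<Longrightarrow> \<omega> r = \<omega> s"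
    unfolding eventually_at_right[OF s(2)] by blast
  \<comment> \<open>\<open>\<sigma>\<close> is the right end of the cell that contains
    \<open>s\<close>. It is squeezed to \<open>s\<close> from the right, where the path keeps the
    value \<open>\<omega> s\<close>.\<close>
  have "\<forall>m. \<exists>\<sigma>. s \<le> \<sigma> \<and> \<sigma> \<le> s + t / Suc m \<and> \<sigma> \<le> t \<and> step_fun W \<omega> t m s = W \<sigma> (\<omega> \<sigma>)"
  proof
    fix m
    define h where "h = t / Suc m"
    have h: "h > 0" "s \<le> real (Suc m) * h" using s by (auto simp: h_def)
    obtain k where k: "k < Suc m" "real k * h < s" "s \<le> real (Suc k) * h"
      using grid_cell[OF h(1) s(1) h(2)] by blast
    have "real (Suc k) * h \<le> real (Suc m) * h" using k h by (intro mult_right_mono) auto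
    then have "real (Suc k) * h \<le> t" by (simp add: h_def)
    moreover have "real (Suc k) * h \<le> s + h" using k by (simp add: algebra_simps)
    ultimately show "\<exists>\<sigma>. s \<le> \<sigma> \<and> \<sigma> \<le> s + t / Suc m \<and> \<sigma> \<le> t \<and> step_fun W \<omega> t m s = W \<sigma> (\<omega> \<sigma>)"
      using k sum_indicator_grid[OF k h(1), of "\<lambda>j. W (real (Suc j) * h) (\<omega> (real (Suc j) * h))"]
      unfolding h_def[symmetric] by (intro exI[of _ "real (Suc k) * h"]) auto
  qed
  then obtain \<sigma> where \<sigma>: "\<And>m. s \<le> \<sigma> m" "\<And>m. \<sigma> m \<le> s + t / Suc m" "\<And>m. \<sigma> m \<le> t"
    "\<And>m. step_fun W \<omega> t m s = W (\<sigma> m) (\<omega> (\<sigma> m))"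
    by metis
  have tl: "(\<lambda>m. s + t / Suc m) \<longlonglongrightarrow> s + 0"
    by (intro tendsto_add tendsto_const LIMSEQ_Suc[OF lim_const_over_n])
  have \<sigma>l: "\<sigma> \<longlonglongrightarrow> s"
    by (rule tendsto_sandwich[OF _ _ tendsto_const tl[simplified]]) (use \<sigma> in auto)
  have "((\<lambda>m. W (\<sigma> m) (\<omega> s)) \<longlonglongrightarrow> W s (\<omega> s))"
    by (rule continuous_on_tendsto_compose[OF W[OF sS] \<sigma>l])
       (use s t \<sigma> in \<open>auto intro!: always_eventually order_trans[OF less_imp_le[OF s(1)]] order_trans[OF _ t]\<close>)
  moreover have "eventually (\<lambda>m. W (\<sigma> m) (\<omega> s) = W (\<sigma> m) (\<omega> (\<sigma> m))) sequentially"
  proof (rule eventually_mono[OF order_tendstoD(2)[OF \<sigma>l b(1)]])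
    fix m assume "\<sigma> m < b"
    then have "\<omega> (\<sigma> m) = \<omega> s" using b(2)[of "\<sigma> m"] \<sigma>(1)[of m] by (cases "\<sigma> m = s") auto
    then show "W (\<sigma> m) (\<omega> s) = W (\<sigma> m) (\<omega> (\<sigma> m))" by simp
  qed
  ultimately show ?thesis unfolding \<sigma>(4) by (rule Lim_transform_eventually)
qed

lemma step_approximation_bound:
  fixes h s :: real and c :: "nat \<Rightarrow> real"
  assumes "h > 0" "\<And>j. j < m \<Longrightarrow> \<bar>c j\<bar> \<le> M"  "M \<ge> 0"
  shows "\<bar>\<Sum>j<m. indicator {real j * h <.. real (Suc j) * h} s * c j\<bar> \<le> M * indicator {0..real m * h} s"
proof (cases "0 < s \<and> s \<le> real m * h")
  case True
  then obtain k where k: "k < m" "real k * h < s" "s \<le> real (Suc k) * h"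
    using grid_cell[OF assms(1)] by blast
  show ?thesis unfolding sum_indicator_grid[OF k assms(1)] using assms(2)[OF k(1)] True by (simp add: indicator_def)
next
  case False
  have "indicator {real j * h <.. real (Suc j) * h} s * c j = 0" if "j < m" for j
  proof -
    have "real (Suc j) * h \<le> real m * h" "0 \<le> real j * h" using that assms by (auto intro: mult_right_mono)
    then show ?thesis using False by (auto simp: indicator_def)
  qed
  then have "(\<Sum>j<m. indicator {real j * h <.. real (Suc j) * h} s * c j) = 0" by (intro sum.neutral) auto
  then show ?thesis using assms(3) by simp
qed

lemma integral_step_function:
  fixes h :: real and c :: "nat \<Rightarrow> real"
  assumes "h \<ge> 0"
  shows "(\<integral>s. (\<Sum>j<m. indicator {real j * h <.. real (Suc j) * h} s * c j) \<partial>lborel) = (\<Sum>j<m. h * c j)"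
proof -
  have "(\<integral>s. (\<Sum>j<m. indicator {real j * h <.. real (Suc j) * h} s * c j) \<partial>lborel)
      = (\<Sum>j<m. \<integral>s. indicator {real j * h <.. real (Suc j) * h} s * c j \<partial>lborel)"
    by (rule Bochner_Integration.integral_sum)
       (auto intro!: integrable_mult_left integrable_real_indicator simp: emeasure_lborel_Ioc assms mult_right_mono)
  also have "\<dots> = (\<Sum>j<m. h * c j)"
    using assms by (intro sum.cong) (auto simp: measure_def emeasure_lborel_Ioc mult_right_mono algebra_simps)
  finally show ?thesis .
qed

lemma path_functional_props:
  fixes W :: "real \<Rightarrow> 's \<Rightarrow> real"
  assumes w: "\<omega> \<in> cadlag S T" and t: "0 < t" "t \<le> T"
    and W: "\<And>\<xi>. \<xi> \<in> S \<Longrightarrow> continuous_on {0..T} (\<lambda>s. W s \<xi>)"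
    and M: "\<And>s \<xi>. 0 \<le> s \<Longrightarrow> s \<le> T \<Longrightarrow> \<xi> \<in> S \<Longrightarrow> \<bar>W s \<xi>\<bar> \<le> M"
  shows path_functional_integrable: "set_integrable lborel {0..t} (\<lambda>s. W s (\<omega> s))"
    and riemann_sums_tendsto: "(\<lambda>m. riemann_sum W \<omega> t m)
         \<longlonglongrightarrow> (LBINT s:{0..t}. W s (\<omega> s))"
proof -
  define F where "F m s = step_fun W \<omega> t m s" for m s
  have wS: "\<omega> s \<in> S" if "0 \<le> s" "s \<le> T" for s using w that by (auto simp: cadlag_def PiE_def Pi_def)
  have M0: "M \<ge> 0" using M[OF _ _ wS, of 0 0] t by force
  have Fm[measurable]: "F m \<in> borel_measurable borel" for m unfolding F_def by measurable
  have Fb: "\<bar>F m s\<bar> \<le> M * indicator {0..t} s" for m s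
  proof -
    have "\<bar>W (gridpt t m j) (\<omega> (gridpt t m j))\<bar> \<le> M" if "j < Suc m" for j
    proof -
      have "gridpt t m j \<le> real (Suc m) * (t / Suc m)" using that t by (intro mult_right_mono) auto
      then have "gridpt t m j \<le> T" using t by simp
      then show ?thesis using t by (intro M wS) auto
    qed
    then show ?thesis unfolding F_def
      using step_approximation_bound[of "t / Suc m" "Suc m" "\<lambda>j. W (gridpt t m j) (\<omega> (gridpt t m j))" M s] t M0
      by simp
  qed
  define f where "f s = indicator {0..t} s * W s (\<omega> s)" for s
  \<comment> \<open>The two end points are left out. They form a null set, which suffices for
    dominated convergence; measurability of \<open>f\<close> is obtained below by adding the two
    point values by hand.\<close>
  have lim: "(\<lambda>m. F m s) \<longlonglongrightarrow> f s" if "s \<noteq> 0" "s \<noteq> t" for s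
  proof (cases "0 < s \<and> s < t")
    case True
    then show ?thesis using step_approximation_tendsto[where S=S and W=W, OF w _ _ t(2) W, of s] by (simp add: F_def f_def)
  next
    case False
    then have "s \<notin> {0..t}" using that by auto
    then have "F m s = 0" "f s = 0" for m using Fb[of m s] by (auto simp: f_def)
    then show ?thesis by simp
  qed
  have g: "(\<lambda>s. indicator (- {0,t}) s * f s) \<in> borel_measurable borel"
  proof (rule borel_measurable_LIMSEQ_real)
    show "(\<lambda>m. indicator (- {0,t}) s * F m s) \<longlonglongrightarrow> indicator (- {0,t}) s * f s" for s
      using lim[of s] by (cases "s \<in> {0, t}") auto
  qed measurable
  have "f = (\<lambda>s. indicator (- {0,t}) s * f s + f 0 * indicator {0} s + f t * indicator {t} s)"
    using t by (auto simp: fun_eq_iff indicator_def)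
  moreover have "(\<lambda>s. indicator (- {0,t}) s * f s + f 0 * indicator {0} s + f t * indicator {t} s) \<in> borel_measurable borel"
    using g by measurable
  ultimately have fm[measurable]: "f \<in> borel_measurable borel" by simp
  have ae: "AE s in lborel. (\<lambda>m. F m s) \<longlonglongrightarrow> f s"
    using AE_lborel_singleton[of 0] AE_lborel_singleton[of t] by eventually_elim (rule lim)
  have dom: "integrable lborel (\<lambda>s. M * indicator {0..t} s)"
    by (intro integrable_mult_right integrable_real_indicator) (auto simp: emeasure_lborel_Icc_eq)
  have "integrable lborel f"
    by (rule integrable_dominated_convergence[OF _ _ dom ae]) (use Fb in auto)
  then show "set_integrable lborel {0..t} (\<lambda>s. W s (\<omega> s))"
    unfolding set_integrable_def f_def[abs_def] by simp
  have int: "(\<integral>s. F m s \<partial>lborel) = riemann_sum W \<omega> t m" for m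
    unfolding F_def by (rule integral_step_function) (use t in simp)
  have "(\<lambda>m. \<integral>s. F m s \<partial>lborel) \<longlonglongrightarrow> (\<integral>s. f s \<partial>lborel)"
    by (rule integral_dominated_convergence[OF _ _ dom ae]) (use Fb in auto)
  then show "(\<lambda>m. riemann_sum W \<omega> t m)
         \<longlonglongrightarrow> (LBINT s:{0..t}. W s (\<omega> s))"
    unfolding int by (simp only: set_lebesgue_integral_def f_def[abs_def] real_scaleR_def)
qed

section \<open>Exponential moments in continuous time\<close>

context feynman_kac
begin

context
  fixes W :: "real \<Rightarrow> 's \<Rightarrow> real" and M \<Lambda> :: real
  assumes W: "\<And>\<xi>. \<xi> \<in> S \<Longrightarrow> continuous_on {0..T} (\<lambda>s. W s \<xi>)"
    and M: "\<And>s \<xi>. 0 \<le> s \<Longrightarrow> s \<le> T \<Longrightarrow> \<xi> \<in> S \<Longrightarrow> \<bar>W s \<xi>\<bar> \<le> M"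
    and M0: "M \<ge> 0" and Lam: "\<Lambda> \<ge> 0"
    and spec: "\<And>s. 0 \<le> s \<Longrightarrow> s \<le> T \<Longrightarrow> spectral_le (W s) \<Lambda>"
begin

lemma path_functional_measurable:
  assumes "0 < t" "t \<le> T"
  shows "(\<lambda>\<omega>. LBINT s:{0..t}. W s (\<omega> s)) \<in> borel_measurable P"
proof (rule borel_measurable_LIMSEQ_real)
  show "(\<lambda>m. riemann_sum W \<omega> t m)
         \<longlonglongrightarrow> (LBINT s:{0..t}. W s (\<omega> s))" if "\<omega> \<in> space P" for \<omega>
    by (rule riemann_sums_tendsto[OF _ assms W M]) (use that space_P in auto)
  show "(\<lambda>\<omega>. riemann_sum W \<omega> t m) \<in> borel_measurable P" for m
  proof (intro borel_measurable_sum borel_measurable_times borel_measurable_const coord_fun_measurable)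
    fix j assume "j \<in> {..<Suc m}"
    then have "gridpt t m j \<le> real (Suc m) * (t / Suc m)" using assms by (intro mult_right_mono) auto
    then show "gridpt t m j \<le> T" using assms by simp
  qed (use assms in auto)
qed

text \<open>The limit of \<open>discrete_bound\<close> with v = 1 along Riemann sums; as
  \<open>W\<close> is bounded by \<open>M\<close>, the constant exp (M t) dominates.\<close>

lemma exponential_moment_bound:
  assumes t: "0 < t" "t \<le> T"
  shows "expectation (\<lambda>\<omega>. exp (LBINT s:{0..t}. W s (\<omega> s))) \<le> exp (\<Lambda> * t)"
    and "integrable P (\<lambda>\<omega>. exp (LBINT s:{0..t}. W s (\<omega> s)))"
proof -
  define X where "X = (\<lambda>\<omega>. LBINT s:{0..t}. W s (\<omega> s))"
  define Y where "Y m \<omega> = riemann_sum W \<omega> t m" for m \<omega>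
  have grid: "0 \<le> gridpt t m j" "gridpt t m j \<le> T" if "j < Suc m" for j m
  proof -
    have "gridpt t m j \<le> real (Suc m) * (t / Suc m)" using that t by (intro mult_right_mono) auto
    then show "gridpt t m j \<le> T" using t by simp
  qed (use t in auto)
  have Ym: "Y m \<in> borel_measurable P" for m unfolding Y_def
    by (intro borel_measurable_sum borel_measurable_times borel_measurable_const coord_fun_measurable) (use grid in auto)
  have YX: "(\<lambda>m. Y m \<omega>) \<longlonglongrightarrow> X \<omega>" if "\<omega> \<in> space P" for \<omega>
    unfolding Y_def X_def
    by (rule riemann_sums_tendsto[OF _ t W M]) (use that space_P in auto)
  have Yb: "\<bar>Y m \<omega>\<bar> \<le> M * t" if "\<omega> \<in> space P" for m \<omega>
  proof -
    have "\<bar>Y m \<omega>\<bar> \<le> (\<Sum>j<Suc m. (t / Suc m) * M)" unfolding Y_def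
    proof (rule order_trans[OF sum_abs sum_mono])
      fix j assume "j \<in> {..<Suc m}"
      then show "\<bar>(t / Suc m) * W (gridpt t m j) (\<omega> (gridpt t m j))\<bar> \<le> (t / Suc m) * M"
        unfolding abs_mult using t grid[of j m] coord_in_S[of \<omega>] that space_P
        by (intro mult_mono M) auto
    qed
    also have "\<dots> = M * t" by (simp del: of_nat_Suc)
    finally show ?thesis .
  qed
  have Yb': "Y m \<omega> \<le> M * t" if "\<omega> \<in> space P" for m \<omega>
    using Yb[OF that, of m] by linarith
  have Xm: "X \<in> borel_measurable P" unfolding X_def by (rule path_functional_measurable[OF t])
  have dom: "integrable P (\<lambda>\<omega>. exp (M * t))" by simp
  have "integrable P (\<lambda>\<omega>. exp (X \<omega>))"
    by (rule integrable_dominated_convergence[OF _ _ dom, where s = "\<lambda>m \<omega>. exp (Y m \<omega>)"])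
       (use Ym Xm YX Yb' in \<open>auto intro!: AE_I2 tendsto_exp\<close>)
  then show "integrable P (\<lambda>\<omega>. exp (LBINT s:{0..t}. W s (\<omega> s)))" by (simp add: X_def)
  have conv: "(\<lambda>m. expectation (\<lambda>\<omega>. exp (Y m \<omega>))) \<longlonglongrightarrow> expectation (\<lambda>\<omega>. exp (X \<omega>))"
    by (rule integral_dominated_convergence[OF _ _ dom])
       (use Ym Xm YX Yb' in \<open>auto intro!: AE_I2 tendsto_exp\<close>)
  obtain D where D: "D \<ge> 0" "\<And>h W v. 0 \<le> h \<Longrightarrow> h \<le> 1 \<Longrightarrow> (\<And>\<xi>. \<xi> \<in> S \<Longrightarrow> \<bar>W \<xi>\<bar> \<le> M) \<Longrightarrow> spectral_le W \<Lambda> \<Longrightarrow>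
     nrm (tilted_step h W v) \<le> (1 + h * \<Lambda> + h\<^sup>2 * D) * nrm v"
    using one_step[OF M0 Lam] by blast
  have nrm1: "nrm (\<lambda>_. 1) \<le> 1" by (rule nrm_le_sup) auto
  \<comment> \<open>The condition on \<open>m\<close> keeps the mesh below 1, as the one-step bound
    requires. The product of the one-step factors is at most exp (\<Lambda> t + t^2 D / Suc m), and
    the correction vanishes in the limit.\<close>
  have bound: "expectation (\<lambda>\<omega>. exp (Y m \<omega>)) \<le> exp (\<Lambda> * t + t\<^sup>2 * D / Suc m)" if m: "real (Suc m) \<ge> t" for m
  proof -
    define h where "h = t / Suc m"
    have h: "0 \<le> h" "h \<le> 1" using t m by (auto simp: h_def)
    have D1: "0 \<le> 1 + h * \<Lambda> + h\<^sup>2 * D" using h Lam D(1) by (intro add_nonneg_nonneg mult_nonneg_nonneg) auto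
    have eq: "exp (Y m \<omega>) = (\<Prod>j<Suc m. exp (h * W (real (Suc j) * h) (\<omega> (real (Suc j) * h))))" for \<omega>
      unfolding Y_def h_def[symmetric] by (rule exp_sum) simp
    have "\<bar>expectation (\<lambda>\<omega>. (\<Prod>j<Suc m. exp (h * W (real (Suc j) * h) (\<omega> (real (Suc j) * h)))) * 1)\<bar>
      \<le> (1 + h * \<Lambda> + h\<^sup>2 * D) ^ Suc m * nrm (\<lambda>_. 1)"
    proof (rule discrete_bound[OF h(1) D1, where W = "\<lambda>j. W (real j * h)" and v = "\<lambda>_. 1"])
      fix j v assume j: "j < Suc m"
      show "nrm (tilted_step h (W (real (Suc j) * h)) v) \<le> (1 + h * \<Lambda> + h\<^sup>2 * D) * nrm v"
        by (rule D(2)[OF h]) (use grid[OF j] M spec in \<open>auto simp: h_def\<close>)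
    qed (use t in \<open>auto simp: h_def\<close>)
    then have "expectation (\<lambda>\<omega>. exp (Y m \<omega>)) \<le> (1 + h * \<Lambda> + h\<^sup>2 * D) ^ Suc m * nrm (\<lambda>_. 1)"
      unfolding eq by simp
    also have "\<dots> \<le> (1 + h * \<Lambda> + h\<^sup>2 * D) ^ Suc m * 1" using D1 by (intro mult_left_mono nrm1) auto
    also have "\<dots> \<le> exp (h * \<Lambda> + h\<^sup>2 * D) ^ Suc m"
      using D1 exp_ge_add_one_self[of "h * \<Lambda> + h\<^sup>2 * D"] by (simp only: mult_1_right) (intro power_mono, auto simp: add.assoc)
    also have "\<dots> = exp (real (Suc m) * (h * \<Lambda> + h\<^sup>2 * D))" by (simp only: exp_of_nat_mult)
    also have "real (Suc m) * (h * \<Lambda> + h\<^sup>2 * D) = \<Lambda> * t + t\<^sup>2 * D / Suc m"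
      unfolding h_def by (simp add: field_simps power2_eq_square del: of_nat_Suc)
    finally show ?thesis .
  qed
  have lim: "(\<lambda>m. exp (\<Lambda> * t + t\<^sup>2 * D / Suc m)) \<longlonglongrightarrow> exp (\<Lambda> * t + 0)"
    by (intro tendsto_intros LIMSEQ_Suc[OF lim_const_over_n])
  obtain m0 :: nat where m0: "real m0 \<ge> t" using real_arch_simple by blast
  have "expectation (\<lambda>\<omega>. exp (X \<omega>)) \<le> exp (\<Lambda> * t + 0)"
    by (rule LIMSEQ_le[OF conv lim]) (use bound m0 in \<open>auto intro!: exI[of _ m0]\<close>)
  then show "expectation (\<lambda>\<omega>. exp (LBINT s:{0..t}. W s (\<omega> s))) \<le> exp (\<Lambda> * t)" by (simp add: X_def)
qed

end

end

section \<open>The urn flow\<close>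

definition layer :: "nat \<Rightarrow> (int ^ 'd::finite) set" where
  "layer k = {z. (\<forall>j. 0 \<le> z $ j) \<and> (\<Sum>j\<in>UNIV. z $ j) = int k}"

definition corner :: "nat \<Rightarrow> (int ^ 'd::finite) set" where
  "corner l = {z. (\<forall>j. 0 \<le> z $ j) \<and> (\<Sum>j\<in>UNIV. z $ j) < int l}"

lemma bij_betw_sites:
  "bij_betw vec_nth (sites n :: (int ^ 'd::finite) set) (UNIV \<rightarrow>\<^sub>E {0..<int n})"
  by (rule bij_betw_byWitness[where f' = vec_lambda])
     (auto simp: sites_def PiE_def Pi_def extensional_def)

lemma finite_sites [simp]: "finite (sites n :: (int ^ 'd::finite) set)"
  using bij_betw_finite[OF bij_betw_sites] by (simp add: finite_PiE)

lemma card_sites: "card (sites n :: (int ^ 'd::finite) set) = n ^ CARD('d)"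
  using bij_betw_same_card[OF bij_betw_sites] by (simp add: card_PiE)

lemma coord_le_sum:
  fixes z :: "int ^ 'd::finite"
  assumes "\<And>j. 0 \<le> z $ j"
  shows "z $ j \<le> (\<Sum>j\<in>UNIV. z $ j)"
  by (rule member_le_sum) (use assms in auto)

lemma finite_layer [simp]: "finite (layer k :: (int ^ 'd::finite) set)"
proof (rule finite_subset)
  show "layer k \<subseteq> (sites (Suc k) :: (int ^ 'd) set)"
  proof
    fix z :: "int ^ 'd" assume z: "z \<in> layer k"
    have "z $ j < int (Suc k)" for j
    proof -
      have "z $ j \<le> int k" using coord_le_sum[of z j] z by (auto simp: layer_def)
      then show ?thesis by linarith
    qed
    then show "z \<in> sites (Suc k)" using z by (simp add: layer_def sites_def)
  qed
qed simp

lemma corner_eq_UN: "corner l = (\<Union>k<l. layer k)"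
proof (intro set_eqI iffI)
  fix z :: "int ^ 'd" assume z: "z \<in> corner l"
  have "0 \<le> (\<Sum>j\<in>UNIV. z $ j)" using z by (auto simp: corner_def intro: sum_nonneg)
  then show "z \<in> (\<Union>k<l. layer k)" using z
    by (auto simp: corner_def layer_def intro!: bexI[of _ "nat (\<Sum>j\<in>UNIV. z $ j)"])
qed (auto simp: corner_def layer_def)

lemma finite_corner [simp]: "finite (corner l :: (int ^ 'd::finite) set)"
  by (simp add: corner_eq_UN)

lemma sum_corner:
  fixes F :: "int ^ 'd::finite \<Rightarrow> real"
  shows "(\<Sum>z\<in>corner l. F z) = (\<Sum>k<l. \<Sum>z\<in>layer k. F z)"
  unfolding corner_eq_UN
proof (rule sum.UNION_disjoint)
  show "\<forall>i\<in>{..<l}. \<forall>j\<in>{..<l}. i \<noteq> j \<longrightarrow> layer i \<inter> (layer j :: (int ^ 'd) set) = {}"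
    by (auto simp: layer_def)
qed simp_all

text \<open>In state \<open>z\<close> of \<open>layer k\<close> an urn holds
  \<open>z $ j + 1\<close> balls of colour \<open>j\<close>, k + d in all, and the drawn colour
  gains one ball. A state \<open>z\<close> of the next layer is entered from z - e_j with weight
  \<open>z $ j\<close>, and these weights add up to k + 1 whatever the state is. Hence the uniform
  law on a layer is carried to the uniform law on the next.\<close>

lemma urn_identity:
  fixes f :: "int ^ 'd::finite \<Rightarrow> real"
  shows "(\<Sum>z\<in>layer k. \<Sum>j\<in>UNIV. real_of_int (z $ j + 1) * f (z + axis j 1))
       = real (Suc k) * (\<Sum>z\<in>layer (Suc k). f z)"
proof -
  have sa: "(\<Sum>i\<in>UNIV. axis j (1::int) $ i) = 1" for j :: 'd
    by (simp add: axis_def)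
  have "(\<Sum>z\<in>layer k. real_of_int (z $ j + 1) * f (z + axis j 1))
      = (\<Sum>z\<in>layer (Suc k). real_of_int (z $ j) * f z)" for j
  proof -
    have "(\<Sum>z\<in>layer k. real_of_int (z $ j + 1) * f (z + axis j 1))
       = (\<Sum>z\<in>{z \<in> layer (Suc k). z $ j \<ge> 1}. real_of_int (z $ j) * f z)"
    proof (rule sum.reindex_bij_witness[of _ "\<lambda>z. z - axis j 1" "\<lambda>z. z + axis j 1"])
      fix z :: "int ^ 'd" assume z: "z \<in> {z \<in> layer (Suc k). 1 \<le> z $ j}"
      have "0 \<le> (z - axis j 1) $ i" for i
        using z by (cases "i = j") (auto simp: layer_def axis_def)
      then show "z - axis j 1 \<in> layer k" using z sa[of j]
        by (auto simp: layer_def sum_subtractf)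
    next
      fix z :: "int ^ 'd" assume z: "z \<in> layer k"
      have "0 \<le> (z + axis j 1) $ i" for i
        using z by (cases "i = j") (auto simp: layer_def axis_def)
      then show "z + axis j 1 \<in> {z \<in> layer (Suc k). 1 \<le> z $ j}" using z sa[of j]
        by (auto simp: layer_def sum.distrib axis_def)
    qed (auto simp: axis_def)
    \<comment> \<open>States with \<open>z $ j = 0\<close> have no predecessor in direction
      \<open>j\<close>, and they carry weight 0.\<close>
    also have "\<dots> = (\<Sum>z\<in>layer (Suc k). real_of_int (z $ j) * f z)"
    proof (rule sum.mono_neutral_left)
      show "\<forall>z\<in>layer (Suc k) - {z \<in> layer (Suc k). 1 \<le> z $ j}. real_of_int (z $ j) * f z = 0"
      proof
        fix z :: "int ^ 'd" assume "z \<in> layer (Suc k) - {z \<in> layer (Suc k). 1 \<le> z $ j}"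
        then have "0 \<le> z $ j" "z $ j < 1" by (auto simp: layer_def)
        then show "real_of_int (z $ j) * f z = 0" by simp
      qed
    qed auto
    finally show ?thesis .
  qed
  then have "(\<Sum>j\<in>UNIV. \<Sum>z\<in>layer k. real_of_int (z $ j + 1) * f (z + axis j 1))
      = (\<Sum>j\<in>UNIV. \<Sum>z\<in>layer (Suc k). real_of_int (z $ j) * f z)"
    by (rule sum.cong[OF refl])
  then have "(\<Sum>z\<in>layer k. \<Sum>j\<in>UNIV. real_of_int (z $ j + 1) * f (z + axis j 1))
      = (\<Sum>z\<in>layer (Suc k). (\<Sum>j\<in>UNIV. real_of_int (z $ j)) * f z)"
    by (subst (1) sum.swap, subst (asm) (2) sum.swap) (simp only: sum_distrib_right)
  also have "\<dots> = (\<Sum>z\<in>layer (Suc k). real (Suc k) * f z)"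
    by (intro sum.cong) (auto simp: layer_def simp flip: of_int_sum)
  finally show ?thesis by (simp add: sum_distrib_left)
qed

section \<open>Growth of the simplices\<close>

abbreviation layer_card :: "'d::finite itself \<Rightarrow> nat \<Rightarrow> real" where
  "layer_card _ k \<equiv> real (card (layer k :: (int ^ 'd) set))"

lemma sum_coord_layer:
  assumes "z \<in> (layer k :: (int ^ 'd::finite) set)"
  shows "(\<Sum>j\<in>UNIV. real_of_int (z $ j + 1)) = real k + real CARD('d)"
proof -
  have "(\<Sum>j\<in>UNIV. real_of_int (z $ j)) = real k"
    using assms by (auto simp: layer_def simp flip: of_int_sum)
  then show ?thesis by (simp add: sum.distrib)
qed

text \<open>The urn identity for the constant function 1. Together with \<open>layer_card_0\<close>
  it makes the cardinality the binomial coefficient of k + d - 1 over k.\<close>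

lemma layer_card_rec:
  "(real k + real CARD('d::finite)) * layer_card TYPE('d) k = real (Suc k) * layer_card TYPE('d) (Suc k)"
proof -
  have "(\<Sum>z\<in>layer k. \<Sum>j\<in>UNIV. real_of_int ((z :: int ^ 'd) $ j + 1) * 1)
      = (\<Sum>z\<in>(layer k :: (int ^ 'd) set). real k + real CARD('d))"
    by (intro sum.cong) (simp_all only: mult_1_right sum_coord_layer)
  then show ?thesis using urn_identity[of "\<lambda>_ :: int ^ 'd. 1" k] by (simp add: mult.commute)
qed

lemma layer_card_0: "layer_card TYPE('d::finite) 0 = 1"
proof -
  have "layer 0 = {0 :: int ^ 'd}"
    by (auto simp: layer_def vec_eq_iff sum_nonneg_eq_0_iff)
  then show ?thesis by simp
qed

lemma layer_card_pos: "layer_card TYPE('d::finite) k > 0"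
proof (induction k)
  case (Suc k)
  have "0 < (real k + real CARD('d)) * layer_card TYPE('d) k"
    using Suc by (intro mult_pos_pos add_nonneg_pos) auto
  then show ?case unfolding layer_card_rec by (simp add: zero_less_mult_iff)
qed (simp add: layer_card_0)

lemma layer_card_ge_linear:
  assumes "CARD('d::finite) \<ge> 2"
  shows "layer_card TYPE('d) k \<ge> real (Suc k)"
proof (induction k)
  case (Suc k)
  have "real (Suc k) * real (Suc (Suc k)) \<le> (real k + real CARD('d)) * layer_card TYPE('d) k"
    using mult_mono[of "real k + 2" "real k + real CARD('d)", OF _ Suc] assms
    by (simp add: algebra_simps)
  then show ?case unfolding layer_card_rec by (simp only: mult_le_cancel_left_pos of_nat_0_less_iff zero_less_Suc)
qed (simp add: layer_card_0)

lemma layer_card_ge_quadratic: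
  assumes "CARD('d::finite) \<ge> 3"
  shows "layer_card TYPE('d) k \<ge> real (Suc k) * real (Suc (Suc k)) / 2"
proof (induction k)
  case (Suc k)
  have "real (Suc k) * (real (Suc (Suc k)) * real (Suc (Suc (Suc k))) / 2) \<le> (real k + real CARD('d)) * layer_card TYPE('d) k"
    using mult_mono[of "real k + 3" "real k + real CARD('d)", OF _ Suc] assms
    by (simp add: algebra_simps)
  then show ?case unfolding layer_card_rec by (simp only: mult_le_cancel_left_pos of_nat_0_less_iff zero_less_Suc)
qed (simp add: layer_card_0)

text \<open>The origin of \<open>g_scale\<close>: cardinalities grow like k^(d-1), so the sum is
  linear for d = 1, harmonic for d = 2 and dominated by a telescoping series for d \<ge> 3. From n =
  3 on, ln n \<ge> 1 absorbs the additive constant of the harmonic bound.\<close>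

lemma sum_inverse_layer_card:
  assumes n: "n \<ge> 3"
  shows "(\<Sum>k<n - 1. 1 / layer_card TYPE('d::finite) k) \<le> 2 * g_scale CARD('d) n"
proof -
  consider "CARD('d) = 1" | "CARD('d) = 2" | "CARD('d) \<ge> 3"
    using zero_less_card_finite[where 'a='d] by linarith
  then show ?thesis
  proof cases
    case 1
    have "1 / layer_card TYPE('d) k \<le> 1" for k
      using layer_card_pos[where 'd='d, of k] by (simp add: Suc_le_eq)
    then have "(\<Sum>k<n - 1. 1 / layer_card TYPE('d) k) \<le> (\<Sum>k<n - 1. 1)" by (rule sum_mono)
    also have "\<dots> \<le> 2 * real n" by simp
    finally show ?thesis using 1 by (simp add: g_scale_def)
  next
    case 2
    have harm_1: "harm (Suc 0) = (1 :: real)" by (simp add: harm_def)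
    have "exp 1 \<le> real n" using exp_le n by linarith
    then have ln1: "1 \<le> ln (real n)" using n by (subst ln_ge_iff) auto
    have "(\<Sum>k<n - 1. 1 / layer_card TYPE('d) k) \<le> (\<Sum>k<n - 1. inverse (real (Suc k)))"
      using layer_card_ge_linear[where 'd='d] 2 layer_card_pos[where 'd='d]
      by (intro sum_mono) (simp add: divide_inverse le_imp_inverse_le)
    also have "\<dots> = harm (n - 1)"
      by (simp add: harm_altdef)
    also have "\<dots> \<le> ln (real (n - 1)) + 1" using euler_mascheroni_sequence_decreasing[of 1 "n - 1"] n harm_1
      by (simp add: le_diff_conv Suc_le_eq)
    also have "\<dots> \<le> ln (real n) + ln (real n)" using n ln1 by (intro add_mono) auto
    finally show ?thesis using 2 by (simp add: g_scale_def)
  next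
    case 3
    have "(\<Sum>k<n - 1. 1 / layer_card TYPE('d) k) \<le> (\<Sum>k<n - 1. 2 / real (Suc k) - 2 / real (Suc (Suc k)))"
    proof (rule sum_mono)
      fix k
      have "1 / layer_card TYPE('d) k \<le> 1 / (real (Suc k) * real (Suc (Suc k)) / 2)"
        by (rule divide_left_mono[OF layer_card_ge_quadratic[OF 3]])
           (use layer_card_pos[where 'd='d, of k] in auto)
      also have "\<dots> = 2 / real (Suc k) - 2 / real (Suc (Suc k))" by (simp add: field_simps)
      finally show "1 / layer_card TYPE('d) k \<le> 2 / real (Suc k) - 2 / real (Suc (Suc k))" .
    qed
    also have "\<dots> = 2 - 2 / real (Suc (n - 1))"
      using sum_lessThan_telescope'[of "\<lambda>k. 2 / real (Suc k)" "n - 1"] by simp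
    also have "\<dots> \<le> 2" by simp
    finally show ?thesis using 3 by (simp add: g_scale_def)
  qed
qed

text \<open>Summation by parts. It expresses the loss between a start value and its time average
  through increments, each of which will be a flow along edges.\<close>

lemma average_telescope:
  fixes a :: "nat \<Rightarrow> real"
  shows "real l * a 0 - (\<Sum>k<l. a k) = (\<Sum>k<l. (real l - real (Suc k)) * (a k - a (Suc k)))"
proof (induction l)
  case (Suc l)
  have "(\<Sum>k<Suc l. (real (Suc l) - real (Suc k)) * (a k - a (Suc k)))
      = (\<Sum>k<l. (real l - real (Suc k)) * (a k - a (Suc k)) + (a k - a (Suc k)))"
    by (simp add: algebra_simps)
  also have "\<dots> = real l * a 0 - (\<Sum>k<l. a k) + (a 0 - a l)"
    by (simp add: sum.distrib Suc sum_lessThan_telescope')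
  finally show ?case by (simp add: algebra_simps)
qed simp

text \<open>The flow of the Polya urn: a unit mass at the origin moves along the coordinate directions
  and is uniformly distributed on \<open>layer k\<close> after \<open>k\<close> steps.  It is stopped at a time uniform in
  \<open>{0..<l}\<close>.\<close>

lemma urn_flow:
  assumes l: "l \<ge> 1"
  defines "R \<equiv> (\<Sum>k<l. 1 / layer_card TYPE('d::finite) k)"
  obtains q :: "int ^ 'd \<Rightarrow> real" and \<phi> :: "int ^ 'd \<Rightarrow> 'd \<Rightarrow> real" where
    "\<And>z. z \<in> corner l \<Longrightarrow> 0 \<le> q z" "\<And>z j. z \<in> corner l \<Longrightarrow> 0 \<le> \<phi> z j"
    "(\<Sum>z\<in>corner l. q z) = 1" "(\<Sum>z\<in>corner l. \<Sum>j\<in>UNIV. \<phi> z j) \<le> real l"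
    "(\<Sum>z\<in>corner l. (q z)\<^sup>2) = R / (real l)\<^sup>2" "(\<Sum>z\<in>corner l. \<Sum>j\<in>UNIV. (\<phi> z j)\<^sup>2) \<le> R"
    "\<And>f. f 0 - (\<Sum>z\<in>corner l. q z * f z)
        = (\<Sum>z\<in>corner l. \<Sum>j\<in>UNIV. \<phi> z j * (f z - f (z + axis j 1)))"
proof -
  define N where "N k = layer_card TYPE('d) k" for k
  have N: "N k > 0" for k unfolding N_def by (rule layer_card_pos)
  define deg where "deg z = nat (\<Sum>j\<in>UNIV. z $ j)" for z :: "int ^ 'd"
  have deg: "deg z = k" if "z \<in> layer k" for z k using that by (simp add: deg_def layer_def)
  \<comment> \<open>The probability that the step out of \<open>layer k\<close> is made, i.e. that a
    stopping time uniform in {0..<l} exceeds \<open>k\<close>.\<close>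
  define s where "s k = (real l - real (Suc k)) / real l" for k
  have s: "0 \<le> s k" "s k \<le> 1" if "k < l" for k using that by (auto simp: s_def)
  \<comment> \<open>The probability that the unstopped urn is at \<open>z\<close> after
    \<open>k\<close> steps and then moves in direction \<open>j\<close>: the uniform law on the
    layer times the urn rule.\<close>
  define \<pi> where "\<pi> k z j = real_of_int (z $ j + 1) / ((real k + real CARD('d)) * N k)" for k and z :: "int ^ 'd" and j
  have kd: "real k + real CARD('d) > 0" for k by (rule add_nonneg_pos) auto
  have \<pi>0: "0 \<le> \<pi> k z j" if "z \<in> layer k" for k z j
    using that N[of k] kd[of k] by (auto simp: \<pi>_def layer_def)
  have \<pi>s: "(\<Sum>j\<in>UNIV. \<pi> k z j) = 1 / N k" if "z \<in> layer k" for k z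
  proof -
    have "(\<Sum>j\<in>UNIV. \<pi> k z j) = (real k + real CARD('d)) / ((real k + real CARD('d)) * N k)"
      unfolding \<pi>_def sum_divide_distrib[symmetric] sum_coord_layer[OF that] ..
    then show ?thesis using kd[of k] by simp
  qed
  \<comment> \<open>\<open>q\<close> is the law of the stopped position, and
    \<open>\<phi> z j\<close> the probability that the stopped urn crosses the edge from
    \<open>z\<close> in direction \<open>j\<close>.\<close>
  define q where "q z = 1 / (real l * N (deg z))" for z
  define \<phi> where "\<phi> z j = s (deg z) * \<pi> (deg z) z j" for z j
  define A where "A f k = (\<Sum>z\<in>layer k. f z) / N k" for f :: "int ^ 'd \<Rightarrow> real" and k
  have A0: "A f 0 = f 0" for f
  proof -
    have "layer 0 = {0 :: int ^ 'd}"
      by (auto simp: layer_def vec_eq_iff sum_nonneg_eq_0_iff)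
    then show ?thesis by (simp add: A_def N_def)
  qed
  have step: "A f k - A f (Suc k) = (\<Sum>z\<in>layer k. \<Sum>j\<in>UNIV. \<pi> k z j * (f z - f (z + axis j 1)))" for f k
  proof -
    have "(\<Sum>z\<in>layer k. \<Sum>j\<in>UNIV. \<pi> k z j * f (z + axis j 1))
        = (\<Sum>z\<in>layer k. \<Sum>j\<in>UNIV. real_of_int (z $ j + 1) * f (z + axis j 1)) / ((real k + real CARD('d)) * N k)"
      unfolding \<pi>_def by (simp add: sum_divide_distrib)
    also have "\<dots> = real (Suc k) * (\<Sum>z\<in>layer (Suc k). f z) / (real (Suc k) * N (Suc k))"
      unfolding urn_identity using layer_card_rec[where 'd='d, of k] by (simp add: N_def)
    also have "\<dots> = A f (Suc k)" by (simp add: A_def)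
    finally have "(\<Sum>z\<in>layer k. \<Sum>j\<in>UNIV. \<pi> k z j * f (z + axis j 1)) = A f (Suc k)" .
    moreover have "(\<Sum>z\<in>layer k. \<Sum>j\<in>UNIV. \<pi> k z j * f z) = A f k"
      by (simp add: A_def \<pi>s sum_divide_distrib flip: sum_distrib_right)
    ultimately show ?thesis by (simp add: right_diff_distrib sum_subtractf)
  qed
  show ?thesis
  proof (rule that[of q \<phi>])
    show "0 \<le> q z" for z using N by (simp add: q_def less_imp_le)
    show "0 \<le> \<phi> z j" if "z \<in> corner l" for z j
      using that s \<pi>0 deg by (auto simp: corner_eq_UN \<phi>_def)
    show "(\<Sum>z\<in>corner l. q z) = 1"
      using l N less_imp_neq[OF N] by (simp add: sum_corner q_def deg) (simp add: N_def)
    show "(\<Sum>z\<in>corner l. (q z)\<^sup>2) = R / (real l)\<^sup>2"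
    proof -
      have "(\<Sum>z\<in>layer k. (q z)\<^sup>2) = 1 / N k / (real l)\<^sup>2" for k
      proof -
        have "(\<Sum>z\<in>layer k. (q z)\<^sup>2) = N k * (1 / (real l * N k))\<^sup>2" by (simp add: q_def deg) (simp add: N_def)
        then show ?thesis using N[of k] by (simp add: power2_eq_square field_simps)
      qed
      then show ?thesis by (simp add: sum_corner R_def N_def sum_divide_distrib)
    qed
    have ph: "(\<Sum>j\<in>UNIV. \<phi> z j) = s k / N k" if "z \<in> layer k" for z k
      using that by (simp add: \<phi>_def deg \<pi>s flip: sum_distrib_left)
    have "(\<Sum>z\<in>corner l. \<Sum>j\<in>UNIV. \<phi> z j) = (\<Sum>k<l. s k)"
      using less_imp_neq[OF N] by (simp add: sum_corner ph) (simp add: N_def)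
    also have "\<dots> \<le> (\<Sum>k<l. 1)" by (intro sum_mono) (use s in auto)
    finally show "(\<Sum>z\<in>corner l. \<Sum>j\<in>UNIV. \<phi> z j) \<le> real l" by simp
    have "(\<Sum>z\<in>corner l. \<Sum>j\<in>UNIV. (\<phi> z j)\<^sup>2) \<le> (\<Sum>k<l. \<Sum>z\<in>(layer k :: (int ^ 'd) set). (1 / N k)\<^sup>2)"
      unfolding sum_corner
    proof (intro sum_mono)
      fix k and z :: "int ^ 'd" assume k: "k \<in> {..<l}" and z: "z \<in> layer k"
      have nn: "0 \<le> \<phi> z j" for j using k z s \<pi>0 deg by (auto simp: \<phi>_def)
      \<comment> \<open>The sum of squares of nonnegative terms is at most the square of their sum.
        A layer of N k points thus contributes at most N k (1 / N k)^2 = 1 / N k to the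
        energy.\<close>
      have "(\<Sum>j\<in>UNIV. (\<phi> z j)\<^sup>2) \<le> (\<Sum>j\<in>UNIV. \<phi> z j * (\<Sum>j\<in>UNIV. \<phi> z j))"
        unfolding power2_eq_square by (intro sum_mono mult_left_mono member_le_sum nn) auto
      also have "\<dots> = (s k / N k)\<^sup>2" unfolding sum_distrib_right[symmetric] ph[OF z] power2_eq_square ..
      also have "\<dots> \<le> (1 / N k)\<^sup>2" using s[of k] k N[of k] by (intro power_mono divide_right_mono) auto
      finally show "(\<Sum>j\<in>UNIV. (\<phi> z j)\<^sup>2) \<le> (1 / N k)\<^sup>2" .
    qed
    also have "(\<Sum>k<l. \<Sum>z\<in>(layer k :: (int ^ 'd) set). (1 / N k)\<^sup>2) = R"
    proof -
      have "(\<Sum>z\<in>(layer k :: (int ^ 'd) set). (1 / N k)\<^sup>2) = 1 / N k" for k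
        using N[of k] by (simp add: N_def power2_eq_square)
      then show ?thesis by (simp add: R_def N_def)
    qed
    finally show "(\<Sum>z\<in>corner l. \<Sum>j\<in>UNIV. (\<phi> z j)\<^sup>2) \<le> R" .
    show "f 0 - (\<Sum>z\<in>corner l. q z * f z)
        = (\<Sum>z\<in>corner l. \<Sum>j\<in>UNIV. \<phi> z j * (f z - f (z + axis j 1)))" for f
    proof -
      have "(\<Sum>z\<in>corner l. q z * f z) = (\<Sum>k<l. A f k) / real l"
        by (simp add: sum_corner q_def deg A_def sum_divide_distrib mult.commute)
      then have "f 0 - (\<Sum>z\<in>corner l. q z * f z) = (real l * A f 0 - (\<Sum>k<l. A f k)) / real l"
        using l by (simp add: A0 diff_divide_distrib)
      also have "\<dots> = (\<Sum>k<l. s k * (A f k - A f (Suc k)))"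
        unfolding average_telescope by (simp add: s_def sum_divide_distrib)
      also have "\<dots> = (\<Sum>z\<in>corner l. \<Sum>j\<in>UNIV. \<phi> z j * (f z - f (z + axis j 1)))"
        by (simp add: sum_corner step \<phi>_def deg sum_distrib_left mult.assoc)
      finally show ?thesis .
    qed
  qed
qed

section \<open>The pointwise inequality\<close>

text \<open>Up to the factor \<open>K\<close>, \<open>w\<close> is half the gradient of the
  quadratic form \<open>Q\<close> in the variables \<open>e\<close>, with the diagonal removed so
  that \<open>w x\<close> does not involve \<open>e x\<close>. Pairing \<open>w\<close> with
  \<open>e\<close> returns K Q up to the diagonal, which the trace \<open>\<tau>\<close> bounds
  because the variables are at most 1. Row and column sums below \<open>r\<close> control the
  squares by Schur's test. The gain is linear in \<open>K\<close> while the cost carries K^2 r^2, so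
  for small \<open>r\<close> the gain prevails.\<close>

lemma absorption:
  fixes T :: "'i \<Rightarrow> 'x \<Rightarrow> real" and e :: "'x \<Rightarrow> real"
  assumes X: "finite X" and I: "finite I"
    and e: "\<And>x. x \<in> X \<Longrightarrow> \<bar>e x\<bar> \<le> 1"
    and row: "\<And>\<alpha>. \<alpha> \<in> I \<Longrightarrow> (\<Sum>x\<in>X. \<bar>T \<alpha> x\<bar>) \<le> r"
    and col: "\<And>x. x \<in> X \<Longrightarrow> (\<Sum>\<alpha>\<in>I. \<bar>T \<alpha> x\<bar>) \<le> r"
    and r: "r \<ge> 0" and K: "K \<ge> 0"
  defines "Q \<equiv> (\<Sum>\<alpha>\<in>I. (\<Sum>x\<in>X. T \<alpha> x * e x)\<^sup>2)"
    and "\<tau> \<equiv> (\<Sum>\<alpha>\<in>I. \<Sum>x\<in>X. (T \<alpha> x)\<^sup>2)"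
    and "w \<equiv> (\<lambda>x. K * (\<Sum>\<alpha>\<in>I. T \<alpha> x * (\<Sum>y\<in>X - {x}. T \<alpha> y * e y)))"
  shows absorption_bound: "\<And>x. x \<in> X \<Longrightarrow> \<bar>w x\<bar> \<le> K * r\<^sup>2"
    and absorption_gain: "K * (Q - \<tau>) \<le> (\<Sum>x\<in>X. e x * w x)"
    and absorption_cost: "(\<Sum>x\<in>X. (w x)\<^sup>2) \<le> 2 * K\<^sup>2 * r\<^sup>2 * (Q + \<tau>)"
proof -
  define L where "L \<alpha> = (\<Sum>x\<in>X. T \<alpha> x * e x)" for \<alpha>
  define N where "N \<alpha> x = L \<alpha> - T \<alpha> x * e x" for \<alpha> x
  have rest: "(\<Sum>y\<in>X - {x}. T \<alpha> y * e y) = N \<alpha> x" if "x \<in> X" for \<alpha> x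
    using X that by (simp add: N_def L_def sum_diff1)
  have Tr: "\<bar>T \<alpha> x\<bar> \<le> r" if "\<alpha> \<in> I" "x \<in> X" for \<alpha> x
    using member_le_sum[of x X "\<lambda>x. \<bar>T \<alpha> x\<bar>"] row[OF that(1)] that X by force
  have Te: "\<bar>T \<alpha> x * e x\<bar> \<le> \<bar>T \<alpha> x\<bar>" if "x \<in> X" for \<alpha> x
    using mult_left_mono[OF e[OF that], of "\<bar>T \<alpha> x\<bar>"] by (simp add: abs_mult)
  show "\<bar>w x\<bar> \<le> K * r\<^sup>2" if x: "x \<in> X" for x
  proof -
    have "\<bar>\<Sum>\<alpha>\<in>I. T \<alpha> x * (\<Sum>y\<in>X - {x}. T \<alpha> y * e y)\<bar> \<le> (\<Sum>\<alpha>\<in>I. \<bar>T \<alpha> x\<bar> * r)"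
    proof (rule order_trans[OF sum_abs sum_mono])
      fix \<alpha> assume \<alpha>: "\<alpha> \<in> I"
      have "\<bar>\<Sum>y\<in>X - {x}. T \<alpha> y * e y\<bar> \<le> (\<Sum>y\<in>X - {x}. \<bar>T \<alpha> y\<bar>)"
        by (rule order_trans[OF sum_abs sum_mono]) (use Te in auto)
      also have "\<dots> \<le> (\<Sum>y\<in>X. \<bar>T \<alpha> y\<bar>)" by (rule sum_mono2) (use X in auto)
      also have "\<dots> \<le> r" by (rule row[OF \<alpha>])
      finally show "\<bar>T \<alpha> x * (\<Sum>y\<in>X - {x}. T \<alpha> y * e y)\<bar> \<le> \<bar>T \<alpha> x\<bar> * r"
        by (simp add: abs_mult mult_left_mono)
    qed
    also have "\<dots> \<le> r * r" using col[OF x] r by (simp add: mult_right_mono flip: sum_distrib_right)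
    finally show ?thesis using K by (simp add: w_def abs_mult mult_left_mono power2_eq_square)
  qed
  show "K * (Q - \<tau>) \<le> (\<Sum>x\<in>X. e x * w x)"
  proof -
    have "(\<Sum>x\<in>X. e x * w x) = K * (\<Sum>x\<in>X. \<Sum>\<alpha>\<in>I. T \<alpha> x * e x * L \<alpha> - (T \<alpha> x)\<^sup>2 * (e x)\<^sup>2)"
    proof (subst sum_distrib_left, rule sum.cong[OF refl])
      fix x assume x: "x \<in> X"
      show "e x * w x = K * (\<Sum>\<alpha>\<in>I. T \<alpha> x * e x * L \<alpha> - (T \<alpha> x)\<^sup>2 * (e x)\<^sup>2)"
        unfolding w_def rest[OF x] N_def by (simp add: sum_distrib_left algebra_simps power2_eq_square)
    qed
    also have "\<dots> = K * (\<Sum>\<alpha>\<in>I. \<Sum>x\<in>X. T \<alpha> x * e x * L \<alpha> - (T \<alpha> x)\<^sup>2 * (e x)\<^sup>2)"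
      by (subst sum.swap) simp
    also have "(\<Sum>\<alpha>\<in>I. \<Sum>x\<in>X. T \<alpha> x * e x * L \<alpha> - (T \<alpha> x)\<^sup>2 * (e x)\<^sup>2)
        = Q - (\<Sum>\<alpha>\<in>I. \<Sum>x\<in>X. (T \<alpha> x)\<^sup>2 * (e x)\<^sup>2)"
      by (simp add: Q_def L_def sum_subtractf power2_eq_square flip: sum_distrib_right)
    also have "K * (Q - \<tau>) \<le> K * (Q - (\<Sum>\<alpha>\<in>I. \<Sum>x\<in>X. (T \<alpha> x)\<^sup>2 * (e x)\<^sup>2))"
    proof (intro mult_left_mono K diff_left_mono)
      have "(e x)\<^sup>2 \<le> 1" if "x \<in> X" for x using e[OF that] by (simp add: abs_square_le_1)
      then show "(\<Sum>\<alpha>\<in>I. \<Sum>x\<in>X. (T \<alpha> x)\<^sup>2 * (e x)\<^sup>2) \<le> \<tau>" unfolding \<tau>_def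
        by (intro sum_mono mult_left_le) auto
    qed
    finally show ?thesis .
  qed
  show "(\<Sum>x\<in>X. (w x)\<^sup>2) \<le> 2 * K\<^sup>2 * r\<^sup>2 * (Q + \<tau>)"
  proof -
    have "(w x)\<^sup>2 \<le> K\<^sup>2 * (r * (\<Sum>\<alpha>\<in>I. \<bar>T \<alpha> x\<bar> * (2 * (L \<alpha>)\<^sup>2 + 2 * (T \<alpha> x)\<^sup>2)))" if x: "x \<in> X" for x
    proof -
      \<comment> \<open>Schur's test: the modulus of the kernel is split into two square roots.
        Cauchy-Schwarz leaves a column sum here, and the later summation over \<open>x\<close>
        leaves row sums.\<close>
      have "(\<Sum>\<alpha>\<in>I. T \<alpha> x * (N \<alpha> x))\<^sup>2
          \<le> (\<Sum>\<alpha>\<in>I. (sqrt \<bar>T \<alpha> x\<bar>) * (sqrt \<bar>T \<alpha> x\<bar> * \<bar>N \<alpha> x\<bar>))\<^sup>2"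
      proof (rule power2_le_iff_abs_le[THEN iffD2])
        have eq: "\<bar>T \<alpha> x * (N \<alpha> x)\<bar> = sqrt \<bar>T \<alpha> x\<bar> * (sqrt \<bar>T \<alpha> x\<bar> * \<bar>N \<alpha> x\<bar>)" for \<alpha>
          by (simp add: abs_mult flip: mult.assoc)
        show "\<bar>\<Sum>\<alpha>\<in>I. T \<alpha> x * (N \<alpha> x)\<bar> \<le> (\<Sum>\<alpha>\<in>I. (sqrt \<bar>T \<alpha> x\<bar>) * (sqrt \<bar>T \<alpha> x\<bar> * \<bar>N \<alpha> x\<bar>))"
          unfolding eq[symmetric] by (rule sum_abs)
      qed (auto intro!: sum_nonneg)
      also have "\<dots> \<le> (\<Sum>\<alpha>\<in>I. (sqrt \<bar>T \<alpha> x\<bar>)\<^sup>2) * (\<Sum>\<alpha>\<in>I. (sqrt \<bar>T \<alpha> x\<bar> * \<bar>N \<alpha> x\<bar>)\<^sup>2)"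
        by (rule Cauchy_Schwarz_ineq_sum)
      also have "\<dots> = (\<Sum>\<alpha>\<in>I. \<bar>T \<alpha> x\<bar>) * (\<Sum>\<alpha>\<in>I. \<bar>T \<alpha> x\<bar> * (N \<alpha> x)\<^sup>2)"
        by (simp add: power_mult_distrib)
      also have "\<dots> \<le> r * (\<Sum>\<alpha>\<in>I. \<bar>T \<alpha> x\<bar> * (2 * (L \<alpha>)\<^sup>2 + 2 * (T \<alpha> x)\<^sup>2))"
      proof (intro mult_mono col x sum_mono order.refl)
        fix \<alpha>
        have "(N \<alpha> x)\<^sup>2 \<le> 2 * (L \<alpha>)\<^sup>2 + 2 * (T \<alpha> x * e x)\<^sup>2"
          using zero_le_power2[of "L \<alpha> + T \<alpha> x * e x"] by (simp add: N_def power2_eq_square algebra_simps)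
        also have "(T \<alpha> x * e x)\<^sup>2 \<le> (T \<alpha> x)\<^sup>2" using Te[OF x] by (simp add: abs_le_square_iff)
        finally show "(N \<alpha> x)\<^sup>2 \<le> 2 * (L \<alpha>)\<^sup>2 + 2 * (T \<alpha> x)\<^sup>2" by simp
      qed (use r in \<open>auto intro!: sum_nonneg\<close>)
      finally show ?thesis by (simp add: w_def rest[OF x] power_mult_distrib mult_left_mono)
    qed
    then have "(\<Sum>x\<in>X. (w x)\<^sup>2) \<le> (\<Sum>x\<in>X. K\<^sup>2 * (r * (\<Sum>\<alpha>\<in>I. \<bar>T \<alpha> x\<bar> * (2 * (L \<alpha>)\<^sup>2 + 2 * (T \<alpha> x)\<^sup>2))))"
      by (rule sum_mono)
    also have "\<dots> = 2 * K\<^sup>2 * r * (\<Sum>x\<in>X. \<Sum>\<alpha>\<in>I. \<bar>T \<alpha> x\<bar> * (L \<alpha>)\<^sup>2 + \<bar>T \<alpha> x\<bar> * (T \<alpha> x)\<^sup>2)"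
      by (simp add: sum_distrib_left algebra_simps)
    also have "\<dots> = 2 * K\<^sup>2 * r * (\<Sum>\<alpha>\<in>I. \<Sum>x\<in>X. \<bar>T \<alpha> x\<bar> * (L \<alpha>)\<^sup>2 + \<bar>T \<alpha> x\<bar> * (T \<alpha> x)\<^sup>2)"
      by (subst sum.swap) (rule refl)
    also have "\<dots> \<le> 2 * K\<^sup>2 * r * (r * (Q + \<tau>))"
    proof (rule mult_left_mono)
      have "(\<Sum>\<alpha>\<in>I. \<Sum>x\<in>X. \<bar>T \<alpha> x\<bar> * (L \<alpha>)\<^sup>2 + \<bar>T \<alpha> x\<bar> * (T \<alpha> x)\<^sup>2)
          = (\<Sum>\<alpha>\<in>I. (\<Sum>x\<in>X. \<bar>T \<alpha> x\<bar>) * (L \<alpha>)\<^sup>2) + (\<Sum>\<alpha>\<in>I. \<Sum>x\<in>X. \<bar>T \<alpha> x\<bar> * (T \<alpha> x)\<^sup>2)"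
        by (simp add: sum.distrib sum_distrib_right)
      also have "\<dots> \<le> (\<Sum>\<alpha>\<in>I. r * (L \<alpha>)\<^sup>2) + (\<Sum>\<alpha>\<in>I. \<Sum>x\<in>X. r * (T \<alpha> x)\<^sup>2)"
        by (intro add_mono sum_mono mult_right_mono row Tr) auto
      also have "\<dots> = r * (Q + \<tau>)" by (simp add: Q_def \<tau>_def L_def sum_distrib_left algebra_simps)
      finally show "(\<Sum>\<alpha>\<in>I. \<Sum>x\<in>X. \<bar>T \<alpha> x\<bar> * (L \<alpha>)\<^sup>2 + \<bar>T \<alpha> x\<bar> * (T \<alpha> x)\<^sup>2) \<le> r * (Q + \<tau>)" .
    qed (use r in auto)
    also have "\<dots> = 2 * K\<^sup>2 * r\<^sup>2 * (Q + \<tau>)" by (simp add: power2_eq_square)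
    finally show ?thesis .
  qed
qed

section \<open>Periodic functions and sums over the torus\<close>

definition red :: "nat \<Rightarrow> int ^ 'd \<Rightarrow> int ^ 'd" where
  "red n x = (\<chi> j. x $ j mod int n)"

lemma red_in_sites: "n > 0 \<Longrightarrow> red n x \<in> sites n"
  by (simp add: red_def sites_def)

lemma red_site: "x \<in> sites n \<Longrightarrow> red n x = x"
  by (simp add: red_def sites_def vec_eq_iff)

lemma red_red: "red n (red n x) = red n x"
  by (simp add: red_def vec_eq_iff)

lemma red_add_left: "red n (red n x + y) = red n (x + y)"
  by (simp add: red_def vec_eq_iff mod_add_left_eq)

lemma red_eq_iff: "red n x = red n y \<longleftrightarrow> (\<forall>j. int n dvd x $ j - y $ j)"
  by (simp add: red_def vec_eq_iff mod_eq_dvd_iff)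

lemma shift_eq_red: "shift n i x = red n (x + axis i 1)"
  by (simp add: shift_def red_def)

lemma sum_of_bool_mult:
  fixes f :: "'a \<Rightarrow> real"
  assumes "finite A" "a \<in> A"
  shows "(\<Sum>x\<in>A. of_bool (a = x) * f x) = f a"
proof -
  have "(\<Sum>x\<in>A. of_bool (a = x) * f x) = (\<Sum>x\<in>A. if a = x then f x else 0)"
    by (intro sum.cong) auto
  then show ?thesis using assms by simp
qed

text \<open>Functions on the torus are treated as functions of integer vectors that are invariant
  under \<open>red n\<close>; translations are then plain additions, and reduction modulo
  \<open>n\<close> permutes the representatives.\<close>

lemma sum_sites_translate:
  fixes F :: "int ^ 'd::finite \<Rightarrow> real"
  assumes n: "n > 0" and F: "\<And>x. F (red n x) = F x"
  shows "(\<Sum>x\<in>sites n. F (x + c)) = (\<Sum>x\<in>sites n. F x)"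
proof (rule sum.reindex_bij_witness[of _ "\<lambda>x. red n (x - c)" "\<lambda>x. red n (x + c)"])
  show "red n (red n (x + c) - c) = x" if "x \<in> sites n" for x
    using red_add_left[of n "x + c" "- c"] that by (simp add: red_site)
  show "red n (red n (x - c) + c) = x" if "x \<in> sites n" for x
    using red_add_left[of n "x - c" "c"] that by (simp add: red_site)
qed (use n F in \<open>auto simp: red_in_sites\<close>)

lemma sum_sites_of_bool:
  assumes "n > 0" "x \<in> sites n"
  shows "(\<Sum>y\<in>sites n. of_bool (red n (y + c) = x) :: real) = 1"
proof -
  have "(\<Sum>y\<in>sites n. of_bool (red n (y + c) = x) :: real) = (\<Sum>y\<in>sites n. of_bool (red n y = x))"
    by (rule sum_sites_translate[OF assms(1), of "\<lambda>y. of_bool (red n y = x)"]) (simp add: red_red)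
  also have "\<dots> = (\<Sum>y\<in>sites n. of_bool (y = x))" by (intro sum.cong) (auto simp: red_site)
  finally show ?thesis using assms by (simp add: of_bool_def)
qed

section \<open>Push-forwards of weights to the torus\<close>

context
  fixes n :: nat and p :: "'o \<Rightarrow> int ^ 'd::finite"
  assumes n: "n > 0"
begin

text \<open>The inner sum is the push-forward of the weights \<open>c\<close> under \<open>p\<close>
  modulo \<open>n\<close>. The transport fields are linear forms with such coefficients.\<close>

lemma sum_kernel:
  fixes c :: "'o \<Rightarrow> real"
  assumes "finite Z"
  shows "(\<Sum>x\<in>sites n. (\<Sum>z\<in>Z. of_bool (red n (p z) = x) * c z) * f x) = (\<Sum>z\<in>Z. c z * f (red n (p z)))"
proof -
  have "(\<Sum>x\<in>sites n. (\<Sum>z\<in>Z. of_bool (red n (p z) = x) * c z) * f x)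
      = (\<Sum>z\<in>Z. \<Sum>x\<in>sites n. of_bool (red n (p z) = x) * (c z * f x))"
    by (simp only: sum_distrib_right mult.assoc) (rule sum.swap)
  also have "\<dots> = (\<Sum>z\<in>Z. c z * f (red n (p z)))"
    by (intro sum.cong refl sum_of_bool_mult[where f = "\<lambda>x. c _ * f x"] finite_sites red_in_sites n)
  finally show ?thesis .
qed

lemma sum_abs_kernel:
  fixes c :: "'o \<Rightarrow> real"
  assumes "finite Z"
  shows "(\<Sum>x\<in>sites n. \<bar>\<Sum>z\<in>Z. of_bool (red n (p z) = x) * c z\<bar>) \<le> (\<Sum>z\<in>Z. \<bar>c z\<bar>)"
proof -
  have "(\<Sum>x\<in>sites n. \<bar>\<Sum>z\<in>Z. of_bool (red n (p z) = x) * c z\<bar>)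
      \<le> (\<Sum>x\<in>sites n. (\<Sum>z\<in>Z. of_bool (red n (p z) = x) * \<bar>c z\<bar>) * 1)"
    by (intro sum_mono order_trans[OF sum_abs]) (auto simp: abs_mult)
  also have "\<dots> = (\<Sum>z\<in>Z. \<bar>c z\<bar>)" unfolding sum_kernel[OF assms] by simp
  finally show ?thesis .
qed

text \<open>Without collisions a push-forward keeps the l2 norm; this ties the trace in
  \<open>transport_fields\<close> to the energy of the urn flow.\<close>

lemma sum_square_kernel:
  fixes c :: "'o \<Rightarrow> real"
  assumes "finite Z" "inj_on (\<lambda>z. red n (p z)) Z"
  shows "(\<Sum>x\<in>sites n. (\<Sum>z\<in>Z. of_bool (red n (p z) = x) * c z)\<^sup>2) = (\<Sum>z\<in>Z. (c z)\<^sup>2)"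
proof -
  have "(\<Sum>x\<in>sites n. (\<Sum>z\<in>Z. of_bool (red n (p z) = x) * c z)\<^sup>2)
      = (\<Sum>z\<in>Z. c z * (\<Sum>z'\<in>Z. of_bool (red n (p z') = red n (p z)) * c z'))"
    unfolding power2_eq_square by (subst sum_kernel[OF assms(1)]) simp
  also have "\<dots> = (\<Sum>z\<in>Z. c z * c z)"
  proof (intro sum.cong refl arg_cong2[where f = "(*)"])
    fix z assume z: "z \<in> Z"
    have "(\<Sum>z'\<in>Z. of_bool (red n (p z') = red n (p z)) * c z') = (\<Sum>z'\<in>Z. of_bool (z' = z) * c z')"
      using inj_onD[OF assms(2) _ _ z] by (intro sum.cong) auto
    then show "(\<Sum>z'\<in>Z. of_bool (red n (p z') = red n (p z)) * c z') = c z"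
      using z assms(1) sum_of_bool_mult[of Z z c] by (simp add: eq_commute[of z])
  qed
  finally show ?thesis by (simp add: power2_eq_square)
qed

end

lemma sum_square_le_card:
  fixes f :: "'a::finite \<Rightarrow> real"
  shows "(\<Sum>i\<in>UNIV. f i)\<^sup>2 \<le> real CARD('a) * (\<Sum>i\<in>UNIV. (f i)\<^sup>2)"
  using Cauchy_Schwarz_ineq_sum[of "\<lambda>_. 1" f UNIV] by simp

text \<open>Points belonging to different directions \<open>i\<close> may collide. Cauchy-Schwarz
  over the directions costs one factor \<open>CARD('a)\<close>, and adding up their contributions
  the other.\<close>

lemma sum_square_kernel_le:
  fixes p :: "'a::finite \<Rightarrow> 'o \<Rightarrow> int ^ 'd::finite" and c :: "'a \<Rightarrow> 'o \<Rightarrow> real"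
  assumes n: "n > 0" and Z: "finite Z" and inj: "\<And>i. inj_on (\<lambda>z. red n (p i z)) Z"
    and c: "\<And>i z. z \<in> Z \<Longrightarrow> \<bar>c i z\<bar> \<le> c' z"
  shows "(\<Sum>x\<in>sites n. (\<Sum>u\<in>UNIV \<times> Z. of_bool (red n (p (fst u) (snd u)) = x) * c (fst u) (snd u))\<^sup>2)
    \<le> (real CARD('a))\<^sup>2 * (\<Sum>z\<in>Z. (c' z)\<^sup>2)"
proof -
  have "(\<Sum>x\<in>sites n. (\<Sum>u\<in>UNIV \<times> Z. of_bool (red n (p (fst u) (snd u)) = x) * c (fst u) (snd u))\<^sup>2)
    \<le> (\<Sum>x\<in>sites n. real CARD('a) * (\<Sum>i\<in>UNIV. (\<Sum>z\<in>Z. of_bool (red n (p i z) = x) * c i z)\<^sup>2))"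
    by (intro sum_mono) (simp only: sum.cartesian_product' fst_conv snd_conv sum_square_le_card)
  also have "\<dots> = real CARD('a) * (\<Sum>i\<in>UNIV. \<Sum>z\<in>Z. (c i z)\<^sup>2)"
    by (simp only: sum_distrib_left[symmetric], subst sum.swap) (simp only: sum_square_kernel[OF n Z inj])
  also have "\<dots> \<le> real CARD('a) * (\<Sum>i\<in>(UNIV :: 'a set). \<Sum>z\<in>Z. (c' z)\<^sup>2)"
    using c by (intro mult_left_mono sum_mono power2_le_iff_abs_le[THEN iffD2]) (auto intro: order_trans[OF abs_ge_zero])
  also have "\<dots> = (real CARD('a))\<^sup>2 * (\<Sum>z\<in>Z. (c' z)\<^sup>2)" by (simp add: power2_eq_square)
  finally show ?thesis .
qed

lemma sum_swap4:
  "(\<Sum>i\<in>I. \<Sum>z\<in>Z. \<Sum>j\<in>J. \<Sum>y\<in>Y. f i z j y) = (\<Sum>y\<in>Y. \<Sum>j\<in>J. \<Sum>i\<in>I. \<Sum>z\<in>Z. f i z j y)"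
proof -
  have "(\<Sum>i\<in>I. \<Sum>z\<in>Z. \<Sum>j\<in>J. \<Sum>y\<in>Y. f i z j y) = (\<Sum>i\<in>I. \<Sum>j\<in>J. \<Sum>z\<in>Z. \<Sum>y\<in>Y. f i z j y)"
    by (rule sum.cong[OF refl], rule sum.swap)
  also have "\<dots> = (\<Sum>i\<in>I. \<Sum>j\<in>J. \<Sum>y\<in>Y. \<Sum>z\<in>Z. f i z j y)"
    by (rule sum.cong[OF refl], rule sum.cong[OF refl], rule sum.swap)
  also have "\<dots> = (\<Sum>i\<in>I. \<Sum>y\<in>Y. \<Sum>j\<in>J. \<Sum>z\<in>Z. f i z j y)"
    by (rule sum.cong[OF refl], rule sum.swap)
  also have "\<dots> = (\<Sum>y\<in>Y. \<Sum>i\<in>I. \<Sum>j\<in>J. \<Sum>z\<in>Z. f i z j y)"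
    by (rule sum.swap)
  also have "\<dots> = (\<Sum>y\<in>Y. \<Sum>j\<in>J. \<Sum>i\<in>I. \<Sum>z\<in>Z. f i z j y)"
    by (rule sum.cong[OF refl], rule sum.swap)
  finally show ?thesis .
qed

text \<open>\<open>r\<close> bounds the row and column sums in \<open>transport_fields\<close>, and
  \<open>K\<close> is the strength of the damping there. The four conditions give, in order: |U|
  \<le> n; a bound b/4 on each of the two parts of \<open>w\<close>; and a cost of the damping of at
  most \<open>Q + \<tau>\<close>.\<close>

definition small_coupling :: "real \<Rightarrow> nat \<Rightarrow> real \<Rightarrow> bool" where
  "small_coupling b d \<kappa> \<longleftrightarrow> (let K = 2 + 4 / b; r = 2 * real d * \<kappa> in
     r \<le> 1 \<and> r \<le> b / 4 \<and> K * r\<^sup>2 \<le> b / 4 \<and> 8 / b * K\<^sup>2 * r\<^sup>2 \<le> 1)"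

text \<open>\<open>K + 1\<close> times the bound on the trace \<open>\<tau>\<close>. The number 20
  is 2 (9 + 1): the 2 is from \<open>sum_inverse_layer_card\<close>, the 9 from n \<le> 3 (n -
  2).\<close>

definition spectral_const :: "real \<Rightarrow> nat \<Rightarrow> real \<Rightarrow> nat \<Rightarrow> real" where
  "spectral_const b d \<kappa> n = (3 + 4 / b) * (20 * (real d * \<kappa>)\<^sup>2 * (real n ^ d / (real n)\<^sup>2) * g_scale d n)"

text \<open>The field \<open>w\<close> drives the flips and \<open>U\<close> the exchanges.  \<open>U\<close> transports \<open>e (x + e\<^sub>i)\<close> to its
  average over a corner of size \<open>n\<close> based at \<open>x + e\<^sub>i\<close>, a set that avoids \<open>x\<close>; one part of \<open>w\<close>
  cancels this average and the other one, a damping, absorbs the quadratic errors.\<close>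

lemma transport_fields:
  fixes G :: "'d::finite \<Rightarrow> int ^ 'd \<Rightarrow> real"
  assumes n: "n \<ge> 3" and G_per: "\<And>i x. G i (red n x) = G i x"
    and G_bound: "\<And>i x. \<bar>G i x\<bar> \<le> \<kappa>" and b: "b > 0"
    and small: "small_coupling b CARD('d) \<kappa>"
  obtains w :: "(int ^ 'd \<Rightarrow> real) \<Rightarrow> int ^ 'd \<Rightarrow> real" and U :: "(int ^ 'd \<Rightarrow> real) \<Rightarrow> int ^ 'd \<Rightarrow> 'd \<Rightarrow> real" where
    "\<And>e e' x. x \<in> sites n \<Longrightarrow> (\<And>y. red n y \<noteq> x \<Longrightarrow> e y = e' y) \<Longrightarrow> w e x = w e' x"
    "\<And>e e' y j. y \<in> sites n \<Longrightarrow> (\<And>z. red n z \<noteq> y \<Longrightarrow> red n z \<noteq> red n (y + axis j 1) \<Longrightarrow> e z = e' z) \<Longrightarrow> U e y j = U e' y j"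
    "\<And>e x. (\<And>y. e (red n y) = e y) \<Longrightarrow> (\<And>y. \<bar>e y\<bar> \<le> 1) \<Longrightarrow> x \<in> sites n \<Longrightarrow> \<bar>w e x\<bar> \<le> b / 2"
    "\<And>e y j. (\<And>y. e (red n y) = e y) \<Longrightarrow> (\<And>y. \<bar>e y\<bar> \<le> 1) \<Longrightarrow> y \<in> sites n \<Longrightarrow> \<bar>U e y j\<bar> \<le> real n"
    "\<And>e. (\<And>y. e (red n y) = e y) \<Longrightarrow> (\<And>y. \<bar>e y\<bar> \<le> 1) \<Longrightarrow>
      (\<Sum>x\<in>sites n. \<Sum>i\<in>UNIV. G i x * e x * e (x + axis i 1))
      + (\<Sum>x\<in>sites n. - e x * w e x + 2 / b * (w e x)\<^sup>2)
      + (\<Sum>y\<in>sites n. \<Sum>j\<in>UNIV. (e (y + axis j 1) - e y) * U e y j + (U e y j)\<^sup>2 / (real n)\<^sup>2)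
      \<le> spectral_const b CARD('d) \<kappa> n"
proof -
  define K where "K = 2 + 4 / b"
  define r where "r = 2 * real CARD('d) * \<kappa>"
  have r1: "r \<le> 1" and r2: "r \<le> b / 4" and r3: "K * r\<^sup>2 \<le> b / 4" and r4: "8 / b * K\<^sup>2 * r\<^sup>2 \<le> 1"
    using small unfolding small_coupling_def Let_def K_def r_def by blast+
  \<comment> \<open>Points of the corner have coordinates at most n - 3. Hence 1 + z_i and 2 + z_i
    stay strictly between 0 and n, so that x + e_i + z never wraps round to x, and y - e_i - z meets
    neither y nor y + e_j.\<close>
  define l where "l = n - 2"
  have l: "l \<ge> 1" using n by (simp add: l_def)
  have n0: "n > 0" using n by simp
  define R where "R = (\<Sum>k<l. 1 / layer_card TYPE('d) k)"
  have R: "R \<le> 2 * g_scale CARD('d) n"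
  proof -
    have "R \<le> (\<Sum>k<n-1. 1 / layer_card TYPE('d) k)" unfolding R_def l_def
      by (rule sum_mono2) auto
    also have "\<dots> \<le> 2 * g_scale CARD('d) n" by (rule sum_inverse_layer_card[OF n])
    finally show ?thesis .
  qed
  have R0: "R \<ge> 0" unfolding R_def by (intro sum_nonneg) auto
  obtain q :: "int ^ 'd \<Rightarrow> real" and \<phi> :: "int ^ 'd \<Rightarrow> 'd \<Rightarrow> real" where
    q0: "\<And>z. z \<in> corner l \<Longrightarrow> 0 \<le> q z" and \<phi>0: "\<And>z j. z \<in> corner l \<Longrightarrow> 0 \<le> \<phi> z j" and
    q1: "(\<Sum>z\<in>corner l. q z) = 1" and \<phi>1: "(\<Sum>z\<in>corner l. \<Sum>j\<in>UNIV. \<phi> z j) \<le> real l" and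
    q2: "(\<Sum>z\<in>corner l. (q z)\<^sup>2) = R / (real l)\<^sup>2" and \<phi>2: "(\<Sum>z\<in>corner l. \<Sum>j\<in>UNIV. (\<phi> z j)\<^sup>2) \<le> R" and
    flow: "\<And>f. f 0 - (\<Sum>z\<in>corner l. q z * f z)
        = (\<Sum>z\<in>corner l. \<Sum>j\<in>UNIV. \<phi> z j * (f z - f (z + axis j 1)))"
    using urn_flow[where 'd='d, OF l, folded R_def] by blast
  define Z where "Z = (UNIV :: 'd set) \<times> (corner l :: (int ^ 'd) set)"
  have finZ: "finite Z" by (simp add: Z_def)
  have zc: "0 \<le> z $ i" "z $ i < int l" if "z \<in> corner l" for z :: "int ^ 'd" and i
    using that coord_le_sum[of z i] by (force simp: corner_def)+
  \<comment> \<open>\<open>p1 x (i, z)\<close> is a site over which the value at x + e_i is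
    averaged, and \<open>p2 y (i, z)\<close> is the base point whose flow for direction
    \<open>i\<close> passes through \<open>y\<close>. The factor 1 / n in \<open>c2\<close> puts
    averages and flows on the same footing.\<close>
  define p1 where "p1 x o' = x + axis (fst o') 1 + snd o'" for x :: "int ^ 'd" and o' :: "'d \<times> (int ^ 'd)"
  define p2 where "p2 y o' = y - axis (fst o') 1 - snd o'" for y :: "int ^ 'd" and o' :: "'d \<times> (int ^ 'd)"
  define c1 where "c1 x o' = G (fst o') x * q (snd o')" for x :: "int ^ 'd" and o' :: "'d \<times> (int ^ 'd)"
  define c2 where "c2 y j o' = G (fst o') (p2 y o') * \<phi> (snd o') j / real n" for y :: "int ^ 'd" and j and o' :: "'d \<times> (int ^ 'd)"
  \<comment> \<open>The linear forms to be damped: \<open>Inl x\<close> is the average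
    \<open>w1\<close> at \<open>x\<close>, and \<open>Inr (y, j)\<close> is \<open>U / n\<close> on
    the edge from \<open>y\<close> in direction \<open>j\<close>. The sum \<open>Q\<close> of their
    squares controls all quadratic errors.\<close>
  define T where "T \<alpha> x = (case \<alpha> of Inl x' \<Rightarrow> \<Sum>o'\<in>Z. of_bool (red n (p1 x' o') = x) * c1 x' o'
     | Inr (y, j) \<Rightarrow> \<Sum>o'\<in>Z. of_bool (red n (p2 y o') = x) * c2 y j o')" for \<alpha> :: "(int ^ 'd) + (int ^ 'd) \<times> 'd" and x
  define I where "I = (sites n :: (int ^ 'd) set) <+> (sites n :: (int ^ 'd) set) \<times> (UNIV :: 'd set)"
  have finI: "finite I" by (simp add: I_def)
  have sum_I: "(\<Sum>\<alpha>\<in>I. F \<alpha>) = (\<Sum>x\<in>sites n. F (Inl x)) + (\<Sum>y\<in>sites n. \<Sum>j\<in>UNIV. F (Inr (y, j)))" for F :: "_ \<Rightarrow> real"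
    unfolding I_def by (simp add: sum.Plus sum.cartesian_product)
  define w1 where "w1 e x = (\<Sum>o'\<in>Z. c1 x o' * e (p1 x o'))" for e x
  define U where "U e y j = real n * (\<Sum>o'\<in>Z. c2 y j o' * e (p2 y o'))" for e y j
  define w2 where "w2 e x = K * (\<Sum>\<alpha>\<in>I. T \<alpha> x * (\<Sum>y\<in>sites n - {x}. T \<alpha> y * e y))" for e x
  define w where "w e x = w1 e x + w2 e x" for e x
  define \<tau> where "\<tau> = (\<Sum>\<alpha>\<in>I. \<Sum>x\<in>sites n. (T \<alpha> x)\<^sup>2)"
  have K0: "K \<ge> 0" using b by (simp add: K_def)
  have \<kappa>0: "\<kappa> \<ge> 0" using G_bound[of undefined undefined] by linarith
  have r0: "r \<ge> 0" using \<kappa>0 by (simp add: r_def)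
  have ln: "real l \<le> real n" by (simp add: l_def)
  define d where "d = real CARD('d)"
  have d0: "d \<ge> 0" by (simp add: d_def)

  have c1b: "\<bar>c1 x o'\<bar> \<le> \<kappa> * q (snd o')" if "o' \<in> Z" for x o'
    unfolding c1_def abs_mult using that q0[of "snd o'"] G_bound by (auto simp: Z_def intro!: mult_right_mono)
  have c2b: "\<bar>c2 y j o'\<bar> \<le> \<kappa> * \<phi> (snd o') j / real n" if "o' \<in> Z" for y j o'
    unfolding c2_def abs_mult abs_divide using that \<phi>0[of "snd o'" j] G_bound
    by (auto simp: Z_def intro!: divide_right_mono mult_right_mono)
  have sumZ: "(\<Sum>o'\<in>Z. F (snd o')) = d * (\<Sum>z\<in>corner l. F z)" for F :: "int ^ 'd \<Rightarrow> real"
    unfolding Z_def d_def by (simp add: sum.cartesian_product' )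
  have s1: "(\<Sum>o'\<in>Z. \<kappa> * q (snd o')) = d * \<kappa>"
    using sumZ[of "\<lambda>z. \<kappa> * q z"] by (simp add: q1 flip: sum_distrib_left)
  have s2: "(\<Sum>o'\<in>Z. \<Sum>j\<in>UNIV. \<kappa> * \<phi> (snd o') j / real n) \<le> d * \<kappa>"
  proof -
    have "(\<Sum>o'\<in>Z. \<Sum>j\<in>UNIV. \<kappa> * \<phi> (snd o') j / real n) = d * \<kappa> * ((\<Sum>z\<in>corner l. \<Sum>j\<in>UNIV. \<phi> z j) / real n)"
      using sumZ[of "\<lambda>z. \<Sum>j\<in>UNIV. \<kappa> * \<phi> z j / real n"] by (simp add: sum_distrib_left sum_divide_distrib algebra_simps)
    \<comment> \<open>The total flow is the expected number of urn steps, at most l \<le> n; the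
      factor 1 / n compensates it.\<close>
    also have "\<dots> \<le> d * \<kappa> * 1" using \<phi>1 ln n0 d0 \<kappa>0
      by (intro mult_left_mono) (auto simp: divide_le_eq)
    finally show ?thesis by simp
  qed
  have s2j: "(\<Sum>o'\<in>Z. \<kappa> * \<phi> (snd o') j / real n) \<le> d * \<kappa>" for j
  proof -
    have "(\<Sum>o'\<in>Z. \<kappa> * \<phi> (snd o') j / real n) \<le> (\<Sum>o'\<in>Z. \<Sum>j\<in>UNIV. \<kappa> * \<phi> (snd o') j / real n)"
      by (intro sum_mono member_le_sum) (use \<phi>0 \<kappa>0 in \<open>auto simp: Z_def\<close>)
    then show ?thesis using s2 by simp
  qed
  have dk: "d * \<kappa> \<le> r" using d0 \<kappa>0 by (simp add: r_def d_def)

  have row: "(\<Sum>x\<in>sites n. \<bar>T \<alpha> x\<bar>) \<le> r" if "\<alpha> \<in> I" for \<alpha>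
  proof (cases \<alpha>)
    case (Inl x')
    have "(\<Sum>x\<in>sites n. \<bar>T \<alpha> x\<bar>) \<le> (\<Sum>o'\<in>Z. \<bar>c1 x' o'\<bar>)"
      unfolding T_def Inl by (simp add: sum_abs_kernel[OF n0 finZ])
    also have "\<dots> \<le> (\<Sum>o'\<in>Z. \<kappa> * q (snd o'))" by (intro sum_mono c1b)
    finally show ?thesis using s1 dk by simp
  next
    case (Inr yj)
    obtain y j where yj: "yj = (y, j)" by (cases yj)
    have "(\<Sum>x\<in>sites n. \<bar>T \<alpha> x\<bar>) \<le> (\<Sum>o'\<in>Z. \<bar>c2 y j o'\<bar>)"
      unfolding T_def Inr yj by (simp add: sum_abs_kernel[OF n0 finZ])
    also have "\<dots> \<le> (\<Sum>o'\<in>Z. \<kappa> * \<phi> (snd o') j / real n)" by (intro sum_mono c2b)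
    finally show ?thesis using s2j[of j] dk by simp
  qed
  \<comment> \<open>Both kinds of forms meet the site \<open>x\<close>, each with total weight at
    most d \<kappa>; hence the factor 2 in \<open>r\<close>.\<close>
  have col: "(\<Sum>\<alpha>\<in>I. \<bar>T \<alpha> x\<bar>) \<le> r" if x: "x \<in> sites n" for x
  proof -
    have "(\<Sum>x'\<in>sites n. \<bar>T (Inl x') x\<bar>) \<le> (\<Sum>x'\<in>sites n. \<Sum>o'\<in>Z. of_bool (red n (x' + (axis (fst o') 1 + snd o')) = x) * (\<kappa> * q (snd o')))"
      unfolding T_def sum.case
    proof (intro sum_mono order_trans[OF sum_abs])
      fix x' o' assume "o' \<in> Z"
      then show "\<bar>of_bool (red n (p1 x' o') = x) * c1 x' o'\<bar> \<le> of_bool (red n (x' + (axis (fst o') 1 + snd o')) = x) * (\<kappa> * q (snd o'))"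
        using c1b[of o' x'] by (auto simp: p1_def add.assoc)
    qed
    also have "\<dots> = (\<Sum>o'\<in>Z. \<kappa> * q (snd o'))"
      by (subst sum.swap) (simp only: sum_distrib_right[symmetric] sum_sites_of_bool[OF n0 x] mult_1_left)
    finally have 1: "(\<Sum>x'\<in>sites n. \<bar>T (Inl x') x\<bar>) \<le> d * \<kappa>" using s1 by simp
    have "(\<Sum>y\<in>sites n. \<Sum>j\<in>UNIV. \<bar>T (Inr (y, j)) x\<bar>)
       \<le> (\<Sum>y\<in>sites n. \<Sum>j\<in>UNIV. \<Sum>o'\<in>Z. of_bool (red n (y + (- axis (fst o') 1 - snd o')) = x) * (\<kappa> * \<phi> (snd o') j / real n))"
      unfolding T_def sum.case prod.case
    proof (intro sum_mono order_trans[OF sum_abs])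
      fix y j o' assume "o' \<in> Z"
      then show "\<bar>of_bool (red n (p2 y o') = x) * c2 y j o'\<bar> \<le> of_bool (red n (y + (- axis (fst o') 1 - snd o')) = x) * (\<kappa> * \<phi> (snd o') j / real n)"
        using c2b[of o' y j] by (auto simp: p2_def diff_conv_add_uminus[symmetric] add_diff_eq)
    qed
    also have "\<dots> = (\<Sum>y\<in>sites n. \<Sum>o'\<in>Z. of_bool (red n (y + (- axis (fst o') 1 - snd o')) = x) * (\<Sum>j\<in>UNIV. \<kappa> * \<phi> (snd o') j / real n))"
      by (intro sum.cong refl, subst sum.swap) (simp only: sum_distrib_left)
    also have "\<dots> = (\<Sum>o'\<in>Z. \<Sum>j\<in>UNIV. \<kappa> * \<phi> (snd o') j / real n)"
      by (subst sum.swap) (simp only: sum_distrib_right[symmetric] sum_sites_of_bool[OF n0 x] mult_1_left)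
    finally have 2: "(\<Sum>y\<in>sites n. \<Sum>j\<in>UNIV. \<bar>T (Inr (y, j)) x\<bar>) \<le> d * \<kappa>" using s2 by simp
    show ?thesis using 1 2 unfolding sum_I by (simp add: r_def d_def)
  qed

  have corner_eq: "z = z'" if z: "z \<in> corner l" "z' \<in> corner l" and dvd: "\<And>j. int n dvd z $ j - z' $ j" for z z' :: "int ^ 'd"
  proof -
    have "z $ j = z' $ j" for j
    proof -
      have "\<bar>z $ j - z' $ j\<bar> < int n" using zc[OF z(1), of j] zc[OF z(2), of j] ln by linarith
      then show ?thesis using dvd[of j] zdvd_imp_le[of "int n" "\<bar>z $ j - z' $ j\<bar>"] by (cases "z $ j = z' $ j") auto
    qed
    then show ?thesis by (simp add: vec_eq_iff)
  qed
  have inj1: "inj_on (\<lambda>z. red n (x + axis i 1 + z)) (corner l)" for x :: "int ^ 'd" and i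
    by (rule inj_onI, rule corner_eq) (auto simp: red_eq_iff)
  have inj2: "inj_on (\<lambda>z. red n (x - axis i 1 - z)) (corner l)" for x :: "int ^ 'd" and i
    by (rule inj_onI, rule sym, rule corner_eq) (auto simp: red_eq_iff)

  have T1sq: "(\<Sum>x\<in>sites n. (T (Inl x') x)\<^sup>2) \<le> d * (d * \<kappa>\<^sup>2 * (R / (real l)\<^sup>2))" for x'
  proof -
    have "(\<Sum>x\<in>sites n. (T (Inl x') x)\<^sup>2) \<le> (real CARD('d))\<^sup>2 * (\<Sum>z\<in>corner l. (\<kappa> * q z)\<^sup>2)"
      unfolding T_def sum.case p1_def c1_def Z_def
      by (rule sum_square_kernel_le[OF n0 finite_corner inj1]) (use c1b in \<open>force simp: c1_def Z_def\<close>)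
    also have "(\<Sum>z\<in>corner l. (\<kappa> * q z)\<^sup>2) = \<kappa>\<^sup>2 * (R / (real l)\<^sup>2)"
      by (simp only: power_mult_distrib sum_distrib_left[symmetric] q2)
    finally show ?thesis by (simp only: d_def power2_eq_square mult.assoc)
  qed
  have T2sq: "(\<Sum>j\<in>UNIV. \<Sum>x\<in>sites n. (T (Inr (y, j)) x)\<^sup>2) \<le> d * (d * \<kappa>\<^sup>2 * (R / (real n)\<^sup>2))" for y
  proof -
    have "(\<Sum>x\<in>sites n. (T (Inr (y, j)) x)\<^sup>2) \<le> (real CARD('d))\<^sup>2 * (\<Sum>z\<in>corner l. (\<kappa> * \<phi> z j / real n)\<^sup>2)" for j
      unfolding T_def sum.case prod.case p2_def c2_def Z_def
      by (rule sum_square_kernel_le[OF n0 finite_corner inj2]) (use c2b in \<open>force simp: c2_def p2_def Z_def\<close>)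
    then have "(\<Sum>j\<in>UNIV. \<Sum>x\<in>sites n. (T (Inr (y, j)) x)\<^sup>2)
       \<le> (\<Sum>j\<in>UNIV. (real CARD('d))\<^sup>2 * (\<Sum>z\<in>corner l. (\<kappa> * \<phi> z j / real n)\<^sup>2))" by (rule sum_mono)
    also have "\<dots> = d * (d * \<kappa>\<^sup>2 * ((\<Sum>z\<in>corner l. \<Sum>j\<in>UNIV. (\<phi> z j)\<^sup>2) / (real n)\<^sup>2))"
      unfolding sum.swap[of "\<lambda>z j. (\<phi> z j)\<^sup>2" UNIV "corner l"]
      by (simp add: d_def sum_distrib_left sum_divide_distrib power_mult_distrib power_divide power2_eq_square mult_ac)
    also have "\<dots> \<le> d * (d * \<kappa>\<^sup>2 * (R / (real n)\<^sup>2))"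
      using \<phi>2 d0 by (intro mult_left_mono divide_right_mono) auto
    finally show ?thesis .
  qed
  \<comment> \<open>Each of the n^d sites contributes at most R / l^2 through the averages and R /
    n^2 through the flow, up to (d \<kappa>)^2. The trace is thus of order n^(d-2) g_d(n).\<close>
  have \<tau>: "\<tau> \<le> 20 * (d * \<kappa>)\<^sup>2 * (real n ^ CARD('d) / (real n)\<^sup>2) * g_scale CARD('d) n"
  proof -
    have "\<tau> \<le> (\<Sum>x\<in>(sites n :: (int ^ 'd) set). d * (d * \<kappa>\<^sup>2 * (R / (real l)\<^sup>2))) + (\<Sum>x\<in>(sites n :: (int ^ 'd) set). d * (d * \<kappa>\<^sup>2 * (R / (real n)\<^sup>2)))"
      unfolding \<tau>_def sum_I by (intro add_mono sum_mono T1sq T2sq)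
    also have "\<dots> = real n ^ CARD('d) * ((d * \<kappa>)\<^sup>2 * R * (1 / (real l)\<^sup>2 + 1 / (real n)\<^sup>2))"
      by (simp add: card_sites power2_eq_square algebra_simps)
    also have "\<dots> \<le> real n ^ CARD('d) * ((d * \<kappa>)\<^sup>2 * (2 * g_scale CARD('d) n) * (9 / (real n)\<^sup>2 + 1 / (real n)\<^sup>2))"
    proof -
      have "real n \<le> 3 * real l" using n by (simp add: l_def)
      then have "(real n)\<^sup>2 \<le> (3 * real l)\<^sup>2" by (intro power_mono) auto
      then have "1 / (real l)\<^sup>2 \<le> 9 / (real n)\<^sup>2" using l n0 by (simp add: field_simps)
      then show ?thesis using R R0 by (intro mult_left_mono mult_mono add_mono) auto
    qed
    also have "\<dots> = 20 * (d * \<kappa>)\<^sup>2 * (real n ^ CARD('d) / (real n)\<^sup>2) * g_scale CARD('d) n"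
      by (simp add: field_simps)
    finally show ?thesis .
  qed

  have LT1: "(\<Sum>x\<in>sites n. T (Inl x') x * e x) = w1 e x'" if "\<And>y. e (red n y) = e y" for e x'
    unfolding T_def sum.case sum_kernel[OF n0 finZ] w1_def by (simp add: that)
  have LT2: "(\<Sum>x\<in>sites n. T (Inr (y, j)) x * e x) = U e y j / real n" if "\<And>y. e (red n y) = e y" for e y j
    unfolding T_def sum.case prod.case sum_kernel[OF n0 finZ] U_def using n0 by (simp add: that)
  have Lbound: "\<bar>\<Sum>x\<in>sites n. T \<alpha> x * e x\<bar> \<le> r" if "\<And>y. \<bar>e y\<bar> \<le> 1" "\<alpha> \<in> I" for e \<alpha>
  proof -
    have "\<bar>\<Sum>x\<in>sites n. T \<alpha> x * e x\<bar> \<le> (\<Sum>x\<in>sites n. \<bar>T \<alpha> x\<bar>)"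
      by (rule order_trans[OF sum_abs sum_mono]) (auto simp: abs_mult intro!: mult_left_le that(1))
    then show ?thesis using row[OF that(2)] by simp
  qed

  show ?thesis
  proof (rule that[of w U])
    fix e e' :: "int ^ 'd \<Rightarrow> real" and x :: "int ^ 'd"
    assume x: "x \<in> sites n" and ee: "\<And>y. red n y \<noteq> x \<Longrightarrow> e y = e' y"
    have "red n (p1 x o') \<noteq> x" if "o' \<in> Z" for o'
    proof
      assume "red n (p1 x o') = x"
      then have "red n (p1 x o') = red n x" using x by (simp add: red_site)
      then have "int n dvd p1 x o' $ fst o' - x $ fst o'" by (simp add: red_eq_iff)
      then have "int n dvd 1 + snd o' $ fst o'" by (simp add: p1_def axis_def)
      moreover have "0 < 1 + snd o' $ fst o'" "1 + snd o' $ fst o' < int n"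
        using zc[of "snd o'" "fst o'"] that n by (auto simp: Z_def l_def)
      ultimately show False using zdvd_imp_le by fastforce
    qed
    then have "w1 e x = w1 e' x" unfolding w1_def by (intro sum.cong) (auto simp: ee)
    moreover have "w2 e x = w2 e' x" unfolding w2_def
      by (intro arg_cong2[where f = "(*)"] sum.cong) (auto simp: ee red_site)
    ultimately show "w e x = w e' x" by (simp add: w_def)
  next
    fix e e' :: "int ^ 'd \<Rightarrow> real" and y :: "int ^ 'd" and j
    assume y: "y \<in> sites n" and ee: "\<And>z. red n z \<noteq> y \<Longrightarrow> red n z \<noteq> red n (y + axis j 1) \<Longrightarrow> e z = e' z"
    have "red n (p2 y o') \<noteq> y" "red n (p2 y o') \<noteq> red n (y + axis j 1)" if "o' \<in> Z" for o'
    proof -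
      have z: "0 \<le> snd o' $ fst o'" "snd o' $ fst o' < int n - 2"
        using zc[of "snd o'" "fst o'"] that n by (auto simp: Z_def l_def)
      have "red n (p2 y o') \<noteq> red n y"
      proof
        assume "red n (p2 y o') = red n y"
        then have "int n dvd y $ fst o' - p2 y o' $ fst o'" by (metis red_eq_iff)
        then have "int n dvd 1 + snd o' $ fst o'" by (simp add: p2_def axis_def)
        moreover have "0 < 1 + snd o' $ fst o'" "1 + snd o' $ fst o' < int n" using z by auto
        ultimately show False using zdvd_imp_le by fastforce
      qed
      then show "red n (p2 y o') \<noteq> y" using y by (simp add: red_site)
      show "red n (p2 y o') \<noteq> red n (y + axis j 1)"
      proof
        assume "red n (p2 y o') = red n (y + axis j 1)"
        then have "int n dvd (y + axis j 1) $ fst o' - p2 y o' $ fst o'" by (metis red_eq_iff)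
        then have "int n dvd (if fst o' = j then 1 else 0) + (1 + snd o' $ fst o')" by (simp add: p2_def axis_def algebra_simps)
        moreover have "0 < (if fst o' = j then 1 else 0) + (1 + snd o' $ fst o')"
          "(if fst o' = j then 1 else 0) + (1 + snd o' $ fst o') < int n" using z by auto
        ultimately show False using zdvd_imp_le by fastforce
      qed
    qed
    then show "U e y j = U e' y j" unfolding U_def by (intro arg_cong2[where f = "(*)"] sum.cong) (auto simp: ee)
  next
    fix e :: "int ^ 'd \<Rightarrow> real" and x :: "int ^ 'd"
    assume ep: "\<And>y. e (red n y) = e y" and e1: "\<And>y. \<bar>e y\<bar> \<le> 1" and x: "x \<in> sites n"
    have "\<bar>w1 e x\<bar> \<le> r" using Lbound[of e, OF e1, of "Inl x"] x unfolding LT1[of e, OF ep] by (simp add: I_def InlI)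
    moreover have "\<bar>w2 e x\<bar> \<le> K * r\<^sup>2" unfolding w2_def
      by (rule absorption_bound[OF finite_sites finI e1 row col r0 K0 x])
    ultimately show "\<bar>w e x\<bar> \<le> b / 2" using r2 r3 unfolding w_def by linarith
  next
    fix e :: "int ^ 'd \<Rightarrow> real" and y :: "int ^ 'd" and j
    assume ep: "\<And>y. e (red n y) = e y" and e1: "\<And>y. \<bar>e y\<bar> \<le> 1" and y: "y \<in> sites n"
    have "\<bar>U e y j / real n\<bar> \<le> 1" using Lbound[of e, OF e1, of "Inr (y, j)"] y r1 unfolding LT2[of e, OF ep] by (simp add: I_def InrI)
    then show "\<bar>U e y j\<bar> \<le> real n" using n0 by (simp add: abs_divide divide_le_eq)
  next
    fix e :: "int ^ 'd \<Rightarrow> real"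
    assume ep: "\<And>y. e (red n y) = e y" and e1: "\<And>y. \<bar>e y\<bar> \<le> 1"
    have ered: "e (red n x + c) = e (x + c)" for x c
      using ep[of "red n x + c"] ep[of "x + c"] by (simp add: red_add_left)
    define Q where "Q = (\<Sum>\<alpha>\<in>I. (\<Sum>x\<in>sites n. T \<alpha> x * e x)\<^sup>2)"
    have Q: "Q = (\<Sum>x\<in>sites n. (w1 e x)\<^sup>2) + (\<Sum>y\<in>sites n. \<Sum>j\<in>UNIV. (U e y j)\<^sup>2 / (real n)\<^sup>2)"
      unfolding Q_def sum_I LT1[of e, OF ep] LT2[of e, OF ep] by (simp add: power_divide)
    \<comment> \<open>The flow identity is applied to z \<mapsto> e (x + e_i + z), and the sum is
      then reordered by the starting point y = x + e_i + z of the edge. All base points whose flow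
      uses the edge are collected in \<open>U\<close>.\<close>
    have transport: "(\<Sum>x\<in>sites n. \<Sum>i\<in>UNIV. G i x * e x * e (x + axis i 1))
      = (\<Sum>x\<in>sites n. e x * w1 e x) + (\<Sum>y\<in>sites n. \<Sum>j\<in>UNIV. (e y - e (y + axis j 1)) * U e y j)"
    proof -
      have "e x * w1 e x = (\<Sum>i\<in>UNIV. G i x * e x * (\<Sum>z\<in>corner l. q z * e (x + axis i 1 + z)))" for x
        unfolding w1_def Z_def by (simp only: sum.cartesian_product') (simp add: c1_def p1_def sum_distrib_left algebra_simps)
      then have "(\<Sum>x\<in>sites n. \<Sum>i\<in>UNIV. G i x * e x * e (x + axis i 1)) - (\<Sum>x\<in>sites n. e x * w1 e x)
        = (\<Sum>x\<in>sites n. \<Sum>i\<in>UNIV. G i x * e x * (e (x + axis i 1 + 0) - (\<Sum>z\<in>corner l. q z * e (x + axis i 1 + z))))"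
        by (simp add: right_diff_distrib sum_subtractf)
      also have "\<dots> = (\<Sum>x\<in>sites n. \<Sum>i\<in>UNIV. \<Sum>z\<in>corner l. \<Sum>j\<in>UNIV. G i x * e x * \<phi> z j * (e (x + axis i 1 + z) - e (x + axis i 1 + z + axis j 1)))"
        unfolding flow[of "\<lambda>z. e (_ + z)"] by (simp add: sum_distrib_left mult.assoc add.assoc)
      also have "\<dots> = (\<Sum>i\<in>UNIV. \<Sum>z\<in>corner l. \<Sum>j\<in>UNIV. \<Sum>x\<in>sites n. G i x * e x * \<phi> z j * (e (x + axis i 1 + z) - e (x + axis i 1 + z + axis j 1)))"
        by (simp only: sum.swap[of _ _ "sites n"])
      also have "\<dots> = (\<Sum>i\<in>UNIV. \<Sum>z\<in>corner l. \<Sum>j\<in>UNIV. \<Sum>y\<in>sites n. G i (y - axis i 1 - z) * e (y - axis i 1 - z) * \<phi> z j * (e y - e (y + axis j 1)))"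
      proof (rule sum.cong[OF refl], rule sum.cong[OF refl], rule sum.cong[OF refl])
        fix i j :: 'd and z :: "int ^ 'd"
        define F where "F x = G i x * e x * \<phi> z j * (e (x + axis i 1 + z) - e (x + axis i 1 + z + axis j 1))" for x
        have "F (red n x) = F x" for x
          using ered[of x "axis i 1 + z"] ered[of x "axis i 1 + z + axis j 1"] by (simp add: F_def G_per ep add.assoc)
        from sum_sites_translate[where F = F, OF n0 this, of "- axis i 1 - z"]
        show "(\<Sum>x\<in>sites n. G i x * e x * \<phi> z j * (e (x + axis i 1 + z) - e (x + axis i 1 + z + axis j 1)))
           = (\<Sum>y\<in>sites n. G i (y - axis i 1 - z) * e (y - axis i 1 - z) * \<phi> z j * (e y - e (y + axis j 1)))"
          by (simp add: F_def algebra_simps)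
      qed
      also have "\<dots> = (\<Sum>y\<in>sites n. \<Sum>j\<in>UNIV. (e y - e (y + axis j 1)) * (\<Sum>i\<in>UNIV. \<Sum>z\<in>corner l. G i (y - axis i 1 - z) * \<phi> z j * e (y - axis i 1 - z)))"
        by (subst sum_swap4) (simp add: sum_distrib_left mult_ac)
      also have "\<dots> = (\<Sum>y\<in>sites n. \<Sum>j\<in>UNIV. (e y - e (y + axis j 1)) * U e y j)"
      proof -
        have "U e y j = (\<Sum>i\<in>UNIV. \<Sum>z\<in>corner l. G i (y - axis i 1 - z) * \<phi> z j * e (y - axis i 1 - z))" for y j
          unfolding U_def Z_def using n0
          by (simp only: sum.cartesian_product') (simp add: c2_def p2_def sum_distrib_left)
        then show ?thesis by simp
      qed
      finally show ?thesis by simp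
    qed
    have gain: "K * (Q - \<tau>) \<le> (\<Sum>x\<in>sites n. e x * w2 e x)" unfolding w2_def Q_def \<tau>_def
      by (rule absorption_gain[OF finite_sites finI e1 row col r0 K0])
    have cost: "(\<Sum>x\<in>sites n. (w2 e x)\<^sup>2) \<le> 2 * K\<^sup>2 * r\<^sup>2 * (Q + \<tau>)" unfolding w2_def Q_def \<tau>_def
      by (rule absorption_cost[OF finite_sites finI e1 row col r0 K0])
    let ?UU = "(\<Sum>y\<in>sites n. \<Sum>j\<in>UNIV. (U e y j)\<^sup>2 / (real n)\<^sup>2)" and ?WW = "\<Sum>x\<in>sites n. (w1 e x)\<^sup>2"
    have QU: "0 \<le> ?UU" "0 \<le> ?WW" "0 \<le> \<tau>"
      by (auto simp: \<tau>_def intro!: sum_nonneg)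
    let ?lhs = "(\<Sum>x\<in>sites n. \<Sum>i\<in>UNIV. G i x * e x * e (x + axis i 1))
      + (\<Sum>x\<in>sites n. - e x * w e x + 2 / b * (w e x)\<^sup>2)
      + (\<Sum>y\<in>sites n. \<Sum>j\<in>UNIV. (e (y + axis j 1) - e y) * U e y j + (U e y j)\<^sup>2 / (real n)\<^sup>2)"
    \<comment> \<open>By \<open>transport\<close>, the terms e w1 and the gradient terms with
      \<open>U\<close> cancel; what is left is the damping and the squares.\<close>
    have "?lhs = - (\<Sum>x\<in>sites n. e x * w2 e x) + 2 / b * (\<Sum>x\<in>sites n. (w e x)\<^sup>2) + ?UU"
      unfolding transport w_def
      by (simp add: sum.distrib sum_subtractf sum_negf distrib_left left_diff_distrib sum_distrib_left sum_divide_distrib)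
    also have "\<dots> \<le> - (K * (Q - \<tau>)) + 2 / b * (2 * ?WW + 2 * (2 * K\<^sup>2 * r\<^sup>2 * (Q + \<tau>))) + ?UU"
    proof -
      have "(\<Sum>x\<in>sites n. (w e x)\<^sup>2) \<le> (\<Sum>x\<in>sites n. 2 * (w1 e x)\<^sup>2 + 2 * (w2 e x)\<^sup>2)"
      proof (rule sum_mono)
        fix x
        show "(w e x)\<^sup>2 \<le> 2 * (w1 e x)\<^sup>2 + 2 * (w2 e x)\<^sup>2"
          using zero_le_power2[of "w1 e x - w2 e x"] by (simp add: w_def power2_eq_square algebra_simps)
      qed
      also have "\<dots> \<le> 2 * ?WW + 2 * (2 * K\<^sup>2 * r\<^sup>2 * (Q + \<tau>))"
        using cost by (simp only: sum.distrib sum_distrib_left[symmetric])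
      finally show ?thesis using gain b by (intro add_mono mult_left_mono) auto
    qed
    also have "\<dots> = - (K * (Q - \<tau>)) + 4 / b * ?WW + ?UU + (8 / b * K\<^sup>2 * r\<^sup>2) * (Q + \<tau>)"
      using b by (simp add: field_simps)
    also have "\<dots> \<le> - (K * (Q - \<tau>)) + (4 / b + 1) * Q + 1 * (Q + \<tau>)"
    proof -
      have "4 / b * ?WW + ?UU \<le> (4 / b + 1) * Q"
      proof -
        have "0 \<le> 4 / b * ?UU" using QU(1) b by (intro mult_nonneg_nonneg) auto
        then show ?thesis unfolding Q using QU(2) by (simp add: algebra_simps)
      qed
      moreover have "(8 / b * K\<^sup>2 * r\<^sup>2) * (Q + \<tau>) \<le> 1 * (Q + \<tau>)"
        by (rule mult_right_mono[OF r4]) (use QU Q in linarith)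
      ultimately show ?thesis by linarith
    qed
    \<comment> \<open>\<open>K = 2 + 4 / b\<close> is exactly the sum of the coefficients of
      \<open>Q\<close>, so only the trace survives.\<close>
    also have "\<dots> = (K + 1) * \<tau>" using b by (simp add: K_def field_simps)
    also have "\<dots> \<le> (K + 1) * (20 * (d * \<kappa>)\<^sup>2 * (real n ^ CARD('d) / (real n)\<^sup>2) * g_scale CARD('d) n)"
      using K0 by (intro mult_left_mono \<tau>) auto
    finally show "?lhs
      \<le> spectral_const b CARD('d) \<kappa> n"
      by (simp add: d_def K_def spectral_const_def)
  qed
qed

section \<open>The quadratic form of the generator\<close>

lemma rho_star_props:
  assumes "a > 0" "b > 0"
  shows "0 < rho_star a b lam" "rho_star a b lam < 1"
    "(a + lam * rho_star a b lam) * (1 - rho_star a b lam) = b * rho_star a b lam"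
  using theI'[OF rho_star_ex1[OF assms, of lam]] by (auto simp: rho_star_def reaction_def)

text \<open>The defect of invariance has the coefficient \<lambda> / (2 d \<rho>), and
  \<open>rho_star\<close> depends on \<lambda>; a lower bound uniform in \<lambda> lets the critical
  value be fixed first. It follows from (a/2) (1 - \<rho>) \<le> (a + \<lambda> \<rho>) (1 - \<rho>)
  = b \<rho>.\<close>

lemma rho_star_lower:
  assumes "a > 0" "b > 0" "\<bar>lam\<bar> \<le> a / 2"
  shows "a / (a + 2 * b) \<le> rho_star a b lam"
proof -
  define \<rho> where "\<rho> = rho_star a b lam"
  have \<rho>: "0 < \<rho>" "\<rho> < 1" "(a + lam * \<rho>) * (1 - \<rho>) = b * \<rho>"
    using rho_star_props[OF assms(1,2), of lam] by (simp_all add: \<rho>_def)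
  have "\<bar>lam * \<rho>\<bar> \<le> a / 2 * 1" unfolding abs_mult using assms \<rho> by (intro mult_mono) auto
  then have "a / 2 * (1 - \<rho>) \<le> (a + lam * \<rho>) * (1 - \<rho>)" using \<rho> by (intro mult_right_mono) auto
  then show ?thesis using \<rho> assms unfolding \<rho>_def[symmetric] by (simp add: field_simps)
qed

lemma Omega_eq: "Omega n = (PiE_dflt (sites n) False (\<lambda>_. UNIV) :: ('d::finite) config set)"
  by (auto simp: Omega_def PiE_dflt_def)

lemma finite_Omega [simp]: "finite (Omega n :: ('d::finite) config set)"
  unfolding Omega_eq by (rule finite_PiE_dflt) auto

lemma pmf_bernoulli_config:
  assumes "\<eta> \<in> Omega n" "0 < \<rho>" "\<rho> < 1"
  shows "pmf (bernoulli_config n \<rho>) \<eta> = (\<Prod>x\<in>sites n. if \<eta> x then \<rho> else 1 - \<rho>)"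
  using assms unfolding bernoulli_config_def
  by (subst pmf_Pi') (auto simp: Omega_def intro!: prod.cong)

lemma pmf_bernoulli_config_pos:
  assumes "\<eta> \<in> Omega n" "0 < \<rho>" "\<rho> < 1"
  shows "pmf (bernoulli_config n \<rho>) \<eta> > 0"
  unfolding pmf_bernoulli_config[OF assms] using assms by (intro prod_pos) auto

lemma sum_pmf_bernoulli_config:
  "(\<Sum>\<eta>\<in>Omega n. pmf (bernoulli_config n \<rho> :: ('d::finite) config pmf) \<eta>) = 1"
proof (rule sum_pmf_eq_1)
  show "set_pmf (bernoulli_config n \<rho>) \<subseteq> (Omega n :: 'd config set)"
    using set_Pi_pmf_subset[OF finite_sites, of n False "\<lambda>_ :: int ^ 'd. bernoulli_pmf \<rho>"]
    by (simp add: bernoulli_config_def Omega_def)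
qed simp

lemma swap_in_Omega: "\<eta> \<in> Omega n \<Longrightarrow> x \<in> sites n \<Longrightarrow> y \<in> sites n \<Longrightarrow> swap \<eta> x y \<in> Omega n"
  by (auto simp: Omega_def swap_def)

lemma flip_in_Omega: "\<eta> \<in> Omega n \<Longrightarrow> x \<in> sites n \<Longrightarrow> flip \<eta> x \<in> Omega n"
  by (auto simp: Omega_def flip_def)

lemma swap_swap: "swap (swap \<eta> x y) x y = \<eta>"
  by (auto simp: swap_def)

lemma flip_flip: "flip (flip \<eta> x) x = \<eta>"
  by (auto simp: flip_def)

lemma pmf_swap:
  assumes "\<eta> \<in> Omega n" "x \<in> sites n" "y \<in> sites n" "0 < \<rho>" "\<rho> < 1"
  shows "pmf (bernoulli_config n \<rho>) (swap \<eta> x y) = pmf (bernoulli_config n \<rho>) \<eta>"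
proof -
  have "(\<Prod>z\<in>sites n. if swap \<eta> x y z then \<rho> else 1 - \<rho>) = (\<Prod>z\<in>sites n. if \<eta> z then \<rho> else 1 - \<rho>)"
    by (rule prod.reindex_bij_witness[of _ "Transposition.transpose x y" "Transposition.transpose x y"])
       (use assms in \<open>auto simp: swap_def Transposition.transpose_def\<close>)
  then show ?thesis using assms by (simp add: pmf_bernoulli_config swap_in_Omega)
qed

lemma pmf_flip:
  assumes "\<eta> \<in> Omega n" "x \<in> sites n" "0 < \<rho>" "\<rho> < 1"
  shows "pmf (bernoulli_config n \<rho>) (flip \<eta> x)
    = pmf (bernoulli_config n \<rho>) \<eta> * (if \<eta> x then (1 - \<rho>) / \<rho> else \<rho> / (1 - \<rho>))"
proof -
  have "(\<Prod>z\<in>sites n - {x}. if flip \<eta> x z then \<rho> else 1 - \<rho>) = (\<Prod>z\<in>sites n - {x}. if \<eta> z then \<rho> else 1 - \<rho>)"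
    by (intro prod.cong) (auto simp: flip_def)
  then show ?thesis using assms
    by (simp add: pmf_bernoulli_config flip_in_Omega prod.remove[OF finite_sites assms(2)]) (simp add: flip_def)
qed

section \<open>Transition forms with variable exponents\<close>

lemma mult_le_exp_weighted:
  fixes u v t :: real
  shows "u * v \<le> (u\<^sup>2 * exp t + v\<^sup>2 * exp (- t)) / 2"
proof -
  have e: "(exp (t/2))\<^sup>2 = exp t" "(exp (-t/2))\<^sup>2 = exp (-t)" "exp (t/2) * exp (-t/2) = 1"
    by (simp_all add: power2_eq_square flip: exp_add)
  have "0 \<le> (u * exp (t/2) - v * exp (- t/2))\<^sup>2" by simp
  also have "\<dots> = u\<^sup>2 * (exp (t/2))\<^sup>2 + v\<^sup>2 * (exp (-t/2))\<^sup>2 - 2 * (u * v * (exp (t/2) * exp (-t/2)))"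
    by (simp add: power2_eq_square algebra_simps)
  finally show ?thesis unfolding e by simp
qed

text \<open>The exponent \<open>\<alpha>\<close> is an arbitrary antisymmetric function of the transition.  It need not be the
  gradient of a function on the state space, and this is what makes room for the flows below.\<close>

lemma transition_form_le:
  fixes g c \<alpha> p :: "'s \<Rightarrow> real"
  assumes A: "finite A" and F: "\<And>\<eta>. \<eta> \<in> A \<Longrightarrow> F \<eta> \<in> A" "\<And>\<eta>. \<eta> \<in> A \<Longrightarrow> F (F \<eta>) = \<eta>"
    and p: "\<And>\<eta>. \<eta> \<in> A \<Longrightarrow> p \<eta> \<ge> 0" and c: "\<And>\<eta>. \<eta> \<in> A \<Longrightarrow> c \<eta> \<ge> 0"
    and c': "\<And>\<eta>. \<eta> \<in> A \<Longrightarrow> p (F \<eta>) * c (F \<eta>) = p \<eta> * c' \<eta>"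
    and \<alpha>: "\<And>\<eta>. \<eta> \<in> A \<Longrightarrow> \<alpha> (F \<eta>) = - \<alpha> \<eta>"
  shows "(\<Sum>\<eta>\<in>A. p \<eta> * (g \<eta> * (c \<eta> * (g (F \<eta>) - g \<eta>))))
       \<le> (\<Sum>\<eta>\<in>A. p \<eta> * (g \<eta>)\<^sup>2 * ((c \<eta> + c' \<eta>) / 2 * exp (\<alpha> \<eta>) - c \<eta>))"
proof -
  have "(\<Sum>\<eta>\<in>A. p \<eta> * (g \<eta> * (c \<eta> * (g (F \<eta>) - g \<eta>))))
      = (\<Sum>\<eta>\<in>A. p \<eta> * c \<eta> * (g \<eta> * g (F \<eta>)) - p \<eta> * (g \<eta>)\<^sup>2 * c \<eta>)"
    by (intro sum.cong) (auto simp: algebra_simps power2_eq_square)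
  also have "\<dots> \<le> (\<Sum>\<eta>\<in>A. p \<eta> * c \<eta> * (((g \<eta>)\<^sup>2 * exp (\<alpha> \<eta>) + (g (F \<eta>))\<^sup>2 * exp (- \<alpha> \<eta>)) / 2) - p \<eta> * (g \<eta>)\<^sup>2 * c \<eta>)"
    by (intro sum_mono diff_right_mono mult_left_mono mult_le_exp_weighted mult_nonneg_nonneg p c) auto
  also have "\<dots> = (\<Sum>\<eta>\<in>A. p \<eta> * (g \<eta>)\<^sup>2 * (c \<eta> / 2 * exp (\<alpha> \<eta>) - c \<eta>)) + (\<Sum>\<eta>\<in>A. p \<eta> * c \<eta> * (g (F \<eta>))\<^sup>2 * exp (- \<alpha> \<eta>)) / 2"
    by (simp add: sum_divide_distrib algebra_simps add_divide_distrib flip: sum.distrib)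
  \<comment> \<open>The substitution of \<open>F \<eta>\<close> for \<open>\<eta>\<close> turns the
    reversed transition into one out of \<open>\<eta>\<close>: \<open>c'\<close> is the rate of the
    adjoint with respect to \<open>p\<close>, and antisymmetry flips the sign of the exponent
    back.\<close>
  also have "(\<Sum>\<eta>\<in>A. p \<eta> * c \<eta> * (g (F \<eta>))\<^sup>2 * exp (- \<alpha> \<eta>)) = (\<Sum>\<eta>\<in>A. p \<eta> * c' \<eta> * (g \<eta>)\<^sup>2 * exp (\<alpha> \<eta>))"
  proof (rule sum.reindex_bij_witness[of _ F F])
    show "p (F \<eta>) * c' (F \<eta>) * (g (F \<eta>))\<^sup>2 * exp (\<alpha> (F \<eta>)) = p \<eta> * c \<eta> * (g (F \<eta>))\<^sup>2 * exp (- \<alpha> \<eta>)"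
      if "\<eta> \<in> A" for \<eta>
      using c'[OF F(1)[OF that]] F(2)[OF that] \<alpha>[OF that] by simp
  qed (use F in auto)
  also have "(\<Sum>\<eta>\<in>A. p \<eta> * (g \<eta>)\<^sup>2 * (c \<eta> / 2 * exp (\<alpha> \<eta>) - c \<eta>)) + (\<Sum>\<eta>\<in>A. p \<eta> * c' \<eta> * (g \<eta>)\<^sup>2 * exp (\<alpha> \<eta>)) / 2
      = (\<Sum>\<eta>\<in>A. p \<eta> * (g \<eta>)\<^sup>2 * ((c \<eta> + c' \<eta>) / 2 * exp (\<alpha> \<eta>) - c \<eta>))"
    by (simp add: sum_divide_distrib algebra_simps add_divide_distrib flip: sum.distrib)
  finally show ?thesis .
qed

section \<open>Neighbours on the torus and the flip rates\<close>

lemma adj_iff: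
  fixes x y :: "int ^ 'd::finite"
  assumes n: "n \<ge> 3" and x: "x \<in> sites n" and y: "y \<in> sites n"
  shows "adj n x y \<longleftrightarrow> (\<exists>j. y = red n (x + axis j 1) \<or> y = red n (x - axis j 1))"
proof
  define v where "v j = min ((x $ j - y $ j) mod int n) ((y $ j - x $ j) mod int n)" for j
  have nn: "0 \<le> v j" for j using n by (simp add: v_def)
  have y_eq: "y $ j = y $ j mod int n" for j using y by (auto simp: sites_def)
  have mod_eq: "y $ j = (x $ j + c) mod int n" if "(y $ j - x $ j) mod int n = c" for j c
    using y_eq[of j] that by (metis add.commute diff_add_cancel mod_add_left_eq)
  have v0: "y $ j = x $ j mod int n" if "v j = 0" for j
  proof -
    have "(y $ j - x $ j) mod int n = 0 \<or> (x $ j - y $ j) mod int n = 0" using that by (auto simp: v_def min_def split: if_splits)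
    then have "int n dvd y $ j - x $ j" by (metis dvd_eq_mod_eq_0 dvd_diff_commute)
    then show ?thesis using mod_eq[of j 0] by (simp add: dvd_eq_mod_eq_0)
  qed
  {
    assume "adj n x y"
    then have s: "(\<Sum>j\<in>UNIV. v j) = 1" by (simp add: adj_def v_def)
    then have "\<not> (\<forall>j\<in>UNIV. v j = 0)" using sum.neutral[of UNIV v] by fastforce
    then obtain j where j: "v j \<noteq> 0" by blast
    have "(\<Sum>j\<in>UNIV. v j) = v j + (\<Sum>i\<in>UNIV - {j}. v i)" by (rule sum.remove) auto
    moreover have "0 \<le> (\<Sum>i\<in>UNIV - {j}. v i)" by (intro sum_nonneg nn)
    ultimately have vj: "v j = 1" and rest: "(\<Sum>i\<in>UNIV - {j}. v i) = 0" using s j nn[of j] by linarith+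
    have vi: "v i = 0" if "i \<noteq> j" for i
      using rest that nn by (subst (asm) sum_nonneg_eq_0_iff) auto
    have "(y $ j - x $ j) mod int n = 1 \<or> (x $ j - y $ j) mod int n = 1" using vj by (auto simp: v_def min_def split: if_splits)
    then show "\<exists>j. y = red n (x + axis j 1) \<or> y = red n (x - axis j 1)"
    proof
      assume "(y $ j - x $ j) mod int n = 1"
      then have "y = red n (x + axis j 1)" using v0[OF vi] mod_eq[of j 1]
        by (auto simp: vec_eq_iff red_def axis_def)
      then show ?thesis by blast
    next
      assume "(x $ j - y $ j) mod int n = 1"
      then have "(x $ j - y $ j) mod int n = 1 mod int n" using n by simp
      then have "int n dvd - (x $ j - y $ j - 1)" by (simp only: mod_eq_dvd_iff dvd_minus_iff)
      also have "- (x $ j - y $ j - 1) = y $ j - (x $ j - 1)" by simp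
      finally have "int n dvd y $ j - (x $ j - 1)" .
      then have "y $ j mod int n = (x $ j - 1) mod int n" by (simp add: mod_eq_dvd_iff)
      then have "y = red n (x - axis j 1)" using v0[OF vi] y_eq
        by (auto simp: vec_eq_iff red_def axis_def)
      then show ?thesis by blast
    qed
  }
  {
    assume "\<exists>j. y = red n (x + axis j 1) \<or> y = red n (x - axis j 1)"
    then obtain j where j: "y = red n (x + axis j 1) \<or> y = red n (x - axis j 1)" by blast
    have m1: "(-1) mod int n = int n - 1" using n by (simp add: zmod_minus1)
    have "v i = of_bool (i = j)" for i
      using j n m1 by (cases "i = j") (auto simp: v_def red_def axis_def mod_diff_right_eq mod_diff_left_eq)
    then show "adj n x y" by (simp add: adj_def v_def[symmetric])
  }
qed

text \<open>From n = 3 on the 2d neighbours are distinct, since a coincidence would make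
  \<open>n\<close> divide 1 or 2.\<close>

lemma sum_adj:
  fixes x :: "int ^ 'd::finite" and f :: "int ^ 'd \<Rightarrow> real"
  assumes n: "n \<ge> 3" and x: "x \<in> sites n"
  shows "(\<Sum>y | y \<in> sites n \<and> adj n x y. f y) = (\<Sum>j\<in>UNIV. f (red n (x + axis j 1))) + (\<Sum>j\<in>UNIV. f (red n (x - axis j 1)))"
proof -
  have n0: "n > 0" using n by simp
  have small: "\<not> int n dvd 1" "\<not> int n dvd 2" using n zdvd_imp_le[of "int n" 1] zdvd_imp_le[of "int n" 2] by auto
  have eq: "{y. y \<in> sites n \<and> adj n x y} = (\<lambda>j. red n (x + axis j 1)) ` UNIV \<union> (\<lambda>j. red n (x - axis j 1)) ` UNIV"
    using adj_iff[OF n x] red_in_sites[OF n0] by auto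
  have inj1: "inj (\<lambda>j. red n (x + axis j 1))"
  proof (rule injI, rule ccontr)
    fix j j' :: 'd assume "red n (x + axis j 1) = red n (x + axis j' 1)" "j \<noteq> j'"
    then have "int n dvd (x + axis j 1) $ j - (x + axis j' 1) $ j" by (metis red_eq_iff)
    then show False using \<open>j \<noteq> j'\<close> small by (simp add: axis_def)
  qed
  have inj2: "inj (\<lambda>j. red n (x - axis j 1))"
  proof (rule injI, rule ccontr)
    fix j j' :: 'd assume "red n (x - axis j 1) = red n (x - axis j' 1)" "j \<noteq> j'"
    then have "int n dvd (x - axis j' 1) $ j - (x - axis j 1) $ j" by (metis red_eq_iff)
    then show False using \<open>j \<noteq> j'\<close> small by (simp add: axis_def)
  qed
  have disj: "(\<lambda>j. red n (x + axis j 1)) ` UNIV \<inter> (\<lambda>j. red n (x - axis j 1)) ` UNIV = {}"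
  proof (rule ccontr)
    assume "(\<lambda>j. red n (x + axis j 1)) ` UNIV \<inter> (\<lambda>j. red n (x - axis j 1)) ` UNIV \<noteq> {}"
    then obtain j j' :: 'd where "red n (x + axis j 1) = red n (x - axis j' 1)" by auto
    then have "int n dvd (x + axis j 1) $ j - (x - axis j' 1) $ j" by (metis red_eq_iff)
    then show False using small by (simp add: axis_def split: if_splits)
  qed
  show ?thesis unfolding eq
    by (subst sum.union_disjoint[OF _ _ disj]) (simp_all only: finite_imageI finite sum.reindex[OF inj1] sum.reindex[OF inj2] o_def)
qed

text \<open>The centred occupation variables, extended periodically from \<open>sites n\<close> to \<open>\<int>\<^sup>d\<close>.\<close>

definition fld :: "nat \<Rightarrow> real \<Rightarrow> ('d::finite) config \<Rightarrow> int ^ 'd \<Rightarrow> real" where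
  "fld n \<rho> \<eta> x = of_bool (\<eta> (red n x)) - \<rho>"

lemma fld_red: "fld n \<rho> \<eta> (red n x) = fld n \<rho> \<eta> x"
  by (simp add: fld_def red_red)

lemma abs_fld_le: "0 < \<rho> \<Longrightarrow> \<rho> < 1 \<Longrightarrow> \<bar>fld n \<rho> \<eta> x\<bar> \<le> 1"
  by (auto simp: fld_def of_bool_def)

lemma fld_site: "x \<in> sites n \<Longrightarrow> fld n \<rho> \<eta> x = of_bool (\<eta> x) - \<rho>"
  by (simp add: fld_def red_site)

lemma red_add_axis_neq:
  assumes n: "n \<ge> 3" and x: "x \<in> sites n"
  shows "red n (x + axis j 1) \<noteq> x" "red n (x - axis j 1) \<noteq> x"
proof -
  have small: "\<not> int n dvd 1" using n zdvd_imp_le[of "int n" 1] by auto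
  show "red n (x + axis j 1) \<noteq> x"
  proof
    assume "red n (x + axis j 1) = x"
    then have "red n (x + axis j 1) = red n x" using x by (simp add: red_site)
    then have "int n dvd (x + axis j 1) $ j - x $ j" by (metis red_eq_iff)
    then show False using small by (simp add: axis_def)
  qed
  show "red n (x - axis j 1) \<noteq> x"
  proof
    assume "red n (x - axis j 1) = x"
    then have "red n x = red n (x - axis j 1)" using x by (simp add: red_site)
    then have "int n dvd x $ j - (x - axis j 1) $ j" by (metis red_eq_iff)
    then show False using small by (simp add: axis_def)
  qed
qed

text \<open>The fluctuation of the flip rate of an empty site around its mean-field value a +
  \<lambda> \<rho>.\<close>

definition nbr :: "real \<Rightarrow> nat \<Rightarrow> real \<Rightarrow> ('d::finite) config \<Rightarrow> int ^ 'd \<Rightarrow> real" where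
  "nbr lam n \<rho> \<eta> x = lam / (2 * real CARD('d))
     * ((\<Sum>j\<in>UNIV. fld n \<rho> \<eta> (x + axis j 1)) + (\<Sum>j\<in>UNIV. fld n \<rho> \<eta> (x - axis j 1)))"

lemma rate_eq:
  fixes \<eta> :: "('d::finite) config"
  assumes n: "n \<ge> 3" and x: "x \<in> sites n"
  shows "rate a b lam n x \<eta> = (a + lam * \<rho> + nbr lam n \<rho> \<eta> x) * (1 - of_bool (\<eta> x)) + b * of_bool (\<eta> x)"
proof -
  have "(\<Sum>y | y \<in> sites n \<and> adj n x y. of_bool (\<eta> y) :: real)
    = (\<Sum>j\<in>UNIV. fld n \<rho> \<eta> (x + axis j 1) + \<rho>) + (\<Sum>j\<in>UNIV. fld n \<rho> \<eta> (x - axis j 1) + \<rho>)"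
    unfolding sum_adj[OF n x] by (simp add: fld_def)
  also have "\<dots> = (\<Sum>j\<in>UNIV. fld n \<rho> \<eta> (x + axis j 1)) + (\<Sum>j\<in>UNIV. fld n \<rho> \<eta> (x - axis j 1)) + 2 * real CARD('d) * \<rho>"
    by (simp add: sum.distrib)
  finally have "lam / (2 * real CARD('d)) * (\<Sum>y | y \<in> sites n \<and> adj n x y. of_bool (\<eta> y) :: real) = lam * \<rho> + nbr lam n \<rho> \<eta> x"
    by (simp add: nbr_def field_simps)
  then show ?thesis by (simp add: rate_def add.assoc)
qed

lemma abs_nbr_le:
  fixes \<eta> :: "('d::finite) config"
  assumes "0 < \<rho>" "\<rho> < 1"
  shows "\<bar>nbr lam n \<rho> \<eta> x\<bar> \<le> \<bar>lam\<bar>"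
proof -
  have b: "\<bar>\<Sum>j\<in>UNIV. fld n \<rho> \<eta> (f j)\<bar> \<le> real CARD('d)" for f :: "'d \<Rightarrow> int ^ 'd"
  proof -
    have "\<bar>\<Sum>j\<in>UNIV. fld n \<rho> \<eta> (f j)\<bar> \<le> (\<Sum>j\<in>(UNIV :: 'd set). 1)"
      by (rule order_trans[OF sum_abs sum_mono]) (rule abs_fld_le[OF assms])
    then show ?thesis by simp
  qed
  have "\<bar>(\<Sum>j\<in>UNIV. fld n \<rho> \<eta> (x + axis j 1)) + (\<Sum>j\<in>UNIV. fld n \<rho> \<eta> (x - axis j 1))\<bar> \<le> 2 * real CARD('d)"
    using b[of "\<lambda>j. x + axis j 1"] b[of "\<lambda>j. x - axis j 1"] by linarith
  then have "\<bar>nbr lam n \<rho> \<eta> x\<bar> \<le> \<bar>lam\<bar> / (2 * real CARD('d)) * (2 * real CARD('d))"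
    unfolding nbr_def abs_mult abs_divide by (intro mult_mono) auto
  then show ?thesis by simp
qed

text \<open>Every edge is seen from both of its ends, and a translation by -e_j identifies the two
  sums; this turns 1 / (2d) into 1 / d.\<close>

lemma sum_nbr:
  fixes \<eta> :: "('d::finite) config"
  assumes n: "n > 0"
  shows "(\<Sum>x\<in>sites n. nbr lam n \<rho> \<eta> x * fld n \<rho> \<eta> x)
       = lam / real CARD('d) * (\<Sum>x\<in>sites n. \<Sum>j\<in>UNIV. fld n \<rho> \<eta> x * fld n \<rho> \<eta> (x + axis j 1))"
proof -
  let ?e = "fld n \<rho> \<eta>"
  have ered: "?e (red n x + c) = ?e (x + c)" for x c
    by (metis fld_red red_add_left)
  have "(\<Sum>x\<in>sites n. ?e x * ?e (x - axis j 1)) = (\<Sum>x\<in>sites n. ?e x * ?e (x + axis j 1))" for j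
  proof -
    have "(\<Sum>x\<in>sites n. ?e (x - axis j 1 + axis j 1) * ?e (x - axis j 1)) = (\<Sum>x\<in>sites n. ?e (x + axis j 1) * ?e x)"
      using sum_sites_translate[where F = "\<lambda>x. ?e (x + axis j 1) * ?e x" and c = "- axis j 1", OF n]
      by (simp add: ered fld_red)
    then show ?thesis by (simp add: mult.commute)
  qed
  then have "(\<Sum>x\<in>sites n. \<Sum>j\<in>UNIV. ?e x * ?e (x - axis j 1)) = (\<Sum>x\<in>sites n. \<Sum>j\<in>UNIV. ?e x * ?e (x + axis j 1))"
    by (subst (1 2) sum.swap) simp
  moreover have "(\<Sum>x\<in>sites n. nbr lam n \<rho> \<eta> x * ?e x)
      = lam / (2 * real CARD('d)) * ((\<Sum>x\<in>sites n. \<Sum>j\<in>UNIV. ?e x * ?e (x + axis j 1)) + (\<Sum>x\<in>sites n. \<Sum>j\<in>UNIV. ?e x * ?e (x - axis j 1)))"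
    unfolding nbr_def by (simp add: sum_distrib_left sum.distrib algebra_simps)
  ultimately show ?thesis by simp
qed

text \<open>\<open>\<beta> + s / (2 * \<rho>)\<close> is the quotient of the flip rate, symmetrised with respect to the Bernoulli
  measure, by the rate of independent reversible flips.\<close>

lemma flip_integrand_le:
  fixes \<rho> \<beta> s w b e :: real and v :: bool
  assumes \<rho>: "0 < \<rho>" "\<rho> < 1" and b: "b > 0"
    and \<theta>: "\<beta> + s / (2 * \<rho>) \<ge> b / 2" and w: "\<bar>w\<bar> \<le> b / 2"
  defines "\<theta> \<equiv> \<beta> + s / (2 * \<rho>)"
  shows "(if v then 1 - \<rho> else \<rho>) * \<theta> * exp ((1 - 2 * of_bool v) * w / \<theta>)
       - (if v then \<beta> * (1 - \<rho>) else \<beta> * \<rho> + s)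
     \<le> - (of_bool v - \<rho>) * w + 2 / b * w\<^sup>2 + s * (of_bool v - \<rho>) / (2 * \<rho>)"
proof -
  have \<theta>0: "\<theta> > 0" and \<theta>b: "b / 2 \<le> \<theta>" using \<theta> b by (auto simp: \<theta>_def)
  define t where "t = (1 - 2 * of_bool v) * w / \<theta>"
  have t: "\<bar>t\<bar> \<le> 1"
  proof -
    have "\<bar>t\<bar> = \<bar>w\<bar> / \<theta>" using \<theta>0 by (cases v) (auto simp: t_def abs_divide)
    also have "\<dots> \<le> 1" using w \<theta>b \<theta>0 by (simp add: divide_le_eq)
    finally show ?thesis .
  qed
  have et: "exp t \<le> 1 + t + t\<^sup>2" using exp_le_quadratic[of t] t by linarith
  have tt: "\<theta> * (1 + t + t\<^sup>2) = \<theta> + (1 - 2 * of_bool v) * w + w\<^sup>2 / \<theta>"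
    using \<theta>0 by (cases v) (simp_all add: t_def field_simps power2_eq_square)
  define p where "p = (if v then 1 - \<rho> else \<rho>)"
  have p: "0 \<le> p" "p \<le> 1" using \<rho> by (auto simp: p_def)
  have "p * \<theta> * exp t \<le> p * \<theta> * (1 + t + t\<^sup>2)" using p \<theta>0 et by (intro mult_left_mono) auto
  also have "\<dots> = p * (\<theta> + (1 - 2 * of_bool v) * w) + p * (w\<^sup>2 / \<theta>)" by (simp only: mult.assoc tt) (simp add: algebra_simps)
  also have "p * (w\<^sup>2 / \<theta>) \<le> 1 * (2 / b * w\<^sup>2)"
  proof (intro mult_mono p)
    have "w\<^sup>2 / \<theta> \<le> w\<^sup>2 / (b / 2)" using \<theta>b b by (intro divide_left_mono) auto
    then show "w\<^sup>2 / \<theta> \<le> 2 / b * w\<^sup>2" by (simp add: field_simps)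
  qed (use \<theta>0 in auto)
  finally have "p * \<theta> * exp t \<le> p * (\<theta> + (1 - 2 * of_bool v) * w) + 2 / b * w\<^sup>2" by simp
  \<comment> \<open>The first-order term in \<open>w\<close> is the drift -e w. The symmetrised rate
    minus the actual rate is the defect s e / (2 \<rho>), with the same form for both values of
    \<open>v\<close>.\<close>
  moreover have "p * (\<theta> + (1 - 2 * of_bool v) * w) - (if v then \<beta> * (1 - \<rho>) else \<beta> * \<rho> + s)
     = - (of_bool v - \<rho>) * w + s * (of_bool v - \<rho>) / (2 * \<rho>)"
    using \<rho> by (cases v) (simp_all add: p_def \<theta>_def field_simps)
  ultimately show ?thesis unfolding t_def p_def by linarith
qed

text \<open>Summing \<open>transition_form_le\<close> over all exchanges and flips bounds the form
  of the generator by that of a multiplication operator \<open>\<Psi>\<close>. The defect of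
  invariance adds the constant \<open>c\<close> to all coefficients, so
  \<open>transport_fields\<close> is applied to \<open>G + c\<close>, and its pointwise bound is the
  one on \<open>\<Psi> + V\<close>.\<close>

lemma dirichlet_form_bound:
  fixes G :: "'d::finite \<Rightarrow> int ^ 'd \<Rightarrow> real" and g :: "'d config \<Rightarrow> real"
  assumes ab: "a > 0" "b > 0" and lam: "\<bar>lam\<bar> \<le> a / 2" and n: "n \<ge> 3"
  defines "\<rho> \<equiv> rho_star a b lam"
  defines "c \<equiv> lam / (2 * \<rho> * real CARD('d))"
  assumes G_per: "\<And>i x. G i (red n x) = G i x"
    and G_bound: "\<And>i x. \<bar>G i x + c\<bar> \<le> \<kappa>"
    and small: "small_coupling b CARD('d) \<kappa>"
  shows "(\<Sum>\<eta>\<in>Omega n. pmf (bernoulli_config n \<rho>) \<eta> *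
       (g \<eta> * (gen a b lam n g \<eta> + (\<Sum>x\<in>sites n. \<Sum>i\<in>UNIV. G i x * fld n \<rho> \<eta> x * fld n \<rho> \<eta> (x + axis i 1)) * g \<eta>)))
     \<le> spectral_const b CARD('d) \<kappa> n
        * (\<Sum>\<eta>\<in>Omega n. pmf (bernoulli_config n \<rho>) \<eta> * (g \<eta>)\<^sup>2)"
proof -
  define \<Lambda> where "\<Lambda> = spectral_const b CARD('d) \<kappa> n"
  have n0: "n > 0" using n by simp
  have \<rho>: "0 < \<rho>" "\<rho> < 1" and F\<rho>: "(a + lam * \<rho>) * (1 - \<rho>) = b * \<rho>"
    using rho_star_props[OF ab, of lam] by (simp_all add: \<rho>_def)
  define p where "p = pmf (bernoulli_config n \<rho> :: 'd config pmf)"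
  have p0: "p \<eta> \<ge> 0" for \<eta> by (simp add: p_def)
  \<comment> \<open>By the equation for \<open>rho_star\<close> this is also (a + \<lambda> \<rho>)
    / \<rho>. The mean-field flip rates are thus \<beta> (1 - \<rho>) and \<beta> \<rho>, which are
    reversible for the Bernoulli measure.\<close>
  define \<beta> where "\<beta> = b / (1 - \<rho>)"
  have "\<beta> * \<rho> = b * \<rho> / (1 - \<rho>)" by (simp add: \<beta>_def)
  then have \<beta>: "\<beta> * (1 - \<rho>) = b" "\<beta> * \<rho> = a + lam * \<rho>" using \<rho> unfolding F\<rho>[symmetric] by (auto simp: \<beta>_def)
  have "b * (1 - \<rho>) \<le> b * 1" using ab \<rho> by (intro mult_left_mono) auto
  then have \<beta>b: "b \<le> \<beta>" using \<rho> by (simp add: \<beta>_def field_simps)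
  have lr: "\<bar>lam * \<rho>\<bar> \<le> a / 2 * 1" unfolding abs_mult using lam \<rho> ab by (intro mult_mono) auto
  then have \<beta>a: "a / 2 \<le> \<beta> * \<rho>" using \<beta>(2) by linarith
  have G_per': "G i (red n x) + c = G i x + c" for i x by (simp add: G_per)
  obtain w and U :: "(int ^ 'd \<Rightarrow> real) \<Rightarrow> int ^ 'd \<Rightarrow> 'd \<Rightarrow> real" where
    w_loc: "\<And>e e' x. x \<in> sites n \<Longrightarrow> (\<And>y. red n y \<noteq> x \<Longrightarrow> e y = e' y) \<Longrightarrow> w e x = w e' x" and
    U_loc: "\<And>e e' y j. y \<in> sites n \<Longrightarrow> (\<And>z. red n z \<noteq> y \<Longrightarrow> red n z \<noteq> red n (y + axis j 1) \<Longrightarrow> e z = e' z) \<Longrightarrow> U e y j = U e' y j" and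
    w_bound: "\<And>e x. (\<And>y. e (red n y) = e y) \<Longrightarrow> (\<And>y. \<bar>e y\<bar> \<le> 1) \<Longrightarrow> x \<in> sites n \<Longrightarrow> \<bar>w e x\<bar> \<le> b / 2" and
    U_bound: "\<And>e y j. (\<And>y. e (red n y) = e y) \<Longrightarrow> (\<And>y. \<bar>e y\<bar> \<le> 1) \<Longrightarrow> y \<in> sites n \<Longrightarrow> \<bar>U e y j\<bar> \<le> real n" and
    total: "\<And>e. (\<And>y. e (red n y) = e y) \<Longrightarrow> (\<And>y. \<bar>e y\<bar> \<le> 1) \<Longrightarrow>
      (\<Sum>x\<in>sites n. \<Sum>i\<in>UNIV. (G i x + c) * e x * e (x + axis i 1))
      + (\<Sum>x\<in>sites n. - e x * w e x + 2 / b * (w e x)\<^sup>2)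
      + (\<Sum>y\<in>sites n. \<Sum>j\<in>UNIV. (e (y + axis j 1) - e y) * U e y j + (U e y j)\<^sup>2 / (real n)\<^sup>2) \<le> \<Lambda>"
    by (fact transport_fields[where G = "\<lambda>i x. G i x + c", OF n G_per' G_bound ab(2) small, folded \<Lambda>_def])
  define e :: "'d config \<Rightarrow> int ^ 'd \<Rightarrow> real" where "e = fld n \<rho>"
  have e_per: "e \<eta> (red n y) = e \<eta> y" and e_le: "\<bar>e \<eta> y\<bar> \<le> 1" for \<eta> :: "'d config" and y
    by (simp_all add: e_def fld_red abs_fld_le \<rho>)

  define ex where "ex \<eta> x i = (e \<eta> (x + axis i 1) - e \<eta> x) * U (e \<eta>) x i + (U (e \<eta>) x i)\<^sup>2 / (real n)\<^sup>2"
    for \<eta> :: "'d config" and x i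
  define fl where "fl \<eta> x = - e \<eta> x * w (e \<eta>) x + 2 / b * (w (e \<eta>) x)\<^sup>2 + nbr lam n \<rho> \<eta> x * e \<eta> x / (2 * \<rho>)"
    for \<eta> :: "'d config" and x
  have exchange: "(\<Sum>\<eta>\<in>Omega n. p \<eta> * (g \<eta> * (g (swap \<eta> x (shift n i x)) - g \<eta>))) * (real n)\<^sup>2
      \<le> (\<Sum>\<eta>\<in>Omega n. p \<eta> * (g \<eta>)\<^sup>2 * ex \<eta> x i)"
    if x: "x \<in> sites n" for x i
  proof -
    define x' where "x' = shift n i x"
    have x': "x' = red n (x + axis i 1)" "x' \<in> sites n" by (simp_all add: x'_def shift_eq_red red_in_sites[OF n0])
    have neq: "x' \<noteq> x" using red_add_axis_neq(1)[OF n x] by (simp add: x'(1))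
    have ex: "e \<eta> (x + axis i 1) = of_bool (\<eta> x') - \<rho>" "e \<eta> x = of_bool (\<eta> x) - \<rho>" for \<eta>
      using x by (simp_all add: e_def fld_def x'(1) red_site)
    \<comment> \<open>\<open>U\<close> ignores the two exchanged sites and the difference of
      occupations changes sign, so the exponent is antisymmetric. Dividing by n^2 cancels the speed
      of the exchanges at first order and leaves U^2 / n^2 at second order.\<close>
    define \<alpha> where "\<alpha> \<eta> = (e \<eta> (x + axis i 1) - e \<eta> x) * U (e \<eta>) x i / (real n)\<^sup>2" for \<eta>
    have "\<alpha> (swap \<eta> x x') = - \<alpha> \<eta>" if "\<eta> \<in> Omega n" for \<eta>
    proof -
      have "U (e (swap \<eta> x x')) x i = U (e \<eta>) x i"
      proof (rule U_loc[OF x])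
        fix z assume "red n z \<noteq> x" "red n z \<noteq> red n (x + axis i 1)"
        then show "e (swap \<eta> x x') z = e \<eta> z" by (simp add: e_def fld_def swap_def x'(1))
      qed
      moreover have "swap \<eta> x x' x' = \<eta> x" "swap \<eta> x x' x = \<eta> x'" using neq by (auto simp: swap_def)
      ultimately show ?thesis by (simp add: \<alpha>_def ex algebra_simps diff_divide_distrib)
    qed
    then have "(\<Sum>\<eta>\<in>Omega n. p \<eta> * (g \<eta> * (1 * (g (swap \<eta> x x') - g \<eta>))))
       \<le> (\<Sum>\<eta>\<in>Omega n. p \<eta> * (g \<eta>)\<^sup>2 * ((1 + 1) / 2 * exp (\<alpha> \<eta>) - 1))"
      by (intro transition_form_le)
         (use x x' \<rho> in \<open>auto simp: swap_in_Omega swap_swap p_def pmf_swap\<close>)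
    then have "(\<Sum>\<eta>\<in>Omega n. p \<eta> * (g \<eta> * (g (swap \<eta> x x') - g \<eta>))) * (real n)\<^sup>2
       \<le> (\<Sum>\<eta>\<in>Omega n. p \<eta> * (g \<eta>)\<^sup>2 * (exp (\<alpha> \<eta>) - 1)) * (real n)\<^sup>2"
      by (intro mult_right_mono) auto
    also have "\<dots> = (\<Sum>\<eta>\<in>Omega n. p \<eta> * (g \<eta>)\<^sup>2 * ((exp (\<alpha> \<eta>) - 1) * (real n)\<^sup>2))"
      by (simp add: sum_distrib_right mult.assoc)
    also have "\<dots> \<le> (\<Sum>\<eta>\<in>Omega n. p \<eta> * (g \<eta>)\<^sup>2 * ex \<eta> x i)"
    proof (intro sum_mono mult_left_mono)
      fix \<eta> :: "'d config"
      define D where "D = e \<eta> (x + axis i 1) - e \<eta> x"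
      define u where "u = U (e \<eta>) x i"
      have D: "\<bar>D\<bar> \<le> 1" unfolding D_def ex by (simp add: of_bool_def)
      have D2: "D\<^sup>2 \<le> 1" using D by (simp add: abs_square_le_1)
      have u: "\<bar>u\<bar> \<le> real n" unfolding u_def by (rule U_bound[of "e \<eta>", OF e_per e_le x])
      have "\<bar>D * u\<bar> \<le> 1 * real n" unfolding abs_mult using D u by (intro mult_mono) auto
      also have "\<dots> \<le> (real n)\<^sup>2" using n by (simp add: power2_eq_square)
      finally have "\<bar>\<alpha> \<eta>\<bar> \<le> 1" unfolding \<alpha>_def D_def[symmetric] u_def[symmetric] using n by (simp add: abs_divide divide_le_eq)
      then have "exp (\<alpha> \<eta>) \<le> 1 + \<alpha> \<eta> + (\<alpha> \<eta>)\<^sup>2" by (intro exp_le_quadratic) linarith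
      then have "(exp (\<alpha> \<eta>) - 1) * (real n)\<^sup>2 \<le> (\<alpha> \<eta> + (\<alpha> \<eta>)\<^sup>2) * (real n)\<^sup>2" by (intro mult_right_mono) auto
      also have "\<dots> = D * u + D\<^sup>2 * (u\<^sup>2 / (real n)\<^sup>2)"
        unfolding \<alpha>_def D_def[symmetric] u_def[symmetric] using n by (simp add: field_simps power2_eq_square)
      also have "\<dots> \<le> D * u + 1 * (u\<^sup>2 / (real n)\<^sup>2)" using D2 by (intro add_left_mono mult_right_mono) auto
      finally show "(exp (\<alpha> \<eta>) - 1) * (real n)\<^sup>2 \<le> ex \<eta> x i"
        by (simp add: ex_def D_def u_def)
    qed (simp add: p0)
    finally show ?thesis by (simp add: x'_def)
  qed

  have flips: "(\<Sum>\<eta>\<in>Omega n. p \<eta> * (g \<eta> * (rate a b lam n x \<eta> * (g (flip \<eta> x) - g \<eta>))))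
      \<le> (\<Sum>\<eta>\<in>Omega n. p \<eta> * (g \<eta>)\<^sup>2 * fl \<eta> x)"
    if x: "x \<in> sites n" for x
  proof -
    define s where "s \<eta> = nbr lam n \<rho> \<eta> x" for \<eta> :: "'d config"
    define \<theta> where "\<theta> \<eta> = \<beta> + s \<eta> / (2 * \<rho>)" for \<eta>
    define cr where "cr \<eta> = rate a b lam n x \<eta>" for \<eta> :: "'d config"
    have sb: "\<bar>s \<eta>\<bar> \<le> a / 2" for \<eta> unfolding s_def using abs_nbr_le[OF \<rho>, of lam n \<eta> x] lam by linarith
    have cr: "cr \<eta> = (if \<eta> x then \<beta> * (1 - \<rho>) else \<beta> * \<rho> + s \<eta>)" for \<eta>
      unfolding cr_def rate_eq[OF n x, of a b lam \<eta> \<rho>] by (simp add: \<beta> s_def)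
    have cr0: "cr \<eta> \<ge> 0" for \<eta> unfolding cr using sb[of \<eta>] \<beta>a \<beta>(1) ab by auto
    have \<theta>b: "b / 2 \<le> \<beta> + s \<eta> / (2 * \<rho>)" for \<eta>
    proof -
      have "\<bar>s \<eta>\<bar> \<le> \<beta> * \<rho>" using sb[of \<eta>] \<beta>a by linarith
      then have "\<bar>s \<eta> / (2 * \<rho>)\<bar> \<le> \<beta> / 2" using \<rho> by (simp add: abs_divide field_simps)
      then show ?thesis using \<beta>b by linarith
    qed
    have e_flip: "e (flip \<eta> x) z = e \<eta> z" if "red n z \<noteq> x" for \<eta> z
      using that by (simp add: e_def fld_def flip_def)
    have s_flip: "s (flip \<eta> x) = s \<eta>" for \<eta>
      unfolding s_def nbr_def e_def[symmetric] by (simp add: e_flip red_add_axis_neq[OF n x])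
    have w_flip: "w (e (flip \<eta> x)) x = w (e \<eta>) x" for \<eta>
      by (rule w_loc[OF x]) (rule e_flip)
    have v_flip: "flip \<eta> x x = (\<not> \<eta> x)" for \<eta> by (simp add: flip_def)
    \<comment> \<open>The rate of the reversed flip. Neither \<open>s\<close> nor \<open>w\<close>
      sees the value at \<open>x\<close>, so the mean of \<open>cr\<close> and \<open>c'\<close> is
      \<open>\<theta>\<close> times 1 - \<rho> or \<rho>, and the exponent below is
      antisymmetric.\<close>
    define c' where "c' \<eta> = (if \<eta> x then (1 - \<rho>) / \<rho> else \<rho> / (1 - \<rho>)) * cr (flip \<eta> x)" for \<eta>
    define \<alpha> where "\<alpha> \<eta> = (1 - 2 * of_bool (\<eta> x)) * w (e \<eta>) x / \<theta> \<eta>" for \<eta>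
    have "(\<Sum>\<eta>\<in>Omega n. p \<eta> * (g \<eta> * (cr \<eta> * (g (flip \<eta> x) - g \<eta>))))
       \<le> (\<Sum>\<eta>\<in>Omega n. p \<eta> * (g \<eta>)\<^sup>2 * ((cr \<eta> + c' \<eta>) / 2 * exp (\<alpha> \<eta>) - cr \<eta>))"
    proof (rule transition_form_le)
      show "\<alpha> (flip \<eta> x) = - \<alpha> \<eta>" for \<eta>
        unfolding \<alpha>_def \<theta>_def w_flip s_flip v_flip by (cases "\<eta> x") auto
      show "p (flip \<eta> x) * cr (flip \<eta> x) = p \<eta> * c' \<eta>" if "\<eta> \<in> Omega n" for \<eta>
        unfolding p_def pmf_flip[OF that x \<rho>] c'_def by (simp only: mult.assoc)
    qed (use x p0 cr0 flip_in_Omega flip_flip in auto)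
    also have "\<dots> \<le> (\<Sum>\<eta>\<in>Omega n. p \<eta> * (g \<eta>)\<^sup>2 * fl \<eta> x)"
    proof (intro sum_mono mult_left_mono)
      fix \<eta> :: "'d config"
      have ev: "e \<eta> x = of_bool (\<eta> x) - \<rho>" using x by (simp add: e_def fld_site)
      have "(cr \<eta> + c' \<eta>) / 2 = (if \<eta> x then 1 - \<rho> else \<rho>) * \<theta> \<eta>"
        using \<rho> unfolding c'_def cr s_flip v_flip \<theta>_def by (cases "\<eta> x") (simp_all add: field_simps)
      then have "(cr \<eta> + c' \<eta>) / 2 * exp (\<alpha> \<eta>) - cr \<eta>
         = (if \<eta> x then 1 - \<rho> else \<rho>) * (\<beta> + s \<eta> / (2 * \<rho>)) * exp ((1 - 2 * of_bool (\<eta> x)) * w (e \<eta>) x / (\<beta> + s \<eta> / (2 * \<rho>)))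
         - (if \<eta> x then \<beta> * (1 - \<rho>) else \<beta> * \<rho> + s \<eta>)"
        unfolding \<alpha>_def \<theta>_def cr by simp
      also have "\<dots> \<le> - (of_bool (\<eta> x) - \<rho>) * w (e \<eta>) x + 2 / b * (w (e \<eta>) x)\<^sup>2 + s \<eta> * (of_bool (\<eta> x) - \<rho>) / (2 * \<rho>)"
        by (rule flip_integrand_le[OF \<rho> ab(2) \<theta>b w_bound[of "e \<eta>", OF e_per e_le x]])
      finally show "(cr \<eta> + c' \<eta>) / 2 * exp (\<alpha> \<eta>) - cr \<eta>
        \<le> fl \<eta> x"
        unfolding fl_def ev s_def .
    qed (simp add: p0)
    finally show ?thesis by (simp add: cr_def)
  qed

  define \<Psi> where "\<Psi> \<eta> = (\<Sum>x\<in>sites n. \<Sum>i\<in>UNIV. ex \<eta> x i)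
     + (\<Sum>x\<in>sites n. fl \<eta> x)" for \<eta> :: "'d config"
  define V where "V \<eta> = (\<Sum>x\<in>sites n. \<Sum>i\<in>UNIV. G i x * e \<eta> x * e \<eta> (x + axis i 1))" for \<eta> :: "'d config"
  have "(\<Sum>\<eta>\<in>Omega n. p \<eta> * (g \<eta> * gen a b lam n g \<eta>))
     = (\<Sum>\<eta>\<in>Omega n. \<Sum>x\<in>sites n. \<Sum>i\<in>UNIV. p \<eta> * (g \<eta> * (g (swap \<eta> x (shift n i x)) - g \<eta>)) * (real n)\<^sup>2)
       + (\<Sum>\<eta>\<in>Omega n. \<Sum>x\<in>sites n. p \<eta> * (g \<eta> * (rate a b lam n x \<eta> * (g (flip \<eta> x) - g \<eta>))))"
    unfolding gen_def Lex_def Lr_def by (simp add: sum_distrib_left algebra_simps flip: sum.distrib)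
  also have "\<dots> = (\<Sum>x\<in>sites n. \<Sum>i\<in>UNIV. (\<Sum>\<eta>\<in>Omega n. p \<eta> * (g \<eta> * (g (swap \<eta> x (shift n i x)) - g \<eta>))) * (real n)\<^sup>2)
       + (\<Sum>x\<in>sites n. \<Sum>\<eta>\<in>Omega n. p \<eta> * (g \<eta> * (rate a b lam n x \<eta> * (g (flip \<eta> x) - g \<eta>))))"
    by (simp only: sum.swap[of _ "sites n" "Omega n"] sum.swap[of _ "UNIV :: 'd set" "Omega n"] sum_distrib_right)
  also have "\<dots> \<le> (\<Sum>x\<in>sites n. \<Sum>i\<in>UNIV. \<Sum>\<eta>\<in>Omega n. p \<eta> * (g \<eta>)\<^sup>2 * ex \<eta> x i)
      + (\<Sum>x\<in>sites n. \<Sum>\<eta>\<in>Omega n. p \<eta> * (g \<eta>)\<^sup>2 * fl \<eta> x)"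
    by (intro add_mono sum_mono exchange flips)
  also have "\<dots> = (\<Sum>\<eta>\<in>Omega n. p \<eta> * (g \<eta>)\<^sup>2 * \<Psi> \<eta>)"
    by (simp only: sum.swap[of _ "Omega n" "sites n"] sum.swap[of _ "Omega n" "UNIV :: 'd set"] \<Psi>_def distrib_left sum.distrib sum_distrib_left)
  finally have form: "(\<Sum>\<eta>\<in>Omega n. p \<eta> * (g \<eta> * gen a b lam n g \<eta>)) \<le> (\<Sum>\<eta>\<in>Omega n. p \<eta> * (g \<eta>)\<^sup>2 * \<Psi> \<eta>)" .
  have \<Psi>V: "\<Psi> \<eta> + V \<eta> \<le> \<Lambda>" for \<eta>
  proof -
    have "(\<Sum>x\<in>sites n. nbr lam n \<rho> \<eta> x * e \<eta> x / (2 * \<rho>)) = c * (\<Sum>x\<in>sites n. \<Sum>j\<in>UNIV. e \<eta> x * e \<eta> (x + axis j 1))"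
      unfolding sum_divide_distrib[symmetric] e_def sum_nbr[OF n0] by (simp add: c_def)
    then have "\<Psi> \<eta> + V \<eta> = (\<Sum>x\<in>sites n. \<Sum>i\<in>UNIV. (G i x + c) * e \<eta> x * e \<eta> (x + axis i 1))
      + (\<Sum>x\<in>sites n. - e \<eta> x * w (e \<eta>) x + 2 / b * (w (e \<eta>) x)\<^sup>2)
      + (\<Sum>y\<in>sites n. \<Sum>j\<in>UNIV. (e \<eta> (y + axis j 1) - e \<eta> y) * U (e \<eta>) y j + (U (e \<eta>) y j)\<^sup>2 / (real n)\<^sup>2)"
      by (simp add: \<Psi>_def V_def ex_def fl_def sum.distrib distrib_right sum_distrib_left mult.assoc)
    then show ?thesis using total[of "e \<eta>", OF e_per e_le] by simp
  qed
  have "(\<Sum>\<eta>\<in>Omega n. p \<eta> * (g \<eta> * (gen a b lam n g \<eta> + V \<eta> * g \<eta>)))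
     = (\<Sum>\<eta>\<in>Omega n. p \<eta> * (g \<eta> * gen a b lam n g \<eta>)) + (\<Sum>\<eta>\<in>Omega n. p \<eta> * (g \<eta>)\<^sup>2 * V \<eta>)"
    by (simp add: power2_eq_square algebra_simps flip: sum.distrib)
  also have "\<dots> \<le> (\<Sum>\<eta>\<in>Omega n. p \<eta> * (g \<eta>)\<^sup>2 * (\<Psi> \<eta> + V \<eta>))"
    using form by (simp add: distrib_left sum.distrib)
  also have "\<dots> \<le> (\<Sum>\<eta>\<in>Omega n. p \<eta> * (g \<eta>)\<^sup>2 * \<Lambda>)"
    by (intro sum_mono mult_left_mono \<Psi>V) (simp add: p0)
  also have "\<dots> = \<Lambda> * (\<Sum>\<eta>\<in>Omega n. p \<eta> * (g \<eta>)\<^sup>2)" by (simp add: sum_distrib_left mult.commute)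
  finally show ?thesis unfolding \<Lambda>_def V_def e_def p_def .
qed

section \<open>Superexponential estimate\<close>

lemma finite_generator_gen:
  "\<exists>C. finite_generator (Omega n :: ('d::finite) config set) (gen a b lam n) C"
proof -
  define B where "B \<eta> = (real n)\<^sup>2 * (\<Sum>x\<in>(sites n :: (int ^ 'd) set). \<Sum>i\<in>(UNIV :: 'd set). 2) + (\<Sum>x\<in>sites n. \<bar>rate a b lam n x \<eta>\<bar> * 2)"
    for \<eta> :: "'d config"
  define C where "C = (\<Sum>\<eta>\<in>Omega n. B \<eta>)"
  have B0: "B \<eta> \<ge> 0" for \<eta> unfolding B_def by (intro add_nonneg_nonneg mult_nonneg_nonneg sum_nonneg) auto
  have "finite_generator (Omega n :: 'd config set) (gen a b lam n) C"
  proof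
    show "gen a b lam n (\<lambda>x. f x + c * g x) \<eta> = gen a b lam n f \<eta> + c * gen a b lam n g \<eta>" for f g :: "'d config \<Rightarrow> real" and c and \<eta> :: "'d config"
      unfolding gen_def Lex_def Lr_def
      by (simp add: sum_distrib_left algebra_simps sum.distrib sum_subtractf)
    show "C \<ge> 0" unfolding C_def by (intro sum_nonneg B0)
    fix f :: "'d config \<Rightarrow> real" and M :: real and \<eta> :: "'d config"
    assume f: "\<And>\<xi>. \<xi> \<in> Omega n \<Longrightarrow> \<bar>f \<xi>\<bar> \<le> M" and \<eta>: "\<eta> \<in> Omega n"
    have M: "M \<ge> 0" using f[OF \<eta>] by linarith
    have d: "\<bar>f \<xi> - f \<eta>\<bar> \<le> 2 * M" if "\<xi> \<in> Omega n" for \<xi> using f[OF that] f[OF \<eta>] by linarith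
    have sh: "shift n i x \<in> sites n" if "x \<in> sites n" for x :: "int ^ 'd" and i
    proof -
      have "n > 0" using that by (cases n) (auto simp: sites_def)
      then show ?thesis by (simp add: shift_eq_red red_in_sites)
    qed
    have "\<bar>Lex n f \<eta>\<bar> \<le> (\<Sum>x\<in>(sites n :: (int ^ 'd) set). \<Sum>i\<in>(UNIV :: 'd set). 2 * M)" unfolding Lex_def
    proof (rule order_trans[OF sum_abs sum_mono])
      fix x :: "int ^ 'd" assume x: "x \<in> sites n"
      show "\<bar>\<Sum>i\<in>UNIV. f (swap \<eta> x (shift n i x)) - f \<eta>\<bar> \<le> (\<Sum>i\<in>(UNIV :: 'd set). 2 * M)"
        by (rule order_trans[OF sum_abs sum_mono]) (intro d swap_in_Omega \<eta> sh x)
    qed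
    moreover have "\<bar>Lr a b lam n f \<eta>\<bar> \<le> (\<Sum>x\<in>sites n. \<bar>rate a b lam n x \<eta>\<bar> * (2 * M))" unfolding Lr_def
      by (rule order_trans[OF sum_abs sum_mono]) (auto simp: abs_mult intro!: mult_left_mono d flip_in_Omega \<eta>)
    ultimately have "\<bar>gen a b lam n f \<eta>\<bar> \<le> (real n)\<^sup>2 * (\<Sum>x\<in>(sites n :: (int ^ 'd) set). \<Sum>i\<in>(UNIV :: 'd set). 2 * M) + (\<Sum>x\<in>sites n. \<bar>rate a b lam n x \<eta>\<bar> * (2 * M))"
      unfolding gen_def by (intro order_trans[OF abs_triangle_ineq] add_mono) (auto simp: abs_mult intro!: mult_left_mono)
    also have "\<dots> = B \<eta> * M" by (simp add: B_def algebra_simps sum_distrib_left sum_distrib_right)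
    also have "\<dots> \<le> C * M" unfolding C_def
      by (intro mult_right_mono member_le_sum) (use \<eta> M B0 in auto)
    finally show "\<bar>gen a b lam n f \<eta>\<bar> \<le> C * M" .
  qed simp
  then show ?thesis by blast
qed

lemma path_integral_increment:
  fixes f :: "real \<Rightarrow> real"
  assumes int: "set_integrable lborel {0..T} f" and st: "0 \<le> s" "s \<le> t" "t \<le> T"
    and B: "\<And>r. 0 \<le> r \<Longrightarrow> r \<le> T \<Longrightarrow> \<bar>f r\<bar> \<le> B"
  shows "\<bar>(LBINT r:{0..t}. f r) - (LBINT r:{0..s}. f r)\<bar> \<le> B * (t - s)"
proof -
  let ?I = "\<lambda>t. LBINT r:{0..t}. f r"
  have i: "set_integrable lborel A f" if "A \<subseteq> {0..T}" "A \<in> sets borel" for A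
    using set_integrable_subset[OF int _ that(1)] that(2) by simp
  have "{0..t} = {0..s} \<union> {s<..t}" using st by auto
  then have "?I t = ?I s + (LBINT r:{s<..t}. f r)"
    using st by (simp only:) (intro set_integral_Un i, auto)
  then have "\<bar>?I t - ?I s\<bar> = \<bar>LBINT r:{s<..t}. f r\<bar>" by simp
  also have "\<dots> \<le> (LBINT r:{s<..t}. B)"
  proof -
    have i': "set_integrable lborel {s<..t} f" by (rule i) (use st in auto)
    have "\<bar>LBINT r:{s<..t}. f r\<bar> \<le> (LBINT r:{s<..t}. \<bar>f r\<bar>)"
      using set_integral_norm_bound[OF i'] by simp
    also have "\<dots> \<le> (LBINT r:{s<..t}. B)"
    proof (rule set_integral_mono)
      show "set_integrable lborel {s<..t} (\<lambda>r. \<bar>f r\<bar>)" by (rule set_integrable_abs[OF i'])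
      show "set_integrable lborel {s<..t} (\<lambda>r. B)" unfolding set_integrable_def real_scaleR_def
        by (intro integrable_mult_left integrable_real_indicator) (use st in \<open>auto simp: emeasure_lborel_Ioc\<close>)
    qed (use st B in auto)
    finally show ?thesis .
  qed
  also have "\<dots> = B * (t - s)" using st by (simp add: set_lebesgue_integral_def measure_def emeasure_lborel_Ioc)
  finally show ?thesis .
qed

text \<open>A time at which |Y| exceeds \<epsilon> is moved to the right end of its cell at a loss
  of at most \<epsilon>/2. The Lipschitz bound also makes the set of values bounded above, without
  which a real supremum would carry no information.\<close>

lemma sup_exceeds_imp_grid:
  fixes Y :: "real \<Rightarrow> real"
  assumes T: "T > 0" and Y0: "Y 0 = 0" and B: "B \<ge> 0"
    and lip: "\<And>s t. 0 \<le> s \<Longrightarrow> s \<le> t \<Longrightarrow> t \<le> T \<Longrightarrow> \<bar>Y t - Y s\<bar> \<le> B * (t - s)"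
    and m: "m \<ge> 1" "B * (T / real m) \<le> \<epsilon> / 2" and \<epsilon>: "\<epsilon> > 0"
    and sup: "(SUP t\<in>{0..T}. \<bar>Y t\<bar>) > \<epsilon>"
  shows "\<exists>k<m. \<bar>Y (real (Suc k) * (T / real m))\<bar> > \<epsilon> / 2"
proof -
  have bnd: "\<bar>Y t\<bar> \<le> B * T" if "0 \<le> t" "t \<le> T" for t
    using lip[of 0 t] Y0 that mult_left_mono[of t T B] B by simp
  have "bdd_above ((\<lambda>t. \<bar>Y t\<bar>) ` {0..T})" by (rule bdd_aboveI2[of _ _ "B * T"]) (use bnd in auto)
  then obtain t where t: "t \<in> {0..T}" "\<epsilon> < \<bar>Y t\<bar>"
    using sup less_cSUP_iff[of "{0..T}" "\<lambda>t. \<bar>Y t\<bar>" \<epsilon>] T by auto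
  then have "0 < t" using Y0 \<epsilon> by (cases "t = 0") auto
  define h where "h = T / real m"
  have h: "h > 0" "t \<le> real m * h" using T m t by (auto simp: h_def)
  obtain k where k: "k < m" "real k * h < t" "t \<le> real (Suc k) * h"
    using grid_cell[OF h(1) \<open>0 < t\<close> h(2)] by blast
  have "real (Suc k) * h \<le> real m * h" using k h by (intro mult_right_mono) auto
  then have kT: "real (Suc k) * h \<le> T" using m by (simp add: h_def)
  have "real (Suc k) * h - t \<le> h" using k by (simp add: algebra_simps)
  then have "B * (real (Suc k) * h - t) \<le> B * h" using B by (intro mult_left_mono)
  moreover have "\<bar>Y (real (Suc k) * h) - Y t\<bar> \<le> B * (real (Suc k) * h - t)"
    using t k kT by (intro lip) auto
  ultimately have "\<bar>Y (real (Suc k) * h)\<bar> > \<epsilon> / 2" using t(2) m(2) unfolding h_def by linarith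
  then show ?thesis using k(1) unfolding h_def by blast
qed

text \<open>Chernoff's bound with both signs of \<gamma> at each grid time, followed by a union
  bound over the \<open>m\<close> grid times. The potential uses up one half of \<kappa> and the
  defect of invariance the other.\<close>

lemma sup_tail_bound:
  fixes H :: "real \<Rightarrow> real ^ 'd::finite \<Rightarrow> real" and P :: "(real \<Rightarrow> 'd config) measure"
    and \<kappa> :: real
  assumes ab: "a > 0" "b > 0" and lam: "\<bar>lam\<bar> \<le> a / 2" and n: "n \<ge> 3" and T: "T > 0"
  defines "\<rho> \<equiv> rho_star a b lam"
  assumes small: "small_coupling b CARD('d) \<kappa>"
    and c: "\<bar>lam / (2 * \<rho> * real CARD('d))\<bar> \<le> \<kappa> / 2"
    and law: "markov_law (Omega n) (gen a b lam n) (bernoulli_config n \<rho>) T P"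
    and H_cont: "\<And>u. continuous_on {0..T} (\<lambda>s. H s u)"
    and H_bound: "\<And>s x. 0 \<le> s \<Longrightarrow> s \<le> T \<Longrightarrow> x \<in> sites n \<Longrightarrow> \<bar>H s (embed n x)\<bar> \<le> M"
    and M: "M \<ge> 0" and \<gamma>: "\<gamma> > 0" "\<gamma> * M \<le> \<kappa> / 2" and \<alpha>: "\<alpha> > 0" and \<epsilon>: "\<epsilon> > 0"
    and m: "m \<ge> 1" "real n ^ CARD('d) * M / \<alpha> * (T / real m) \<le> \<epsilon> / 2"
  defines "\<Lambda> \<equiv> spectral_const b CARD('d) \<kappa> n"
  shows "measure P {\<omega> \<in> space P. (SUP t\<in>{0..T}. \<bar>LBINT s:{0..t}. corr_field n \<alpha> \<rho> i (H s) (\<omega> s)\<bar>) > \<epsilon>}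
     \<le> real m * (2 * exp (\<Lambda> * T - \<gamma> * \<alpha> * \<epsilon> / 2))"
proof -
  obtain C where C: "finite_generator (Omega n :: 'd config set) (gen a b lam n) C"
    using finite_generator_gen by blast
  have \<rho>: "0 < \<rho>" "\<rho> < 1" using rho_star_props[OF ab, of lam] by (simp_all add: \<rho>_def)
  have n0: "n > 0" using n by simp
  have wg: "weighted_generator (Omega n) (gen a b lam n) C (bernoulli_config n \<rho> :: 'd config pmf)"
    by (rule weighted_generator.intro[OF C weighted_generator_axioms.intro[OF sum_pmf_bernoulli_config]])
       (rule pmf_bernoulli_config_pos[OF _ \<rho>])
  interpret fk: feynman_kac "Omega n :: 'd config set" "gen a b lam n" C "bernoulli_config n \<rho>" T P
    by (rule feynman_kac.intro[OF wg feynman_kac_axioms.intro[OF law T]])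
  have \<kappa>0: "\<kappa> \<ge> 0" using c abs_ge_zero[of "lam / (2 * \<rho> * real CARD('d))"] by linarith
  have Lam: "\<Lambda> \<ge> 0"
  proof -
    have "g_scale CARD('d) n \<ge> 0" using n by (simp add: g_scale_def)
    then show ?thesis using ab(2) unfolding \<Lambda>_def spectral_const_def by (intro mult_nonneg_nonneg add_nonneg_nonneg) auto
  qed
  define V where "V s \<eta> = (\<Sum>x\<in>sites n. (of_bool (\<eta> x) - \<rho>) * (of_bool (\<eta> (shift n i x)) - \<rho>) * H s (embed n x))"
    for s and \<eta> :: "'d config"
  have V_fld: "V s \<eta> = (\<Sum>x\<in>sites n. fld n \<rho> \<eta> x * fld n \<rho> \<eta> (x + axis i 1) * H s (embed n x))" for s \<eta>
    unfolding V_def by (intro sum.cong refl) (simp add: fld_site fld_def[of n \<rho> \<eta> "_ + _"] shift_eq_red)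
  have V_bound: "\<bar>V s \<eta>\<bar> \<le> real n ^ CARD('d) * M" if "0 \<le> s" "s \<le> T" for s \<eta>
  proof -
    have "\<bar>V s \<eta>\<bar> \<le> (\<Sum>x\<in>(sites n :: (int ^ 'd) set). 1 * 1 * M)" unfolding V_fld
      by (rule order_trans[OF sum_abs sum_mono], unfold abs_mult)
         (intro mult_mono abs_fld_le \<rho> H_bound that, auto)
    then show ?thesis by (simp add: card_sites)
  qed
  have V_cont: "continuous_on {0..T} (\<lambda>s. V s \<eta>)" for \<eta> unfolding V_def
    by (intro continuous_intros H_cont)
  have moment: "fk.expectation (\<lambda>\<omega>. exp (LBINT s:{0..t}. \<sigma> * V s (\<omega> s))) \<le> exp (\<Lambda> * t)
      \<and> integrable P (\<lambda>\<omega>. exp (LBINT s:{0..t}. \<sigma> * V s (\<omega> s)))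
      \<and> (\<lambda>\<omega>. LBINT s:{0..t}. \<sigma> * V s (\<omega> s)) \<in> borel_measurable P"
    if t: "0 < t" "t \<le> T" and \<sigma>: "\<bar>\<sigma>\<bar> = \<gamma>" for t \<sigma>
  proof -
    have W: "\<And>\<xi>. continuous_on {0..T} (\<lambda>s. \<sigma> * V s \<xi>)" by (intro continuous_intros V_cont)
    have Wb: "\<bar>\<sigma> * V s \<xi>\<bar> \<le> \<gamma> * (real n ^ CARD('d) * M)" if "0 \<le> s" "s \<le> T" for s \<xi>
      unfolding abs_mult \<sigma> using \<gamma> V_bound[OF that] by (intro mult_left_mono) auto
    have Wb0: "\<gamma> * (real n ^ CARD('d) * M) \<ge> 0" using \<gamma> M by simp
    have spec: "fk.spectral_le (\<lambda>\<xi>. \<sigma> * V s \<xi>) \<Lambda>" if s: "0 \<le> s" "s \<le> T" for s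
    proof -
      \<comment> \<open>Only direction \<open>i\<close> carries weight. Evaluation at
        \<open>red n x\<close> makes the coefficient periodic on all integer vectors.\<close>
      define G where "G j x = (if j = i then \<sigma> * H s (embed n (red n x)) else 0)" for j and x :: "int ^ 'd"
      have "\<bar>G j x\<bar> \<le> \<kappa> / 2" for j x
      proof -
        have "\<bar>\<sigma> * H s (embed n (red n x))\<bar> \<le> \<gamma> * M" unfolding abs_mult \<sigma>
          using \<gamma> H_bound[OF s red_in_sites[OF n0]] by (intro mult_left_mono) auto
        then show ?thesis using \<gamma>(2) \<kappa>0 by (auto simp: G_def)
      qed
      then have "\<bar>G j x\<bar> + \<bar>lam / (2 * \<rho> * real CARD('d))\<bar> \<le> \<kappa> / 2 + \<kappa> / 2" for j x
        using c by (intro add_mono)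
      then have Gb: "\<bar>G j x + lam / (2 * \<rho> * real CARD('d))\<bar> \<le> \<kappa>" for j x
        by (intro order_trans[OF abs_triangle_ineq]) (simp only: field_sum_of_halves)
      have eq: "\<sigma> * V s \<xi> = (\<Sum>x\<in>sites n. \<Sum>j\<in>UNIV. G j x * fld n \<rho> \<xi> x * fld n \<rho> \<xi> (x + axis j 1))" for \<xi>
      proof -
        have "(\<Sum>j\<in>UNIV. G j x * fld n \<rho> \<xi> x * fld n \<rho> \<xi> (x + axis j 1)) = \<sigma> * (fld n \<rho> \<xi> x * fld n \<rho> \<xi> (x + axis i 1) * H s (embed n x))"
          if "x \<in> sites n" for x
        proof -
          have "(\<Sum>j\<in>UNIV. G j x * fld n \<rho> \<xi> x * fld n \<rho> \<xi> (x + axis j 1)) =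
            (\<Sum>j\<in>UNIV. if j = i then \<sigma> * H s (embed n (red n x)) * fld n \<rho> \<xi> x * fld n \<rho> \<xi> (x + axis j 1) else 0)"
            by (intro sum.cong) (auto simp: G_def)
          then show ?thesis using that by (simp add: red_site)
        qed
        then show ?thesis by (simp add: V_fld sum_distrib_left)
      qed
      show ?thesis unfolding fk.spectral_le_def unfolding eq \<Lambda>_def \<rho>_def
        by (rule allI, rule dirichlet_form_bound[OF ab lam n _ Gb[unfolded \<rho>_def] small])
           (simp add: G_def red_red)
    qed
    show ?thesis
      using fk.exponential_moment_bound[where W = "\<lambda>s \<eta>. \<sigma> * V s \<eta>", OF W Wb Wb0 Lam spec t]
        fk.path_functional_measurable[where W = "\<lambda>s \<eta>. \<sigma> * V s \<eta>", OF W Wb Wb0 Lam spec t] by blast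
  qed
  define X where "X t \<omega> = (LBINT s:{0..t}. V s (\<omega> s))" for t and \<omega> :: "real \<Rightarrow> 'd config"
  have X\<sigma>: "(LBINT s:{0..t}. \<sigma> * V s (\<omega> s)) = \<sigma> * X t \<omega>" for t \<sigma> and \<omega> :: "real \<Rightarrow> 'd config"
    by (simp add: X_def)
  have Xm: "X t \<in> borel_measurable P" if t: "0 < t" "t \<le> T" for t
  proof -
    have "(\<lambda>\<omega>. \<gamma> * X t \<omega>) \<in> borel_measurable P" using moment[OF t, of \<gamma>] \<gamma> unfolding X\<sigma> by simp
    then have "(\<lambda>\<omega>. 1 / \<gamma> * (\<gamma> * X t \<omega>)) \<in> borel_measurable P" by (rule borel_measurable_times[OF borel_measurable_const])
    moreover have "(\<lambda>\<omega>. 1 / \<gamma> * (\<gamma> * X t \<omega>)) = X t" using \<gamma>(1) by (simp add: fun_eq_iff)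
    ultimately show ?thesis by metis
  qed
  have tail1: "fk.prob {\<omega> \<in> space P. \<sigma> * X t \<omega> \<ge> \<gamma> * y} \<le> exp (\<Lambda> * T - \<gamma> * y)"
    if t: "0 < t" "t \<le> T" and \<sigma>: "\<bar>\<sigma>\<bar> = \<gamma>" for t \<sigma> y
  proof -
    have mo: "fk.expectation (\<lambda>\<omega>. exp (\<sigma> * X t \<omega>)) \<le> exp (\<Lambda> * t)" "integrable P (\<lambda>\<omega>. exp (\<sigma> * X t \<omega>))"
      using moment[OF t \<sigma>] unfolding X\<sigma> by auto
    have "fk.prob {\<omega> \<in> space P. exp (\<sigma> * X t \<omega>) \<ge> exp (\<gamma> * y)} \<le> fk.expectation (\<lambda>\<omega>. exp (\<sigma> * X t \<omega>)) / exp (\<gamma> * y)"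
      by (rule integral_Markov_inequality_measure[OF mo(2), where A = "space P"]) auto
    also have "\<dots> \<le> exp (\<Lambda> * T) / exp (\<gamma> * y)"
    proof (rule divide_right_mono)
      have "exp (\<Lambda> * t) \<le> exp (\<Lambda> * T)" using t Lam by (simp add: mult_left_mono)
      then show "fk.expectation (\<lambda>\<omega>. exp (\<sigma> * X t \<omega>)) \<le> exp (\<Lambda> * T)" using mo(1) by linarith
    qed simp
    finally show ?thesis by (simp add: exp_diff)
  qed
  have tail: "fk.prob {\<omega> \<in> space P. \<bar>X t \<omega>\<bar> > y} \<le> 2 * exp (\<Lambda> * T - \<gamma> * y)"
    if t: "0 < t" "t \<le> T" for t y
  proof -
    let ?E = "\<lambda>\<sigma>. {\<omega> \<in> space P. \<sigma> * X t \<omega> \<ge> \<gamma> * y}"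
    have m1: "?E \<sigma> \<in> sets P" for \<sigma> using Xm[OF t] by measurable
    have "fk.prob {\<omega> \<in> space P. \<bar>X t \<omega>\<bar> > y}
        \<le> fk.prob (?E \<gamma> \<union> ?E (- \<gamma>))"
    proof (rule fk.finite_measure_mono)
      show "{\<omega> \<in> space P. \<bar>X t \<omega>\<bar> > y} \<subseteq> ?E \<gamma> \<union> ?E (- \<gamma>)"
      proof
        fix \<omega> assume w: "\<omega> \<in> {\<omega> \<in> space P. \<bar>X t \<omega>\<bar> > y}"
        then have "y \<le> X t \<omega> \<or> y \<le> - X t \<omega>" by auto
        then have "\<gamma> * y \<le> \<gamma> * X t \<omega> \<or> \<gamma> * y \<le> \<gamma> * (- X t \<omega>)" using mult_left_mono[of y "X t \<omega>" \<gamma>] mult_left_mono[of y "- X t \<omega>" \<gamma>] less_imp_le[OF \<gamma>(1)] by blast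
        then show "\<omega> \<in> ?E \<gamma> \<union> ?E (- \<gamma>)"
          using w by auto
      qed
    qed (intro sets.Un m1)
    also have "\<dots> \<le> fk.prob (?E \<gamma>) + fk.prob (?E (- \<gamma>))"
      by (intro measure_Un_le m1)
    also have "\<dots> \<le> exp (\<Lambda> * T - \<gamma> * y) + exp (\<Lambda> * T - \<gamma> * y)"
      using \<gamma>(1) by (intro add_mono tail1 t) auto
    finally show ?thesis by simp
  qed
  define Y where "Y t \<omega> = (LBINT s:{0..t}. corr_field n \<alpha> \<rho> i (H s) (\<omega> s))" for t and \<omega> :: "real \<Rightarrow> 'd config"
  have YX: "Y t \<omega> = X t \<omega> / \<alpha>" for t \<omega>
  proof -
    have "Y t \<omega> = (LBINT s:{0..t}. 1 / \<alpha> * V s (\<omega> s))" by (simp add: Y_def corr_field_def V_def)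
    then show ?thesis by (simp add: X_def)
  qed
  define B where "B = real n ^ CARD('d) * M / \<alpha>"
  define h where "h = T / real m"
  have h: "0 < real (Suc k) * h" "real (Suc k) * h \<le> T" if "k < m" for k
  proof -
    show "0 < real (Suc k) * h" using T m by (simp add: h_def)
    have "real (Suc k) * h \<le> real m * h" using that T by (intro mult_right_mono) (auto simp: h_def)
    then show "real (Suc k) * h \<le> T" using m by (simp add: h_def)
  qed
  have sub: "{\<omega> \<in> space P. (SUP t\<in>{0..T}. \<bar>Y t \<omega>\<bar>) > \<epsilon>}
     \<subseteq> (\<Union>k<m. {\<omega> \<in> space P. \<bar>X (real (Suc k) * h) \<omega>\<bar> > \<alpha> * \<epsilon> / 2})"
  proof safe
    fix \<omega> assume w: "\<omega> \<in> space P" and sup: "(SUP t\<in>{0..T}. \<bar>Y t \<omega>\<bar>) > \<epsilon>"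
    have int: "set_integrable lborel {0..T} (\<lambda>s. V s (\<omega> s))"
      by (rule path_functional_integrable[where S = "Omega n" and T = T]) (use w fk.space_P T V_cont V_bound in auto)
    have "\<exists>k<m. \<bar>Y (real (Suc k) * (T / real m)) \<omega>\<bar> > \<epsilon> / 2"
    proof (rule sup_exceeds_imp_grid[OF T _ _ _ m(1) _ \<epsilon> sup])
      have "(LBINT s:{0..0}. V s (\<omega> s)) = 0"
        unfolding set_lebesgue_integral_def
      proof (rule integral_eq_zero_AE)
        show "AE s in lborel. indicator {0..0} s *\<^sub>R V s (\<omega> s) = 0"
          using AE_lborel_singleton[of 0] by eventually_elim auto
      qed
      then show "Y 0 \<omega> = 0" unfolding YX X_def by simp
      show "0 \<le> B" using M \<alpha> by (simp add: B_def)
      show "B * (T / real m) \<le> \<epsilon> / 2" using m(2) by (simp add: B_def)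
      show "\<bar>Y t \<omega> - Y s \<omega>\<bar> \<le> B * (t - s)" if "0 \<le> s" "s \<le> t" "t \<le> T" for s t
      proof -
        have "\<bar>X t \<omega> - X s \<omega>\<bar> \<le> real n ^ CARD('d) * M * (t - s)" unfolding X_def
          by (rule path_integral_increment[OF int that]) (rule V_bound)
        then have "\<bar>X t \<omega> - X s \<omega>\<bar> / \<alpha> \<le> real n ^ CARD('d) * M * (t - s) / \<alpha>" using \<alpha> by (intro divide_right_mono) auto
        then show ?thesis using \<alpha> by (simp add: YX B_def abs_divide flip: diff_divide_distrib)
      qed
    qed
    then obtain k where k: "k < m" "\<bar>Y (real (Suc k) * h) \<omega>\<bar> > \<epsilon> / 2" unfolding h_def by blast
    then have "\<bar>X (real (Suc k) * h) \<omega>\<bar> > \<alpha> * \<epsilon> / 2" using \<alpha> by (simp add: YX abs_divide field_simps)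
    then show "\<omega> \<in> (\<Union>k<m. {\<omega> \<in> space P. \<bar>X (real (Suc k) * h) \<omega>\<bar> > \<alpha> * \<epsilon> / 2})" using k(1) w by blast
  qed
  have ev: "{\<omega> \<in> space P. \<bar>X (real (Suc k) * h) \<omega>\<bar> > \<alpha> * \<epsilon> / 2} \<in> sets P" if "k < m" for k
    using Xm[OF h[OF that]] by measurable
  \<comment> \<open>Monotonicity is used with the covering union as the measurable set;
    measurability of the supremum event itself is not an issue.\<close>
  have "fk.prob {\<omega> \<in> space P. (SUP t\<in>{0..T}. \<bar>Y t \<omega>\<bar>) > \<epsilon>}
     \<le> fk.prob (\<Union>k<m. {\<omega> \<in> space P. \<bar>X (real (Suc k) * h) \<omega>\<bar> > \<alpha> * \<epsilon> / 2})"
    by (rule fk.finite_measure_mono[OF sub]) (use ev in auto)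
  also have "\<dots> \<le> (\<Sum>k<m. fk.prob {\<omega> \<in> space P. \<bar>X (real (Suc k) * h) \<omega>\<bar> > \<alpha> * \<epsilon> / 2})"
    by (rule fk.finite_measure_subadditive_finite) (use ev in auto)
  also have "\<dots> \<le> (\<Sum>k<m. 2 * exp (\<Lambda> * T - \<gamma> * (\<alpha> * \<epsilon> / 2)))"
    by (intro sum_mono tail h) auto
  also have "\<dots> = real m * (2 * exp (\<Lambda> * T - \<gamma> * \<alpha> * \<epsilon> / 2))" by simp
  finally show ?thesis unfolding Y_def .
qed

section \<open>Test functions, choice of constants and scales\<close>

lemma C1inf_continuous:
  fixes H :: "real \<Rightarrow> real ^ 'd::finite \<Rightarrow> real"
  assumes "H \<in> C1inf T"
  shows "continuous_on ({0..T} \<times> UNIV) (\<lambda>(t, u). H t u)"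
  using assms by (auto simp: C1inf_def)

text \<open>Compactness of [0, T] times the unit cube, which contains the rescaled sites for every
  \<open>n\<close>.\<close>

lemma C1inf_bounded:
  fixes H :: "real \<Rightarrow> real ^ 'd::finite \<Rightarrow> real"
  assumes "H \<in> C1inf T"
  obtains M where "M > 0" "\<And>s n x. 0 \<le> s \<Longrightarrow> s \<le> T \<Longrightarrow> x \<in> sites n \<Longrightarrow> \<bar>H s (embed n x)\<bar> \<le> M"
proof -
  have "compact ({0..T} \<times> cbox 0 (1 :: real ^ 'd))" by (intro compact_Times compact_Icc compact_cbox)
  moreover have "continuous_on ({0..T} \<times> cbox 0 1) (\<lambda>(t, u). H t u)"
    by (rule continuous_on_subset[OF C1inf_continuous[OF assms]]) auto
  ultimately have "bounded ((\<lambda>(t, u). H t u) ` ({0..T} \<times> cbox 0 1))"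
    by (intro compact_imp_bounded compact_continuous_image)
  then obtain M where M: "\<And>y. y \<in> (\<lambda>(t, u). H t u) ` ({0..T} \<times> cbox 0 1) \<Longrightarrow> norm y \<le> M"
    unfolding bounded_iff by blast
  have "\<bar>H s (embed n x)\<bar> \<le> max M 1" if "0 \<le> s" "s \<le> T" "x \<in> sites n" for s n x
  proof -
    have "embed n x \<in> cbox 0 1" using that(3)
      by (auto simp: mem_box_cart embed_def sites_def divide_le_eq_1 less_imp_le)
        (metis less_imp_le of_int_less_iff of_int_of_nat_eq of_nat_0_le_iff order_trans)
    then have "norm (H s (embed n x)) \<le> M" using that(1,2) by (intro M) (auto intro!: image_eqI[of _ _ "(s, embed n x)"])
    then show ?thesis by simp
  qed
  then show ?thesis by (intro that[of "max M 1"]) auto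
qed

lemma small_coupling_exists:
  assumes b: "b > 0" and d: "d > 0"
  obtains \<kappa> where "\<kappa> > 0" "small_coupling b d \<kappa>"
proof -
  define K where "K = 2 + 4 / b"
  have K: "K > 0" using b by (simp add: K_def add_pos_pos)
  \<comment> \<open>As r \<le> 1 gives r^2 \<le> r, the two quadratic conditions follow from linear
    ones, the last two members of the minimum.\<close>
  define r where "r = Min {1, b / 4, b / (4 * K), b / (8 * K\<^sup>2)}"
  have r0: "r > 0" unfolding r_def using b K by (subst Min_gr_iff) auto
  have r: "r \<le> 1" "r \<le> b / 4" "r \<le> b / (4 * K)" "r \<le> b / (8 * K\<^sup>2)" unfolding r_def by (intro Min_le; simp)+
  have r2: "r\<^sup>2 \<le> r" using r0 r(1) by (simp add: power2_eq_square mult_left_le)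
  have "K * r\<^sup>2 \<le> K * (b / (4 * K))" using K r2 r(3) by (intro mult_left_mono) auto
  then have 3: "K * r\<^sup>2 \<le> b / 4" using K by simp
  have "8 / b * K\<^sup>2 * r\<^sup>2 \<le> 8 / b * K\<^sup>2 * (b / (8 * K\<^sup>2))" using b r2 r(4) by (intro mult_left_mono) auto
  then have 4: "8 / b * K\<^sup>2 * r\<^sup>2 \<le> 1" using K b by simp
  have eq: "2 * real d * (r / (2 * real d)) = r" using d by simp
  have "small_coupling b d (r / (2 * real d))"
    unfolding small_coupling_def Let_def eq K_def[symmetric] using r 3 4 by blast
  then show ?thesis using that[of "r / (2 * real d)"] r0 d by simp
qed

text \<open>A power of \<open>n\<close> below the scale makes the logarithm of the grid size
  negligible. The case d = 1 is the tightest: there the scale equals sqrt n.\<close>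

lemma scale_lower_bound:
  assumes n: "n \<ge> 3" and d: "d \<ge> 1"
  shows "sqrt (real n) \<le> real n ^ (d - 1) * sqrt (g_scale d n)" "0 < g_scale d n"
proof -
  have "exp 1 \<le> real n" using exp_le n by linarith
  then have ln1: "1 \<le> ln (real n)" using n by (subst ln_ge_iff) auto
  show "0 < g_scale d n" using ln1 n by (auto simp: g_scale_def)
  show "sqrt (real n) \<le> real n ^ (d - 1) * sqrt (g_scale d n)"
  proof (cases "d = 1")
    case False
    have g1: "1 \<le> sqrt (g_scale d n)" using ln1 False by (auto simp: g_scale_def)
    have "sqrt (real n) \<le> real n ^ 1" using n by (simp add: real_sqrt_le_iff sqrt_le_D real_le_lsqrt power2_eq_square)
    also have "\<dots> \<le> real n ^ (d - 1)" using False d n by (intro power_increasing) auto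
    also have "\<dots> \<le> real n ^ (d - 1) * sqrt (g_scale d n)" using mult_left_mono[OF g1, of "real n ^ (d - 1)"] by simp
    finally show ?thesis .
  qed (simp add: g_scale_def)
qed

text \<open>The numerator is the logarithm of the prefactor of the union bound over a polynomial
  grid.\<close>

lemma log_over_scale_tendsto_0:
  fixes \<alpha> :: "nat \<Rightarrow> real"
  assumes "eventually (\<lambda>n. sqrt (real n) \<le> \<alpha> n) sequentially"
  shows "(\<lambda>n. (ln 2 + c * ln (real n)) / \<alpha> n) \<longlonglongrightarrow> 0"
proof (rule tendsto_rabs_zero_cancel, rule tendsto_sandwich[where f = "\<lambda>_. 0" and
      h = "\<lambda>n. \<bar>ln 2\<bar> * (1 / real n powr (1/2)) + \<bar>c\<bar> * (ln (real n) / real n powr (1/2))"])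
  have "(\<lambda>n. \<bar>ln 2\<bar> * (1 / real n powr (1/2)) + \<bar>c\<bar> * (ln (real n) / real n powr (1/2))) \<longlonglongrightarrow> \<bar>ln 2\<bar> * 0 + \<bar>c\<bar> * 0"
    by (intro tendsto_intros lim_ln_over_power lim_1_over_real_power) auto
  then show "(\<lambda>n. \<bar>ln 2\<bar> * (1 / real n powr (1/2)) + \<bar>c\<bar> * (ln (real n) / real n powr (1/2))) \<longlonglongrightarrow> 0" by simp
  show "eventually (\<lambda>n. \<bar>(ln 2 + c * ln (real n)) / \<alpha> n\<bar> \<le> \<bar>ln 2\<bar> * (1 / real n powr (1/2)) + \<bar>c\<bar> * (ln (real n) / real n powr (1/2))) sequentially"
    using assms eventually_ge_at_top[of 1]
  proof eventually_elim
    case (elim n)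
    have l: "ln (real n) \<ge> 0" using elim by simp
    have s0: "0 < sqrt (real n)" using elim by simp
    then have \<alpha>0: "\<alpha> n > 0" using elim by linarith
    have "\<bar>(ln 2 + c * ln (real n)) / \<alpha> n\<bar> \<le> (\<bar>ln 2\<bar> + \<bar>c\<bar> * ln (real n)) / \<alpha> n"
    proof -
      have "\<bar>ln 2 + c * ln (real n)\<bar> \<le> \<bar>ln 2\<bar> + \<bar>c\<bar> * ln (real n)"
        using l by (intro order_trans[OF abs_triangle_ineq]) (simp add: abs_mult)
      then show ?thesis using \<alpha>0 by (simp add: abs_divide divide_right_mono)
    qed
    also have "\<dots> \<le> (\<bar>ln 2\<bar> + \<bar>c\<bar> * ln (real n)) / sqrt (real n)"
      using elim l s0 \<alpha>0 by (intro divide_left_mono mult_pos_pos) auto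
    finally show ?case by (simp add: powr_half_sqrt add_divide_distrib)
  qed
qed (auto intro!: always_eventually)

text \<open>For \<open>p \<le> 0\<close> the left side is -\<infinity>, because \<open>c\<close> is
  positive; otherwise the logarithm is monotone.\<close>

lemma elog_le:
  assumes "p \<le> B" "B > 0" "c > 0"
  shows "ereal c * elog p \<le> ereal (c * ln B)"
  using assms by (auto simp: elog_def)

theorem lemma3p6:
  fixes T a b :: real and as :: "nat \<Rightarrow> real"
  assumes "T > 0" and "a > 0" and "b > 0"
    and "\<And>n. n \<ge> 1 \<Longrightarrow> as n > 0"
    and "much_less (\<lambda>n. real n ^ (CARD('d::finite) - 1) * sqrt (g_scale CARD('d) n)) as"
    and "much_less as (\<lambda>n. real n ^ CARD('d))"
  shows "\<exists>lam\<^sub>c>0. \<forall>lam. -lam\<^sub>c \<le> lam \<and> lam \<le> lam\<^sub>c \<and> lam > -a \<longrightarrow>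
    (\<forall>P :: nat \<Rightarrow> (real \<Rightarrow> 'd config) measure.
      (\<forall>n\<ge>1. markov_law (Omega n) (gen a b lam n) (bernoulli_config n (rho_star a b lam)) T (P n)) \<longrightarrow>
      (\<forall>H\<in>C1inf T. \<forall>i :: 'd. \<forall>\<epsilon>>0.
        (\<lambda>n. ereal (real n ^ CARD('d) / (as n)\<^sup>2) *
              elog (\<P>(\<omega> in P n.
                (SUP t\<in>{0..T}. \<bar>LBINT s:{0..t}. corr_field n (as n) (rho_star a b lam) i (H s) (\<omega> s)\<bar>) > \<epsilon>)))
          \<longlonglongrightarrow> -\<infinity>))"
proof -
  define d where "d = CARD('d)"
  define K where "K = 3 + 4 / b"
  have d: "d \<ge> 1" "d > 0" by (simp_all add: d_def Suc_le_eq)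
  obtain \<kappa> where \<kappa>: "\<kappa> > 0" "small_coupling b d \<kappa>"
    using small_coupling_exists[OF assms(3) d(2)] by blast
  \<comment> \<open>The bound a / 2 keeps the flip rates nonnegative and gives
    \<open>rho_star_lower\<close>. With that lower bound on \<rho>, the second term yields
    |\<lambda>| / (2 d \<rho>) \<le> \<kappa> / 2.\<close>
  define lc where "lc = min (a / 2) (\<kappa> * real d * (a / (a + 2 * b)))"
  have "lc > 0" using assms(2,3) \<kappa>(1) d(2) by (simp add: lc_def)
  moreover have "(\<lambda>n. ereal (real n ^ CARD('d) / (as n)\<^sup>2) *
              elog (\<P>(\<omega> in P n.
                (SUP t\<in>{0..T}. \<bar>LBINT s:{0..t}. corr_field n (as n) (rho_star a b lam) i (H s) (\<omega> s)\<bar>) > \<epsilon>)))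
          \<longlonglongrightarrow> -\<infinity>"
    if lam: "\<bar>lam\<bar> \<le> lc"
      and law: "\<And>n. n \<ge> 1 \<Longrightarrow> markov_law (Omega n) (gen a b lam n) (bernoulli_config n (rho_star a b lam)) T (P n)"
      and H: "H \<in> C1inf T" and \<epsilon>: "\<epsilon> > 0"
    for lam and P :: "nat \<Rightarrow> (real \<Rightarrow> 'd config) measure" and H and i :: 'd and \<epsilon> :: real
  proof -
    define \<rho> where "\<rho> = rho_star a b lam"
    have lam2: "\<bar>lam\<bar> \<le> a / 2" using lam by (simp add: lc_def)
    have \<rho>: "0 < \<rho>" "a / (a + 2 * b) \<le> \<rho>"
      using rho_star_props(1)[OF assms(2,3), of lam] rho_star_lower[OF assms(2,3) lam2] by (simp_all add: \<rho>_def)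
    have c: "\<bar>lam / (2 * \<rho> * real CARD('d))\<bar> \<le> \<kappa> / 2"
    proof -
      have "\<bar>lam\<bar> \<le> \<kappa> * real d * \<rho>"
        using lam mult_left_mono[OF \<rho>(2), of "\<kappa> * real d"] \<kappa>(1) by (simp add: lc_def)
      then show ?thesis using \<rho>(1) d(2) by (simp add: d_def[symmetric] abs_divide abs_mult field_simps)
    qed
    obtain M where M: "M > 0" "\<And>s n x. 0 \<le> s \<Longrightarrow> s \<le> T \<Longrightarrow> x \<in> sites n \<Longrightarrow> \<bar>H s (embed n x)\<bar> \<le> M"
      using C1inf_bounded[OF H] by blast
    have H_cont: "continuous_on {0..T} (\<lambda>s. H s u)" for u
    proof -
      have "continuous_on {0..T} ((\<lambda>(t, u). H t u) \<circ> (\<lambda>s. (s, u)))"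
        by (intro continuous_on_compose continuous_intros continuous_on_subset[OF C1inf_continuous[OF H]]) auto
      then show ?thesis by (simp add: o_def)
    qed
    \<comment> \<open>The largest constant that leaves half of \<kappa> to the defect. It does not
      depend on \<open>n\<close>, so that the tails at single times beat a polynomial number of grid
      points.\<close>
    define \<gamma> where "\<gamma> = \<kappa> / (2 * M)"
    have \<gamma>: "\<gamma> > 0" "\<gamma> * M \<le> \<kappa> / 2" using \<kappa>(1) M(1) by (simp_all add: \<gamma>_def)
    define p where "p n = \<P>(\<omega> in P n. (SUP t\<in>{0..T}. \<bar>LBINT s:{0..t}. corr_field n (as n) \<rho> i (H s) (\<omega> s)\<bar>) > \<epsilon>)" for n
    define \<Lambda> where "\<Lambda> n = spectral_const b d \<kappa> n" for n
    \<comment> \<open>The grid has n^(d+1) points: the integrand is at most n^d M / a_n with a_n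
      \<ge> 1 for large n, so the functional moves by at most M T / n within a cell.\<close>
    define B where "B n = real (n ^ (d + 1)) * (2 * exp (\<Lambda> n * T - \<gamma> * as n * \<epsilon> / 2))" for n
    define s where "s n = real n ^ (d - 1) * sqrt (g_scale d n)" for n
    have s_lim: "(\<lambda>n. s n / as n) \<longlonglongrightarrow> 0" using assms(5) by (simp add: much_less_def s_def d_def)
    have a_lim: "(\<lambda>n. as n / real n ^ d) \<longlonglongrightarrow> 0" using assms(6) by (simp add: much_less_def d_def)
    have big: "eventually (\<lambda>n. sqrt (real n) \<le> as n) sequentially"
      using order_tendstoD(2)[OF s_lim zero_less_one] eventually_ge_at_top[of 3]
    proof eventually_elim
      case (elim n)
      then have "s n < as n" using assms(4)[of n] by (simp add: divide_less_eq)
      then show ?case using scale_lower_bound(1)[OF elim(2) d(1)] by (simp add: s_def)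
    qed
    have pB: "eventually (\<lambda>n. p n \<le> B n) sequentially"
      using big eventually_ge_at_top[of 3] eventually_ge_at_top[of "nat \<lceil>2 * M * T / \<epsilon>\<rceil>"]
    proof eventually_elim
      case (elim n)
      have "1 \<le> sqrt (real n)" using elim(2) by simp
      then have a1: "1 \<le> as n" using elim(1) by linarith
      have "2 * M * T / \<epsilon> \<le> real n" using elim(3) by linarith
      then have nT: "M * T \<le> \<epsilon> / 2 * real n" using \<epsilon> by (simp add: field_simps)
      have "real n ^ d * M / as n * (T / real (n ^ (d + 1))) = M * T / (real n * as n)"
        using elim(2) by (simp add: field_simps)
      also have "\<dots> \<le> M * T / (real n * 1)"
        using a1 elim(2) M(1) assms(1) by (intro divide_left_mono mult_left_mono) auto
      also have "\<dots> \<le> \<epsilon> / 2" using nT elim(2) by (simp add: divide_le_eq)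
      finally have grid: "real n ^ d * M / as n * (T / real (n ^ (d + 1))) \<le> \<epsilon> / 2" .
      have n1: "n \<ge> 1" and a0: "as n > 0" and m1: "n ^ (CARD('d) + 1) \<ge> 1"
        using elim(2) a1 by auto
      have Hb: "\<bar>H s (embed n x)\<bar> \<le> M" if "0 \<le> s" "s \<le> T" "x \<in> sites n" for s x
        using M(2) that .
      show ?case unfolding p_def B_def \<Lambda>_def \<rho>_def d_def
        by (rule sup_tail_bound[where H = H and P = "P n" and n = n and M = M and \<kappa> = \<kappa> and T = T, OF assms(2,3) lam2 elim(2) assms(1) \<kappa>(2)[unfolded d_def] c[unfolded \<rho>_def] law[OF n1]
               H_cont Hb less_imp_le[OF M(1)] \<gamma> a0 \<epsilon> m1 grid[unfolded d_def]])
    qed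
    \<comment> \<open>The first term is n^d / a_n^2 times \<Lambda> T, which is a constant times
      (s_n / a_n)^2 and vanishes by the lower growth condition on a_n. In the second, n^d / a_n
      diverges by the upper condition, and the other factor tends to -\<gamma> \<epsilon> /
      2.\<close>
    define U where "U n = K * 20 * (real d * \<kappa>)\<^sup>2 * T * (s n / as n)\<^sup>2
        + real n ^ d / as n * ((ln 2 + real (d + 1) * ln (real n)) / as n - \<gamma> * \<epsilon> / 2)" for n
    have lnB: "eventually (\<lambda>n. real n ^ d / (as n)\<^sup>2 * ln (B n) = U n) sequentially"
      using eventually_ge_at_top[of 3]
    proof eventually_elim
      case (elim n)
      have an: "as n > 0" using assms(4)[of n] elim by simp
      have n: "real n > 0" using elim by simp
      have lnB: "ln (B n) = \<Lambda> n * T + (real (d + 1) * ln (real n) + ln 2 - \<gamma> * as n * \<epsilon> / 2)"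
        using n unfolding B_def by (simp add: ln_mult ln_realpow distrib_right)
      have "real n ^ d / (as n)\<^sup>2 * (\<Lambda> n * T) = K * 20 * (real d * \<kappa>)\<^sup>2 * T * (s n / as n)\<^sup>2"
      proof -
        have g: "(sqrt (g_scale d n))\<^sup>2 = g_scale d n" using scale_lower_bound(2)[OF elim d(1)] by simp
        have nd: "real n ^ d = real n * real n ^ (d - 1)" using d(1) by (simp add: power_eq_if)
        show ?thesis unfolding \<Lambda>_def spectral_const_def K_def[symmetric] s_def power_divide power_mult_distrib g nd
          using n an by (simp add: field_simps power2_eq_square)
      qed
      moreover have "real n ^ d / (as n)\<^sup>2 * (real (d + 1) * ln (real n) + ln 2 - \<gamma> * as n * \<epsilon> / 2)
          = real n ^ d / as n * ((ln 2 + real (d + 1) * ln (real n)) / as n - \<gamma> * \<epsilon> / 2)"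
        using an by (simp add: field_simps power2_eq_square)
      ultimately show ?case unfolding U_def lnB by (simp only: distrib_left)
    qed
    have U_lim: "filterlim U at_bot sequentially"
    proof -
      have R: "filterlim (\<lambda>n. real n ^ d / as n) at_top sequentially"
      proof -
        have "filterlim (\<lambda>n. inverse (as n / real n ^ d)) at_top sequentially"
          by (rule filterlim_inverse_at_top[OF a_lim])
             (use assms(4) in \<open>auto intro!: eventually_sequentiallyI[of 1] divide_pos_pos\<close>)
        then show ?thesis by (simp add: field_simps)
      qed
      have L: "(\<lambda>n. (ln 2 + real (d + 1) * ln (real n)) / as n - \<gamma> * \<epsilon> / 2) \<longlonglongrightarrow> 0 - \<gamma> * \<epsilon> / 2"
        by (intro tendsto_diff tendsto_const log_over_scale_tendsto_0 big)
      have "0 - \<gamma> * \<epsilon> / 2 < 0" using \<gamma>(1) \<epsilon> by simp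
      then have neg: "filterlim (\<lambda>n. ((ln 2 + real (d + 1) * ln (real n)) / as n - \<gamma> * \<epsilon> / 2) * (real n ^ d / as n)) at_bot sequentially"
        by (rule filterlim_tendsto_neg_mult_at_bot[OF L _ R])
      have lim: "(\<lambda>n. K * 20 * (real d * \<kappa>)\<^sup>2 * T * (s n / as n)\<^sup>2) \<longlonglongrightarrow> K * 20 * (real d * \<kappa>)\<^sup>2 * T * 0\<^sup>2"
        by (intro tendsto_intros s_lim)
      have "filterlim (\<lambda>n. - U n) at_top sequentially"
        using filterlim_tendsto_add_at_top[OF tendsto_minus[OF lim] neg[unfolded filterlim_uminus_at_bot]]
        by (simp add: U_def mult.commute)
      then show ?thesis unfolding filterlim_uminus_at_bot .
    qed
    have "(\<lambda>n. ereal (real n ^ d / (as n)\<^sup>2) * elog (p n)) \<longlonglongrightarrow> -\<infinity>"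
      unfolding tendsto_MInfty
    proof
      fix r :: real
      have "eventually (\<lambda>n. U n < r) sequentially"
        using U_lim unfolding filterlim_at_bot_dense by blast
      then show "eventually (\<lambda>n. ereal (real n ^ d / (as n)\<^sup>2) * elog (p n) < ereal r) sequentially"
        using pB lnB eventually_ge_at_top[of 1]
      proof eventually_elim
        case (elim n)
        have "B n > 0" using elim(4) by (simp add: B_def)
        moreover have "real n ^ d / (as n)\<^sup>2 > 0" using elim(4) assms(4)[OF elim(4)] by simp
        ultimately have "ereal (real n ^ d / (as n)\<^sup>2) * elog (p n) \<le> ereal (U n)"
          using elog_le[OF elim(2), of "real n ^ d / (as n)\<^sup>2"] elim(3) by simp
        also have "\<dots> < ereal r" using elim(1) by simp
        finally show ?case .
      qed
    qed
    then show ?thesis by (simp add: p_def d_def \<rho>_def)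
  qed
  ultimately show ?thesis by (intro exI[of _ lc]) (auto simp: abs_le_iff)
qed

end
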